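(* Let $(\beta_p)_{p\ge 2}$ be real numbers with $\sum_{p\ge2}2^p\beta_p^2<\infty$, and let $\xi(u)=\sum_{p\ge 2}\beta_p^2u^p$. Suppose that $$\xi(1)>\max\left(8\log2,\ \frac13\sqrt{\xi'(1)}\;2^{\frac{\xi'(1)}{\xi(1)}+5}\right).$$ Then a Parisi measure $\mu_P$ for $\xi$ (a minimizer over $M[0,1]$ of the Parisi functional $\mathcal P$) is neither Replica Symmetric (a Dirac measure) nor One Replica Symmetry Breaking (a measure consisting of exactly two atoms).
   Context: $M[0,1]$ is the set of Borel probability measures on $[0,1]$ with the metric $d(\mu,\mu')=\int_0^1|\mu([0,u])-\mu'([0,u])|\,du$; $M_d[0,1]\subset M[0,1]$ is the subset of measures with finitely many atoms (and nothing else). Parisi PDE solution. For $\mu\in M_d[0,1]$ with atoms $0\le q_1<\dots<q_{k+1}\le 1$ ($k\ge0$), put $m_p=\mu([0,q_p])$ for $1\le p\le k+1$, $m_0=0$, $q_0=0$, $q_{k+2}=1$. Define $\Phi_\mu:\mathbb R\times[0,1]\to\mathbb R$ by $\Phi_\mu(x,u)=\log\cosh x+\frac12(\xi'(1)-\xi'(u))$ for $q_{k+1}\le u\le1$ and recursively, for $p=k,k-1,\dots,0$ and $q_p\le u<q_{p+1}$, $$\Phi_\mu(x,u)=\frac1{m_p}\log\mathbb E\exp m_p\Phi_\mu\big(x+z\sqrt{\xi'(q_{p+1})-\xi'(u)},\,q_{p+1}\big),$$ $z$ a standard Gaussian, where for $m_p=0$ the right side means $\mathbb E\,\Phi_\mu(x+z\sqrt{\xi'(q_{p+1})-\xi'(u)},q_{p+1})$.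 (This solves $\partial_u\Phi_\mu=-\frac{\xi''(u)}2(\partial_x^2\Phi_\mu+\mu([0,u])(\partial_x\Phi_\mu)^2)$ with $\Phi_\mu(x,1)=\log\cosh x$.) The map $\mu\mapsto\Phi_\mu$ is known to be Lipschitz from $(M_d[0,1],d)$ to $C(\mathbb R\times[0,1])$ with the uniform distance, and $\Phi_\mu$ for general $\mu\in M[0,1]$ is defined by continuous extension. Parisi functional: $\mathcal P(\mu)=\Phi_\mu(0,0)-\frac12\int_0^1u\,\xi''(u)\,\mu([0,u])\,du$ for $\mu\in M[0,1]$. A Parisi measure is any minimizer of $\mathcal P$ on $M[0,1]$. *)

theory Defs
  imports "HOL-Probability.Probability"
begin

definition mixture :: "(nat \<Rightarrow> real) \<Rightarrow> real \<Rightarrow> real" where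
  "mixture \<beta> u = (\<Sum>p. (\<beta> (p + 2))\<^sup>2 * u ^ (p + 2))"

abbreviation borel01 :: "real measure" where
  "borel01 \<equiv> restrict_space borel {0..1}"

definition prob_measures :: "real measure set" where
  "prob_measures = {\<mu>. prob_space \<mu> \<and> sets \<mu> = sets borel01}"

definition cdf_dist :: "real measure \<Rightarrow> real measure \<Rightarrow> real" where
  "cdf_dist \<mu> \<nu> = (LBINT u:{0..1}. \<bar>measure \<mu> {0..u} - measure \<nu> {0..u}\<bar>)"

definition atoms :: "real measure \<Rightarrow> real set" where
  "atoms \<mu> = {q \<in> {0..1}. measure \<mu> {q} > 0}"

definition discrete_measures :: "real measure set" where
  "discrete_measures =
    {\<mu> \<in> prob_measures. finite (atoms \<mu>) \<and> measure \<mu> (atoms \<mu>) = 1}"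

definition gauss_step :: "real \<Rightarrow> real \<Rightarrow> (real \<Rightarrow> real) \<Rightarrow> real \<Rightarrow> real" where
  "gauss_step m s f x =
    (if m = 0 then (LINT z|std_normal_distribution. f (x + z * sqrt s))
     else 1 / m * ln (LINT z|std_normal_distribution. exp (m * f (x + z * sqrt s))))"

text \<open>
  In \<open>Phi_rec \<xi> F m qs x u\<close> the list \<open>qs\<close> contains, in increasing order, the atoms
  \<open>q\<^sub>p\<^sub>+\<^sub>1 < \<dots> < q\<^sub>k\<^sub>+\<^sub>1\<close> above the current level \<open>p\<close>, the function
  \<open>F\<close> is \<open>q \<mapsto> \<mu>([0,q])\<close>, and \<open>m\<close> is the weight \<open>m\<^sub>p\<close> that applies on
  \<open>q\<^sub>p \<le> u < q\<^sub>p\<^sub>+\<^sub>1\<close>. If \<open>u \<ge> q\<^sub>p\<^sub>+\<^sub>1\<close>, the value is determined at a higher level.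
\<close>

fun Phi_rec ::
  "(real \<Rightarrow> real) \<Rightarrow> (real \<Rightarrow> real) \<Rightarrow> real \<Rightarrow> real list \<Rightarrow> real \<Rightarrow> real \<Rightarrow> real" where
  "Phi_rec \<xi> F m [] x u = ln (cosh x) + (deriv \<xi> 1 - deriv \<xi> u) / 2"
| "Phi_rec \<xi> F m (q # qs) x u =
    (if u < q
     then gauss_step m (deriv \<xi> q - deriv \<xi> u) (\<lambda>y. Phi_rec \<xi> F (F q) qs y q) x
     else Phi_rec \<xi> F (F q) qs x u)"

definition Phi_discrete :: "(real \<Rightarrow> real) \<Rightarrow> real measure \<Rightarrow> real \<times> real \<Rightarrow> real" where
  "Phi_discrete \<xi> \<mu> = (\<lambda>(x, u).
    Phi_rec \<xi> (\<lambda>q. measure \<mu> {0..q}) 0 (sorted_list_of_set (atoms \<mu>)) x u)"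

text \<open>
  The extension of \<open>\<mu> \<mapsto> \<Phi>\<^sub>\<mu>\<close> from discrete to arbitrary measures: off the discrete measures
  it is the limit, uniformly on \<open>\<real> \<times> [0,1]\<close>, of \<open>\<Phi>\<^sub>\<nu>\<close> as \<open>\<nu>\<close> runs through the
  discrete measures and the distance from \<open>\<nu>\<close> to \<open>\<mu>\<close> tends to 0. The limit is determined only on
  \<open>\<real> \<times> [0,1]\<close>; values at other points are irrelevant.
\<close>

definition Phi :: "(real \<Rightarrow> real) \<Rightarrow> real measure \<Rightarrow> real \<times> real \<Rightarrow> real" where
  "Phi \<xi> \<mu> =
    (if \<mu> \<in> discrete_measures then Phi_discrete \<xi> \<mu>
     else SOME \<Phi>. uniform_limit (UNIV \<times> {0..1}) (Phi_discrete \<xi>) \<Phi>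
       (inf (filtercomap (\<lambda>\<nu>. cdf_dist \<nu> \<mu>) (nhds 0)) (principal discrete_measures)))"

definition parisi_functional :: "(real \<Rightarrow> real) \<Rightarrow> real measure \<Rightarrow> real" where
  "parisi_functional \<xi> \<mu> =
    Phi \<xi> \<mu> (0, 0) - 1 / 2 * (LBINT u:{0..1}. u * deriv (deriv \<xi>) u * measure \<mu> {0..u})"

definition parisi_measure :: "(real \<Rightarrow> real) \<Rightarrow> real measure \<Rightarrow> bool" where
  "parisi_measure \<xi> \<mu> \<longleftrightarrow>
    \<mu> \<in> prob_measures \<and> (\<forall>\<nu>\<in>prob_measures. parisi_functional \<xi> \<mu> \<le> parisi_functional \<xi> \<nu>)"

definition replica_symmetric :: "real measure \<Rightarrow> bool" where
  "replica_symmetric \<mu> \<longleftrightarrow> (\<exists>q\<in>{0..1}. \<mu> = return borel01 q)"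

definition one_step_rsb :: "real measure \<Rightarrow> bool" where
  "one_step_rsb \<mu> \<longleftrightarrow> \<mu> \<in> discrete_measures \<and> card (atoms \<mu>) = 2"

end

theory Submission
  imports Defs "HOL-Real_Asymp.Real_Asymp"
begin

text \<open>
  If the lowest atom \<open>a\<close> of a candidate is positive, moving it to the right shows
  \<open>E (\<partial>\<^sub>x\<Phi>)\<^sup>2 \<le> a\<close>. Moving a little mass from \<open>a\<close> to \<open>0\<close> changes the functional to first order by
  a multiple of \<open>Var \<Phi> - \<theta> a\<close>, where \<open>\<theta> u = u \<xi>' u - \<xi> u \<ge> u \<xi>' u / 2\<close>. As \<open>\<Phi>\<close> is even, the
  Poincare inequality holds with the second eigenvalue, strictly, so this variation is negative.
  Hence \<open>a = 0\<close>. The Dirac measure at \<open>0\<close> loses against the random energy model measure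
  \<open>m \<delta>\<^sub>0 + (1 - m) \<delta>\<^sub>1\<close>.

  For \<open>m \<delta>\<^sub>0 + (1 - m) \<delta>\<^sub>q\<close>, varying \<open>m\<close> gives \<open>m\<^sup>2 \<xi> q \<le> 2 ln 2\<close>, and comparison with the random
  energy model gives \<open>\<xi> q \<approx> \<xi> 1\<close>. Moving \<open>q\<close> to the left, and splitting \<open>q\<close> into two atoms,
  gives the stability condition \<open>\<xi>'' q * E cosh\<^sup>m\<^sup>-\<^sup>4 \<le> E cosh\<^sup>m\<close>, all at \<open>sqrt (\<xi>' q) z\<close>. But
  \<open>E cosh\<^sup>m \<le> 2 * 2 powr (\<xi>' q / \<xi> q)\<close> and \<open>E cosh\<^sup>-\<^sup>4 \<ge> 1 / sqrt (1 + 4 \<xi>' q)\<close>, which the hypothesis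
  on \<open>\<xi> 1\<close> contradicts.
\<close>

section \<open>Gaussian expectations\<close>

text \<open>The factor 1/2 in \<open>\<theta> u \<ge> u \<xi>' u / 2\<close> is due to the term of
  degree 2 and is attained by a pure 2-spin model. The Gaussian Poincare constant 1 would therefore
  miss by a factor of two, and the constant 1/2 for even functions suffices only because it is
  strict; hence a separate inequality with its equality case. Derivatives of the functional are
  replaced by one-sided estimates: the log-moment is jointly convex in position and standard
  deviation, so moving an atom is controlled by the tangent at the displaced point, and changes of
  mass by convexity or Taylor bounds, with a limit at the end. Splitting \<open>q\<close> is
  delicate, because at a stationary atom the gain of order \<open>r ^ 2\<close> (where
  \<open>r\<^sup>2 = \<xi>' q' - \<xi>' q\<close>) vanishes. The sign is decided at order
  \<open>r ^ 4\<close>, so \<open>ln cosh\<close> is expanded to fourth order. The power of 2 in the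
  hypothesis comes from the Gaussian factor \<open>exp (m\<^sup>2 * \<xi>' q / 2)\<close> of the
  normalising moment, which \<open>m\<^sup>2 * \<xi> q \<le> 2 * ln 2\<close> bounds by
  \<open>2 powr (\<xi>' q / \<xi> q)\<close>.\<close>

abbreviation gE :: "(real \<Rightarrow> real) \<Rightarrow> real" where
  "gE f \<equiv> integral\<^sup>L std_normal_distribution f"

text \<open>A class of integrands closed under sums, products, powers and affine substitution and
  integrable against the Gaussian, so that side conditions on expectations follow from the shape of
  the term.\<close>

definition exp_growth :: "(real \<Rightarrow> real) \<Rightarrow> bool" where
  "exp_growth f \<longleftrightarrow> f \<in> borel_measurable borel \<and> (\<exists>C K. \<forall>z. \<bar>f z\<bar> \<le> C * exp (K * \<bar>z\<bar>))"

lemma prob_space_gauss: "prob_space std_normal_distribution"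
  by (simp add: prob_space_normal_density)

interpretation gauss: prob_space std_normal_distribution
  by (rule prob_space_gauss)

text \<open>Completing the square: an exponential factor shifts the mean. Source of the exponential
  moments and of \<open>gE_shift\<close>.\<close>

lemma gauss_exp_density:
  "std_normal_density z * exp (a * z) = exp (a\<^sup>2 / 2) * normal_density a 1 z"
proof -
  have "std_normal_density z * exp (a * z) = exp (- z\<^sup>2 / 2 + a * z) / sqrt (2 * pi)"
    by (simp add: normal_density_def exp_add[symmetric])
  also have "- z\<^sup>2 / 2 + a * z = a\<^sup>2 / 2 + - (z - a)\<^sup>2 / 2"
    by (simp add: power2_eq_square field_simps)
  finally show ?thesis
    by (simp only: exp_add) (simp add: normal_density_def)
qed

lemma gE_lborel:
  assumes "f \<in> borel_measurable borel"
  shows "gE f = (\<integral>x. std_normal_density x * f x \<partial>lborel)"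
  using assms by (subst integral_density) auto

lemma integrable_gauss_iff:
  assumes "f \<in> borel_measurable borel"
  shows "integrable std_normal_distribution f \<longleftrightarrow> integrable lborel (\<lambda>x. std_normal_density x * f x)"
  using assms by (subst integrable_density) auto

lemma integrable_gauss_exp: "integrable std_normal_distribution (\<lambda>z. exp (a * z))"
  by (subst integrable_gauss_iff) (auto simp: gauss_exp_density)

lemma gE_exp: "gE (\<lambda>z. exp (a * z)) = exp (a\<^sup>2 / 2)"
  by (subst gE_lborel) (auto simp: gauss_exp_density)

lemma integrable_gauss_exp_abs: "integrable std_normal_distribution (\<lambda>z. exp (K * \<bar>z\<bar>))"
proof (rule Bochner_Integration.integrable_bound)
  show "integrable std_normal_distribution (\<lambda>z. exp (K * z) + exp (- K * z))"
    by (intro Bochner_Integration.integrable_add integrable_gauss_exp)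
  show "AE z in std_normal_distribution. norm (exp (K * \<bar>z\<bar>)) \<le> norm (exp (K * z) + exp (- K * z))"
  proof (rule AE_I2)
    fix z :: real
    have "exp (K * \<bar>z\<bar>) \<le> exp (K * z) + exp (- K * z)"
      by (cases "z \<ge> 0") (auto simp: add_increasing add_increasing2)
    then show "norm (exp (K * \<bar>z\<bar>)) \<le> norm (exp (K * z) + exp (- K * z))" by simp
  qed
qed auto

lemma exp_growthI:
  assumes "f \<in> borel_measurable borel" "\<And>z. \<bar>f z\<bar> \<le> C * exp (K * \<bar>z\<bar>)"
  shows "exp_growth f"
  using assms unfolding exp_growth_def by blast

lemma exp_growthE:
  assumes "exp_growth f"
  obtains C K where "C \<ge> 0" "K \<ge> 0" "\<And>z. \<bar>f z\<bar> \<le> C * exp (K * \<bar>z\<bar>)"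
proof -
  obtain C K where *: "\<And>z. \<bar>f z\<bar> \<le> C * exp (K * \<bar>z\<bar>)"
    using assms unfolding exp_growth_def by blast
  have "\<bar>f z\<bar> \<le> \<bar>C\<bar> * exp (\<bar>K\<bar> * \<bar>z\<bar>)" for z
  proof -
    have "C * exp (K * \<bar>z\<bar>) \<le> \<bar>C\<bar> * exp (\<bar>K\<bar> * \<bar>z\<bar>)"
      by (intro mult_mono) (auto intro!: mult_right_mono)
    then show ?thesis using *[of z] by linarith
  qed
  then show ?thesis using that[of "\<bar>C\<bar>" "\<bar>K\<bar>"] by auto
qed

lemma exp_growth_meas: "exp_growth f \<Longrightarrow> f \<in> borel_measurable borel"
  unfolding exp_growth_def by blast

lemma exp_growth_integrable:
  assumes "exp_growth f" shows "integrable std_normal_distribution f"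
proof -
  obtain C K where *: "C \<ge> 0" "\<And>z. \<bar>f z\<bar> \<le> C * exp (K * \<bar>z\<bar>)"
    using assms by (elim exp_growthE) blast
  show ?thesis
  proof (rule Bochner_Integration.integrable_bound)
    show "integrable std_normal_distribution (\<lambda>z. C * exp (K * \<bar>z\<bar>))"
      by (intro integrable_mult_right integrable_gauss_exp_abs)
    show "AE z in std_normal_distribution. norm (f z) \<le> norm (C * exp (K * \<bar>z\<bar>))"
      using * by auto
  qed (use assms in \<open>auto simp: exp_growth_def\<close>)
qed

lemma exp_growth_bounded:
  assumes "f \<in> borel_measurable borel" "\<And>z. \<bar>f z\<bar> \<le> C"
  shows "exp_growth f"
  by (rule exp_growthI[where C=C and K=0]) (use assms in auto)

lemma exp_growth_const: "exp_growth (\<lambda>z. c)"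
  by (rule exp_growth_bounded[where C="\<bar>c\<bar>"]) auto

lemma exp_growth_mult:
  assumes "exp_growth f" "exp_growth g" shows "exp_growth (\<lambda>z. f z * g z)"
proof -
  obtain C K where f: "C \<ge> 0" "\<And>z. \<bar>f z\<bar> \<le> C * exp (K * \<bar>z\<bar>)"
    using assms(1) by (elim exp_growthE) blast
  obtain D L where g: "D \<ge> 0" "\<And>z. \<bar>g z\<bar> \<le> D * exp (L * \<bar>z\<bar>)"
    using assms(2) by (elim exp_growthE) blast
  show ?thesis
  proof (rule exp_growthI[where C="C*D" and K="K+L"])
    show "\<bar>f z * g z\<bar> \<le> C * D * exp ((K + L) * \<bar>z\<bar>)" for z
    proof -
      have "\<bar>f z\<bar> * \<bar>g z\<bar> \<le> (C * exp (K * \<bar>z\<bar>)) * (D * exp (L * \<bar>z\<bar>))"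
        using f(1) by (intro mult_mono f g) auto
      also have "\<dots> = C * D * exp ((K + L) * \<bar>z\<bar>)"
        unfolding distrib_right exp_add by (simp only: mult_ac)
      finally show ?thesis by (simp add: abs_mult)
    qed
  qed (use assms in \<open>auto simp: exp_growth_def\<close>)
qed

lemma exp_growth_add:
  assumes "exp_growth f" "exp_growth g" shows "exp_growth (\<lambda>z. f z + g z)"
proof -
  obtain C K where f: "C \<ge> 0" "\<And>z. \<bar>f z\<bar> \<le> C * exp (K * \<bar>z\<bar>)" "K \<ge> 0"
    using assms(1) by (elim exp_growthE) blast
  obtain D L where g: "D \<ge> 0" "\<And>z. \<bar>g z\<bar> \<le> D * exp (L * \<bar>z\<bar>)" "L \<ge> 0"
    using assms(2) by (elim exp_growthE) blast
  show ?thesis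
  proof (rule exp_growthI[where C="C+D" and K="K+L"])
    show "\<bar>f z + g z\<bar> \<le> (C + D) * exp ((K + L) * \<bar>z\<bar>)" for z
    proof -
      have "C * exp (K * \<bar>z\<bar>) \<le> C * exp ((K + L) * \<bar>z\<bar>)"
        using f g by (intro mult_left_mono) (auto intro!: mult_right_mono)
      moreover have "D * exp (L * \<bar>z\<bar>) \<le> D * exp ((K + L) * \<bar>z\<bar>)"
        using f g by (intro mult_left_mono) (auto intro!: mult_right_mono)
      ultimately show ?thesis using f(2)[of z] g(2)[of z] by (subst distrib_right) linarith
    qed
  qed (use assms in \<open>auto simp: exp_growth_def\<close>)
qed

lemma exp_growth_ident: "exp_growth (\<lambda>z. z)"
proof (rule exp_growthI[where C=1 and K=1])
  show "\<bar>z\<bar> \<le> 1 * exp (1 * \<bar>z\<bar>)" for z :: real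
    using exp_ge_add_one_self[of "\<bar>z\<bar>"] by (simp del: exp_ge_add_one_self)
qed auto

lemma exp_growth_abs: "exp_growth f \<Longrightarrow> exp_growth (\<lambda>z. \<bar>f z\<bar>)"
  unfolding exp_growth_def by auto

lemma exp_growth_exp_abs: "exp_growth (\<lambda>z. exp (K * \<bar>z\<bar>))"
  by (rule exp_growthI[where C=1 and K=K]) auto

lemma exp_growth_exp: "exp_growth (\<lambda>z. exp (K * z))"
  by (rule exp_growthI[where C=1 and K="\<bar>K\<bar>"]) (auto simp: abs_mult[symmetric])

lemma exp_growth_uminus: "exp_growth f \<Longrightarrow> exp_growth (\<lambda>z. - f z)"
  unfolding exp_growth_def by auto

lemma exp_growth_diff:
  assumes "exp_growth f" "exp_growth g" shows "exp_growth (\<lambda>z. f z - g z)"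
  using exp_growth_add[OF assms(1) exp_growth_uminus[OF assms(2)]] by simp

lemma exp_growth_power: "exp_growth f \<Longrightarrow> exp_growth (\<lambda>z. f z ^ n)"
  by (induction n) (auto intro: exp_growth_const exp_growth_mult)

lemma exp_growth_divide: "exp_growth f \<Longrightarrow> exp_growth (\<lambda>z. f z / c)"
  using exp_growth_mult[OF _ exp_growth_const[of "1/c"], of f] by simp

lemma exp_growth_mono:
  assumes "exp_growth g" "f \<in> borel_measurable borel" "\<And>z. \<bar>f z\<bar> \<le> g z"
  shows "exp_growth f"
proof -
  obtain C K where f: "C \<ge> 0" "\<And>z. \<bar>g z\<bar> \<le> C * exp (K * \<bar>z\<bar>)" "K \<ge> 0"
    using assms(1) by (elim exp_growthE) blast
  have "\<bar>f z\<bar> \<le> C * exp (K * \<bar>z\<bar>)" for z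
    using f(2)[of z] assms(3)[of z] by linarith
  then show ?thesis using assms(2) by (rule exp_growthI[rotated])
qed

lemma exp_growth_affine:
  assumes "exp_growth f" shows "exp_growth (\<lambda>z. f (a + b * z))"
proof -
  obtain C K where f: "C \<ge> 0" "\<And>z. \<bar>f z\<bar> \<le> C * exp (K * \<bar>z\<bar>)" "K \<ge> 0"
    using assms(1) by (elim exp_growthE) blast
  show ?thesis
  proof (rule exp_growthI[where C="C * exp (K * \<bar>a\<bar>)" and K="K * \<bar>b\<bar>"])
    show "(\<lambda>z. f (a + b * z)) \<in> borel_measurable borel"
      using exp_growth_meas[OF assms] by measurable
    fix z
    have "\<bar>f (a + b * z)\<bar> \<le> C * exp (K * \<bar>a + b * z\<bar>)" by (rule f)
    also have "\<dots> \<le> C * exp (K * (\<bar>a\<bar> + \<bar>b\<bar> * \<bar>z\<bar>))"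
      using f abs_triangle_ineq[of a "b * z"]
      by (intro mult_left_mono) (auto intro!: mult_left_mono simp: abs_mult)
    finally show "\<bar>f (a + b * z)\<bar> \<le> C * exp (K * \<bar>a\<bar>) * exp (K * \<bar>b\<bar> * \<bar>z\<bar>)"
      by (simp add: exp_add distrib_left mult_ac)
  qed
qed

lemmas exp_growth_intros = exp_growth_const exp_growth_mult exp_growth_add exp_growth_ident
  exp_growth_abs exp_growth_exp_abs exp_growth_exp exp_growth_uminus exp_growth_diff
  exp_growth_power exp_growth_divide

lemma gE_mono:
  assumes "exp_growth f" "exp_growth g" "\<And>z. f z \<le> g z" shows "gE f \<le> gE g"
  using assms by (intro integral_mono exp_growth_integrable) auto

lemma gE_nonneg: "(\<And>z. 0 \<le> f z) \<Longrightarrow> 0 \<le> gE f"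
  by (intro integral_nonneg_AE) auto

lemma gE_add: "exp_growth f \<Longrightarrow> exp_growth g \<Longrightarrow> gE (\<lambda>z. f z + g z) = gE f + gE g"
  by (intro Bochner_Integration.integral_add exp_growth_integrable)

lemma gE_diff: "exp_growth f \<Longrightarrow> exp_growth g \<Longrightarrow> gE (\<lambda>z. f z - g z) = gE f - gE g"
  by (intro Bochner_Integration.integral_diff exp_growth_integrable)

lemma gE_const: "gE (\<lambda>z. c) = c"
  using gauss.prob_space by simp

lemma gE_abs_le:
  assumes f: "f \<in> borel_measurable borel" and "exp_growth g" "\<And>z. \<bar>f z\<bar> \<le> g z"
  shows "\<bar>gE f\<bar> \<le> gE g"
proof -
  have "\<bar>gE f\<bar> \<le> gE (\<lambda>z. \<bar>f z\<bar>)" by (rule integral_abs_bound)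
  also have "\<dots> \<le> gE g"
    by (rule gE_mono) (use assms f in \<open>auto intro: exp_growth_abs exp_growth_mono\<close>)
  finally show ?thesis .
qed

text \<open>Cameron-Martin formula; it turns the weight \<open>cosh\<close> into a mixture of two
  shifted Gaussians in \<open>tilt_1\<close>.\<close>

lemma gE_shift:
  assumes "exp_growth f"
  shows "gE (\<lambda>z. f z * exp (h * z)) = exp (h\<^sup>2 / 2) * gE (\<lambda>z. f (z + h))"
proof -
  note [measurable] = exp_growth_meas[OF assms]
  have "gE (\<lambda>z. f z * exp (h * z)) = (\<integral>x. std_normal_density x * (f x * exp (h * x)) \<partial>lborel)"
    by (rule gE_lborel) measurable
  also have "\<dots> = (\<integral>x. exp (h\<^sup>2 / 2) * (normal_density h 1 x * f x) \<partial>lborel)"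
  proof (rule Bochner_Integration.integral_cong)
    show "std_normal_density x * (f x * exp (h * x)) = exp (h\<^sup>2 / 2) * (normal_density h 1 x * f x)" for x
      using gauss_exp_density[of x h] by (simp add: mult_ac)
  qed (rule refl)
  also have "\<dots> = exp (h\<^sup>2 / 2) * (\<integral>x. normal_density h 1 x * f x \<partial>lborel)"
    by simp
  also have "(\<integral>x. normal_density h 1 x * f x \<partial>lborel) = (\<integral>x. normal_density h 1 (h + 1 * x) * f (h + 1 * x) \<partial>lborel)"
    using lborel_integral_real_affine[of 1 "\<lambda>x. normal_density h 1 x * f x" h] by simp
  also have "\<dots> = (\<integral>x. std_normal_density x * f (x + h) \<partial>lborel)"
    by (rule Bochner_Integration.integral_cong) (auto simp: normal_density_def add_ac)
  also have "\<dots> = gE (\<lambda>z. f (z + h))"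
    by (rule gE_lborel[symmetric]) measurable
  finally show ?thesis .
qed

lemma gE_moments:
  "gE (\<lambda>z. z) = 0" "gE (\<lambda>z. z ^ 2) = 1" "gE (\<lambda>z. z ^ 3) = 0" "gE (\<lambda>z. z ^ 4) = 3"
proof -
  show "gE (\<lambda>z. z) = 0"
    using integral_std_normal_moment_odd[of 0] by (subst gE_lborel) auto
  show "gE (\<lambda>z. z ^ 2) = 1"
    using integral_std_normal_moment_even[of 1] by (subst gE_lborel) auto
  show "gE (\<lambda>z. z ^ 3) = 0"
    using integral_std_normal_moment_odd[of 1] by (subst gE_lborel) auto
  show "gE (\<lambda>z. z ^ 4) = 3"
    using integral_std_normal_moment_even[of 2] by (subst gE_lborel) (auto simp: fact_numeral)
qed

lemma gE_exp_neg_square: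
  assumes "a \<ge> 0"
  shows "gE (\<lambda>z. exp (- a * z\<^sup>2)) = 1 / sqrt (1 + 2 * a)"
proof -
  define \<sigma> where "\<sigma> = 1 / sqrt (1 + 2 * a)"
  have pos: "\<sigma> > 0" using assms by (simp add: \<sigma>_def)
  have s2: "\<sigma>\<^sup>2 = 1 / (1 + 2 * a)" using assms by (simp add: \<sigma>_def power_divide)
  have "std_normal_density x * exp (- a * x\<^sup>2) = \<sigma> * normal_density 0 \<sigma> x" for x
  proof -
    have e: "- x\<^sup>2 / 2 + - a * x\<^sup>2 = - x\<^sup>2 / (2 * \<sigma>\<^sup>2)"
      using assms unfolding s2 by (simp add: divide_simps) (simp add: algebra_simps)
    have "std_normal_density x * exp (- a * x\<^sup>2) = exp (- x\<^sup>2 / (2 * \<sigma>\<^sup>2)) / sqrt (2 * pi)"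
      using e by (simp add: normal_density_def exp_add[symmetric])
    also have "\<dots> = \<sigma> * normal_density 0 \<sigma> x"
      using pos by (simp add: normal_density_def real_sqrt_mult)
    finally show ?thesis .
  qed
  then have "gE (\<lambda>z. exp (- a * z\<^sup>2)) = (\<integral>x. \<sigma> * normal_density 0 \<sigma> x \<partial>lborel)"
    by (subst gE_lborel) auto
  also have "\<dots> = \<sigma>" using pos by simp
  finally show ?thesis by (simp add: \<sigma>_def)
qed

section \<open>Limits, derivatives and integration by parts under the Gaussian expectation\<close>

lemma gE_tendsto:
  assumes "\<And>n. f n \<in> borel_measurable borel" "l \<in> borel_measurable borel"
    and "exp_growth g" "\<And>n z. \<bar>f n z\<bar> \<le> g z" "\<And>z. (\<lambda>n. f n z) \<longlonglongrightarrow> l z"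
  shows "(\<lambda>n. gE (f n)) \<longlonglongrightarrow> gE l"
  by (rule integral_dominated_convergence[where w=g])
     (use assms in \<open>auto intro: exp_growth_integrable\<close>)

text \<open>Dominated convergence for difference quotients. The mean value theorem turns each
  quotient into a value of \<open>F'\<close> within distance 1 of \<open>x0\<close>, so an envelope
  on that ball suffices; the sequence is started late enough to stay there.\<close>

lemma gE_has_derivative:
  fixes F F' :: "real \<Rightarrow> real \<Rightarrow> real"
  assumes d: "\<And>x z. ((\<lambda>x. F x z) has_real_derivative F' x z) (at x)"
    and F: "\<And>x. exp_growth (F x)" and F': "F' x0 \<in> borel_measurable borel"
    and g: "exp_growth g" "\<And>x z. \<bar>x - x0\<bar> \<le> 1 \<Longrightarrow> \<bar>F' x z\<bar> \<le> g z"
  shows "((\<lambda>x. gE (F x)) has_real_derivative gE (F' x0)) (at x0)"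
  unfolding has_field_derivative_iff tendsto_at_iff_sequentially comp_def
proof (intro allI impI)
  fix X :: "nat \<Rightarrow> real"
  assume X: "\<forall>i. X i \<in> UNIV - {x0}" "X \<longlonglongrightarrow> x0"
  have "\<forall>\<^sub>F i in sequentially. \<bar>X i - x0\<bar> < 1"
    using X(2) by (auto simp: tendsto_iff dist_real_def)
  then obtain n0 where n0: "\<And>i. i \<ge> n0 \<Longrightarrow> \<bar>X i - x0\<bar> < 1"
    unfolding eventually_sequentially by blast
  define q where "q = (\<lambda>i z. (F (X (i + n0)) z - F x0 z) / (X (i + n0) - x0))"
  have eq: "gE (q i) = (gE (F (X (i + n0))) - gE (F x0)) / (X (i + n0) - x0)" for i
    unfolding q_def by (simp add: gE_diff F)
  have "(\<lambda>i. gE (q i)) \<longlonglongrightarrow> gE (F' x0)"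
  proof (rule gE_tendsto[OF _ F' g(1)])
    show "q i \<in> borel_measurable borel" for i
      unfolding q_def using exp_growth_meas[OF F] by measurable
    fix i z
    have ne: "X (i + n0) \<noteq> x0" using X(1) by auto
    have "\<bar>X (i + n0) - x0\<bar> \<le> 1" using n0[of "i + n0"] by simp
    define u where "u = X (i + n0)"
    have "\<exists>\<zeta>. \<bar>\<zeta> - x0\<bar> \<le> 1 \<and> q i z = F' \<zeta> z"
    proof (cases "x0 < u")
      case True
      then obtain \<zeta> where "x0 < \<zeta>" "\<zeta> < u" "F u z - F x0 z = (u - x0) * F' \<zeta> z"
        using MVT2[of x0 u "\<lambda>x. F x z" "\<lambda>x. F' x z"] d by blast
      then show ?thesis using True \<open>\<bar>X (i + n0) - x0\<bar> \<le> 1\<close>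
        by (intro exI[of _ \<zeta>]) (auto simp: q_def u_def[symmetric])
    next
      case False
      then have "u < x0" using ne u_def by auto
      then obtain \<zeta> where "u < \<zeta>" "\<zeta> < x0" "F x0 z - F u z = (x0 - u) * F' \<zeta> z"
        using MVT2[of u x0 "\<lambda>x. F x z" "\<lambda>x. F' x z"] d by blast
      moreover from this have "F u z - F x0 z = (u - x0) * F' \<zeta> z" by (simp add: algebra_simps)
      ultimately show ?thesis using \<open>u < x0\<close> \<open>\<bar>X (i + n0) - x0\<bar> \<le> 1\<close>
        by (intro exI[of _ \<zeta>]) (auto simp: q_def u_def[symmetric])
    qed
    then show "\<bar>q i z\<bar> \<le> g z" using g(2) by metis
  next
    fix z
    have "((\<lambda>x. (F x z - F x0 z) / (x - x0)) \<longlongrightarrow> F' x0 z) (at x0)"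
      using d[where x=x0 and z=z] unfolding has_field_derivative_iff .
    moreover have "filterlim (\<lambda>i. X (i + n0)) (at x0) sequentially"
      using X LIMSEQ_ignore_initial_segment[OF X(2), of n0] by (auto simp: filterlim_at)
    ultimately show "(\<lambda>i. q i z) \<longlonglongrightarrow> F' x0 z"
      unfolding q_def by (rule filterlim_compose)
  qed
  then have "(\<lambda>i. (gE (F (X (i + n0))) - gE (F x0)) / (X (i + n0) - x0)) \<longlonglongrightarrow> gE (F' x0)"
    unfolding eq .
  then show "(\<lambda>i. (gE (F (X i)) - gE (F x0)) / (X i - x0)) \<longlonglongrightarrow> gE (F' x0)"
    by (rule LIMSEQ_offset)
qed

text \<open>Fundamental theorem on growing intervals. A finite exceptional set is allowed because
  the function used for the Poincare inequality is only shown to be continuous at 1 and -1.\<close>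

lemma integral_lborel_derivative_eq_0:
  fixes G D :: "real \<Rightarrow> real"
  assumes S: "finite S" and c: "continuous_on UNIV G"
    and d: "\<And>x. x \<notin> S \<Longrightarrow> (G has_real_derivative D x) (at x)"
    and i: "integrable lborel D" and l: "(G \<longlongrightarrow> 0) at_top" "(G \<longlongrightarrow> 0) at_bot"
  shows "(\<integral>x. D x \<partial>lborel) = 0"
proof -
  have "(\<lambda>n. \<integral>x. indicator {- real n..real n} x * D x \<partial>lborel) \<longlonglongrightarrow> (\<integral>x. D x \<partial>lborel)"
  proof (rule integral_dominated_convergence[where w="\<lambda>x. \<bar>D x\<bar>"])
    show "AE x in lborel. (\<lambda>n. indicator {- real n..real n} x * D x) \<longlonglongrightarrow> D x"
    proof (rule AE_I2)
      fix x :: real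
      obtain n0 where "\<bar>x\<bar> \<le> real n0" using real_arch_simple by blast
      then have "\<forall>\<^sub>F n in sequentially. indicator {- real n..real n} x * D x = D x"
        unfolding eventually_sequentially by (intro exI[of _ n0]) (auto simp: indicator_def)
      then show "(\<lambda>n. indicator {- real n..real n} x * D x) \<longlonglongrightarrow> D x"
        by (rule tendsto_eventually)
    qed
  qed (use i in \<open>auto simp: indicator_def\<close>)
  moreover have "(\<integral>x. indicator {- real n..real n} x * D x \<partial>lborel) = G (real n) - G (- real n)" for n
  proof -
    have si: "set_integrable lborel {- real n..real n} D"
      unfolding set_integrable_def real_scaleR_def using i
      by (intro integrable_mult_indicator[where 'b=real, unfolded real_scaleR_def]) auto
    have "(\<integral>x. indicator {- real n..real n} x * D x \<partial>lborel) = integral {- real n..real n} D"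
      using set_borel_integral_eq_integral(2)[OF si] unfolding set_lebesgue_integral_def by simp
    also have "(D has_integral (G (real n) - G (- real n))) {- real n..real n}"
      using S by (rule fundamental_theorem_of_calculus_strong)
        (use d c in \<open>auto simp: has_real_derivative_iff_has_vector_derivative[symmetric]
           intro: continuous_on_subset\<close>)
    then have "integral {- real n..real n} D = G (real n) - G (- real n)" by (rule integral_unique)
    finally show ?thesis .
  qed
  moreover have "(\<lambda>n. G (real n) - G (- real n)) \<longlonglongrightarrow> 0 - 0"
    by (intro tendsto_diff filterlim_compose[OF l(1)] filterlim_compose[OF l(2)])
       (auto simp: filterlim_uminus_at_bot filterlim_real_sequentially)
  ultimately show ?thesis using LIMSEQ_unique by fastforce
qed

lemma std_normal_density_derivative:
  "(std_normal_density has_real_derivative - x * std_normal_density x) (at x)"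
  unfolding normal_density_def
  by (auto intro!: derivative_eq_intros simp: field_simps power2_eq_square)

lemma exp_growth_density_tendsto_0:
  assumes "exp_growth f"
  shows "((\<lambda>x. std_normal_density x * f x) \<longlongrightarrow> 0) at_top"
    and "((\<lambda>x. std_normal_density x * f x) \<longlongrightarrow> 0) at_bot"
proof -
  obtain C K where f: "C \<ge> 0" "\<And>z. \<bar>f z\<bar> \<le> C * exp (K * \<bar>z\<bar>)" "K \<ge> 0"
    using assms(1) by (elim exp_growthE) blast
  have b: "norm (std_normal_density x * f x) \<le> C * exp (K\<^sup>2) * exp (- x\<^sup>2 / 4)" for x
  proof -
    have "std_normal_density x \<le> exp (- x\<^sup>2 / 2)"
      using pi_gt3 by (auto simp: normal_density_def field_simps real_le_rsqrt)
    then have "std_normal_density x * \<bar>f x\<bar> \<le> exp (- x\<^sup>2 / 2) * (C * exp (K * \<bar>x\<bar>))"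
      using f by (intro mult_mono) auto
    also have "\<dots> = C * exp (- x\<^sup>2 / 2 + K * \<bar>x\<bar>)" unfolding exp_add by simp
    also have "\<dots> \<le> C * exp (K\<^sup>2 + - x\<^sup>2 / 4)"
    proof -
      \<comment> \<open>Absorbs the growth \<open>K * |x|\<close> into half of the Gaussian
        exponent.\<close>
      have "0 \<le> (K - \<bar>x\<bar> / 2)\<^sup>2" by simp
      also have "\<dots> = K\<^sup>2 + x\<^sup>2 / 4 - K * \<bar>x\<bar>" by (simp add: power2_eq_square algebra_simps)
      finally show ?thesis using f by (intro mult_left_mono) auto
    qed
    finally show ?thesis unfolding exp_add by (simp add: abs_mult mult_ac)
  qed
  have "((\<lambda>x::real. exp (- x\<^sup>2 / 4)) \<longlongrightarrow> 0) at_top" "((\<lambda>x::real. exp (- x\<^sup>2 / 4)) \<longlongrightarrow> 0) at_bot"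
    by real_asymp+
  note lim = this[THEN tendsto_mult_right_zero[where c="C * exp (K\<^sup>2)"]]
  show "((\<lambda>x. std_normal_density x * f x) \<longlongrightarrow> 0) at_top"
    by (rule Lim_null_comparison[OF _ lim(1)]) (use b in auto)
  show "((\<lambda>x. std_normal_density x * f x) \<longlongrightarrow> 0) at_bot"
    by (rule Lim_null_comparison[OF _ lim(2)]) (use b in auto)
qed

text \<open>Stein's identity: the density times \<open>f\<close> has derivative the density times
  \<open>f' x - x * f x\<close>, and it vanishes at both ends.\<close>

lemma gauss_ibp:
  assumes d: "\<And>x. (f has_real_derivative f' x) (at x)" and f: "exp_growth f" and f': "exp_growth f'"
  shows "gE (\<lambda>z. z * f z) = gE f'"
proof -
  define D where "D = (\<lambda>x. std_normal_density x * (f' x - x * f x))"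
  have eg: "exp_growth (\<lambda>x. f' x - x * f x)"
    by (intro exp_growth_intros f f')
  have "(\<integral>x. D x \<partial>lborel) = 0"
  proof (rule integral_lborel_derivative_eq_0[where S="{}" and G="\<lambda>x. std_normal_density x * f x"])
    show "((\<lambda>x. std_normal_density x * f x) has_real_derivative D x) (at x)" for x
      unfolding D_def
      by (auto intro!: derivative_eq_intros std_normal_density_derivative d simp: algebra_simps)
    then show "continuous_on UNIV (\<lambda>x. std_normal_density x * f x)"
      by (meson DERIV_isCont continuous_at_imp_continuous_on)
    show "integrable lborel D"
      using exp_growth_integrable[OF eg] integrable_gauss_iff[OF exp_growth_meas[OF eg]]
      by (simp add: D_def)
  qed (use exp_growth_density_tendsto_0[OF f] in auto)
  then have "gE (\<lambda>x. f' x - x * f x) = 0"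
    using gE_lborel[OF exp_growth_meas[OF eg]] by (simp add: D_def)
  then show ?thesis
    by (subst (asm) gE_diff) (auto intro!: exp_growth_intros f f')
qed

section \<open>A Poincare inequality for even functions\<close>

text \<open>Ground state substitution with the second Hermite polynomial
  \<open>x\<^sup>2 - 1\<close>: for \<open>p = \<phi> - \<phi> 1\<close> and
  \<open>g = 2 * x * p / (x\<^sup>2 - 1)\<close>, integration by parts gives
  \<open>E f\<^sup>2 - 2 * E p\<^sup>2 = E (f - g)\<^sup>2\<close>. Evenness makes \<open>p\<close>
  vanish at both zeros of the polynomial, which removes the singularities. Equality would force
  \<open>p\<close> to be a multiple of \<open>x\<^sup>2 - 1\<close> beyond 1; boundedness of
  \<open>f\<close> makes that multiple 0, against \<open>nc\<close>.\<close>

lemma even_poincare_strict: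
  fixes \<phi> f :: "real \<Rightarrow> real"
  assumes d: "\<And>x. (\<phi> has_real_derivative f x) (at x)" and cf: "continuous_on UNIV f"
    and even: "\<And>x. \<phi> (- x) = \<phi> x" and M: "\<And>x. \<bar>f x\<bar> \<le> M"
    and nc: "y0 > 1" "\<phi> y0 \<noteq> \<phi> 1"
  shows "gE (\<lambda>z. (\<phi> z - \<phi> 1)\<^sup>2) < 1 / 2 * gE (\<lambda>z. (f z)\<^sup>2)"
proof (rule ccontr)
  assume contr: "\<not> ?thesis"
  define p where "p = (\<lambda>x. \<phi> x - \<phi> 1)"
  \<comment> \<open>At 1 and -1 division by zero yields 0. This does no harm: \<open>p\<close>
    vanishes there, so the product \<open>p * g\<close> is continuous.\<close>
  define g where "g = (\<lambda>x. 2 * x * p x / (x\<^sup>2 - 1))"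
  define k where "k = (\<lambda>x. f x - g x)"
  define h where "h = (\<lambda>x. 2 * f x * g x - (g x)\<^sup>2 - 2 * (p x)\<^sup>2)"
  have M0: "M \<ge> 0" using M[of 0] by linarith
  have dp: "(p has_real_derivative f x) (at x)" for x
    unfolding p_def by (auto intro!: derivative_eq_intros d)
  have lip: "\<bar>\<phi> x - \<phi> y\<bar> \<le> M * \<bar>x - y\<bar>" for x y
    using field_differentiable_bound[of UNIV \<phi> f M x y] d M by (auto simp: norm_minus_commute)
  have p1: "\<bar>p x\<bar> \<le> M * \<bar>x - 1\<bar>" for x using lip[of x 1] by (simp add: p_def)
  have p2: "\<bar>p x\<bar> \<le> M * \<bar>x + 1\<bar>" for x using lip[of x "-1"] even[of 1] by (simp add: p_def)
  have cp: "continuous_on UNIV p"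
    by (meson dp DERIV_isCont continuous_at_imp_continuous_on)
  have [measurable]: "p \<in> borel_measurable borel" "f \<in> borel_measurable borel"
    using cp cf by (auto intro: borel_measurable_continuous_onI)
  have [measurable]: "g \<in> borel_measurable borel" unfolding g_def by measurable
  \<comment> \<open>Partial fractions:
    \<open>2 * x / (x\<^sup>2 - 1) = 1 / (x - 1) + 1 / (x + 1)\<close>, and the Lipschitz bounds
    from the two zeros of \<open>p\<close> cancel the two poles.\<close>
  have gb: "\<bar>g x\<bar> \<le> 2 * M" for x
  proof (cases "x = 1 \<or> x = -1")
    case True then show ?thesis using M0 by (auto simp: g_def)
  next
    case False
    then have ne: "x - 1 \<noteq> 0" "x + 1 \<noteq> 0" by auto
    have "x\<^sup>2 - 1 = (x - 1) * (x + 1)" by (simp add: power2_eq_square algebra_simps)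
    then have "g x = p x / (x - 1) + p x / (x + 1)"
      using ne unfolding g_def by (simp add: field_simps)
    moreover have "\<bar>p x / (x - 1)\<bar> \<le> M" "\<bar>p x / (x + 1)\<bar> \<le> M"
      using p1[of x] p2[of x] ne by (auto simp: field_simps)
    ultimately show ?thesis by linarith
  qed
  have egf: "exp_growth f" by (rule exp_growth_bounded[OF _ M]) measurable
  have egg: "exp_growth g" by (rule exp_growth_bounded[OF _ gb]) measurable
  have egp: "exp_growth p"
    by (rule exp_growth_mono[OF _ _ p1]) (intro exp_growth_intros, measurable)
  have egh: "exp_growth h" unfolding h_def by (intro exp_growth_intros egf egg egp)
  have egk: "exp_growth k" unfolding k_def by (intro exp_growth_intros egf egg)
  \<comment> \<open>\<open>h\<close> is made so that the density times \<open>h\<close> is the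
    derivative of \<open>G\<close>, whence \<open>gE h = 0\<close>. Completing the square gives
    \<open>h = f\<^sup>2 - k\<^sup>2 - 2 * p\<^sup>2\<close>.\<close>
  define G where "G = (\<lambda>x. std_normal_density x * (p x * g x))"
  have dG: "(G has_real_derivative std_normal_density x * h x) (at x)" if "x \<notin> {1, -1}" for x
  proof -
    have ne: "x\<^sup>2 - 1 \<noteq> 0" using that by (simp add: power2_eq_1_iff)
    let ?g' = "((2 * p x + 2 * x * f x) * (x\<^sup>2 - 1) - 2 * x * p x * (2 * x)) / ((x\<^sup>2 - 1) * (x\<^sup>2 - 1))"
    have dg: "(g has_real_derivative ?g') (at x)"
      unfolding g_def using ne by (auto intro!: derivative_eq_intros dp)
    have "(G has_real_derivative - x * std_normal_density x * (p x * g x) + std_normal_density x *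
       (f x * g x + p x * ?g')) (at x)"
      unfolding G_def
      by (rule derivative_eq_intros std_normal_density_derivative dp dg refl)+ (simp add: algebra_simps)
    also have "- x * std_normal_density x * (p x * g x) + std_normal_density x *
       (f x * g x + p x * ?g')
       = std_normal_density x * (- x * (p x * g x) + f x * g x + p x * ?g')"
      by (simp add: algebra_simps)
    also have "- x * (p x * g x) + f x * g x + p x * ?g' = h x"
    proof -
      define w where "w = x\<^sup>2 - 1"
      have x2: "x\<^sup>2 = w + 1" by (simp add: w_def)
      have w: "w \<noteq> 0" using ne by (simp add: w_def)
      \<comment> \<open>\<open>x\<close> and \<open>w\<close> are treated as independent, so that
        the only denominator is \<open>w\<close>; the defect \<open>w + 1 - x\<^sup>2\<close> is
        then 0 by \<open>z\<close>.\<close>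
      have id: "- x * (P * (2 * x * P / w)) + F * (2 * x * P / w) + P * (((2 * P + 2 * x * F) * w - 2 * x * P * (2 * x)) / (w * w))
         = 2 * F * (2 * x * P / w) - (2 * x * P / w)\<^sup>2 - 2 * P\<^sup>2 + 2 * P\<^sup>2 * (w + 1 - x\<^sup>2) / w" for P F
        using w by (simp add: divide_simps power2_eq_square) algebra
      have z: "w + 1 - x\<^sup>2 = 0" using x2 by simp
      show ?thesis unfolding h_def g_def w_def[symmetric] id z by simp
    qed
    finally show ?thesis .
  qed
  have cG: "continuous_on UNIV G"
  proof (intro continuous_at_imp_continuous_on ballI)
    fix x :: real
    show "isCont G x"
    proof (cases "x \<in> {1, -1}")
      case False then show ?thesis using dG DERIV_isCont by blast
    next
      case True
      then have px: "p x = 0" using even[of 1] by (auto simp: p_def)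
      have "((\<lambda>y. 2 * M * \<bar>p y\<bar>) \<longlongrightarrow> 2 * M * \<bar>p x\<bar>) (at x)"
        by (intro tendsto_intros) (use dp DERIV_isCont isCont_def in blast)
      then have lim: "((\<lambda>y. 2 * M * \<bar>p y\<bar>) \<longlongrightarrow> 0) (at x)" using px by simp
      have "(G \<longlongrightarrow> 0) (at x)"
      proof (rule Lim_null_comparison[OF _ lim], intro always_eventually allI)
        fix y
        have "std_normal_density y \<le> 1"
        proof -
          have e1: "exp (- y\<^sup>2 / 2) \<le> 1" by simp
          have e2: "1 \<le> sqrt (2 * pi)" using pi_gt3 by (simp add: real_le_rsqrt)
          have "exp (- y\<^sup>2 / 2) / sqrt (2 * pi) \<le> 1"
            using order_trans[OF e1 e2] e2 by (subst divide_le_eq_1_pos) linarith+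
          then show ?thesis by (simp add: normal_density_def)
        qed
        then have "std_normal_density y * (\<bar>p y\<bar> * \<bar>g y\<bar>) \<le> 1 * (\<bar>p y\<bar> * (2 * M))"
          using gb[of y] M0 by (intro mult_mono) auto
        then show "norm (G y) \<le> 2 * M * \<bar>p y\<bar>"
          by (simp add: G_def abs_mult mult_ac)
      qed
      moreover have "G x = 0" using px by (simp add: G_def)
      ultimately show ?thesis by (simp add: isCont_def)
    qed
  qed
  have "(\<integral>x. std_normal_density x * h x \<partial>lborel) = 0"
  proof (rule integral_lborel_derivative_eq_0[where S="{1,-1}" and G=G])
    show "integrable lborel (\<lambda>x. std_normal_density x * h x)"
      using exp_growth_integrable[OF egh] integrable_gauss_iff[OF exp_growth_meas[OF egh]] by simp
    show "(G \<longlongrightarrow> 0) at_top" "(G \<longlongrightarrow> 0) at_bot"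
      unfolding G_def by (intro exp_growth_density_tendsto_0 exp_growth_intros egp egg)+
  qed (use cG dG in auto)
  then have "gE h = 0" using gE_lborel[OF exp_growth_meas[OF egh]] by simp
  also have "h = (\<lambda>x. (f x)\<^sup>2 - (k x)\<^sup>2 - 2 * (p x)\<^sup>2)"
    by (auto simp: h_def k_def power2_eq_square algebra_simps)
  also have "gE \<dots> = gE (\<lambda>x. (f x)\<^sup>2) - gE (\<lambda>x. (k x)\<^sup>2) - 2 * gE (\<lambda>x. (p x)\<^sup>2)"
    by (simp add: gE_diff exp_growth_intros egf egk egp)
  finally have "gE (\<lambda>x. (k x)\<^sup>2) \<le> 0" using contr unfolding p_def by simp
  moreover have "gE (\<lambda>x. (k x)\<^sup>2) \<ge> 0" by (intro gE_nonneg) simp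
  ultimately have k0: "gE (\<lambda>x. (k x)\<^sup>2) = 0" by simp
  have "AE x in std_normal_distribution. (k x)\<^sup>2 = 0"
    using integral_nonneg_eq_0_iff_AE[OF exp_growth_integrable[OF exp_growth_power[OF egk]], of 2] k0 by auto
  then have ae: "AE x in lborel. k x = 0"
    by (subst (asm) AE_density) (auto elim!: eventually_mono intro: normal_density_pos)
  \<comment> \<open>The derivative of \<open>H\<close> is \<open>k / (x\<^sup>2 - 1)\<close>, so
    \<open>k = 0\<close> almost everywhere makes \<open>H\<close> constant on the half-line beyond
    1, where the denominator is positive.\<close>
  define H where "H = (\<lambda>x. p x / (x\<^sup>2 - 1))"
  have Hc: "H y = H 2" if "y > 1" for y
  proof -
    have FTC: "H b = H a" if ab: "1 < a" "a \<le> b" for a b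
    proof -
      have "(\<integral>x. (k x / (x\<^sup>2 - 1)) * indicator {a..b} x \<partial>lborel) = H b - H a"
      proof (rule integral_FTC_Icc_real[OF ab(2)])
        fix x assume "a \<le> x" "x \<le> b"
        then have "x\<^sup>2 > 1" using ab by (simp add: one_less_power)
        then have ne: "x\<^sup>2 - 1 \<noteq> 0" by simp
        have "(H has_real_derivative (f x * (x\<^sup>2 - 1) - p x * (2 * x)) / ((x\<^sup>2 - 1) * (x\<^sup>2 - 1))) (at x)"
          unfolding H_def using ne by (auto intro!: derivative_eq_intros dp)
        also have "(f x * (x\<^sup>2 - 1) - p x * (2 * x)) / ((x\<^sup>2 - 1) * (x\<^sup>2 - 1)) = k x / (x\<^sup>2 - 1)"
          using ne by (simp add: k_def g_def field_simps)
        finally show "(H has_real_derivative k x / (x\<^sup>2 - 1)) (at x)" .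
        have "isCont f x" "isCont p x" using cf cp by (auto simp: continuous_on_eq_continuous_at)
        then show "isCont (\<lambda>x. k x / (x\<^sup>2 - 1)) x" unfolding k_def g_def
          using ne by (auto intro!: continuous_intros)
      qed
      moreover have "(\<integral>x. (k x / (x\<^sup>2 - 1)) * indicator {a..b} x \<partial>lborel) = 0"
        by (rule integral_eq_zero_AE) (use ae in auto)
      ultimately show ?thesis by simp
    qed
    show ?thesis using FTC[of 2 y] FTC[of y 2] that by (cases "y \<ge> 2") auto
  qed
  have pe: "p y = H 2 * (y\<^sup>2 - 1)" if "y > 1" for y
  proof -
    have "y\<^sup>2 > 1" using that by (simp add: one_less_power)
    then show ?thesis using Hc[OF that] by (simp add: H_def[of] field_simps)
  qed
  have "H 2 = 0"
  proof (rule ccontr)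
    assume ne: "H 2 \<noteq> 0"
    \<comment> \<open>Large enough for the quadratic \<open>|H 2| * (y\<^sup>2 - 1)\<close> to
      exceed the Lipschitz bound \<open>M * (y - 1)\<close>.\<close>
    define y where "y = M / \<bar>H 2\<bar> + 1"
    show False
    proof (cases "M = 0")
      case True then show False using p1[of 2] ne by (simp add: H_def)
    next
      case False
      then have y1: "y > 1" using M0 ne by (simp add: y_def)
      have "\<bar>H 2\<bar> * ((y - 1) * (y + 1)) \<le> M * (y - 1)"
        using p1[of y] pe[OF y1] y1
        by (simp add: abs_mult power2_eq_square algebra_simps)
      then have "(\<bar>H 2\<bar> * (y + 1)) * (y - 1) \<le> M * (y - 1)" by (simp add: mult_ac)
      then have "\<bar>H 2\<bar> * (y + 1) \<le> M" using y1 by (simp add: mult_le_cancel_right)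
      then show False using ne by (auto simp: y_def field_simps mult_le_0_iff)
    qed
  qed
  then show False using pe[OF nc(1)] nc(2) by (simp add: p_def)
qed

lemma gE_uminus:
  assumes [measurable]: "f \<in> borel_measurable borel"
  shows "gE (\<lambda>z. f (- z)) = gE f"
proof -
  have "gE f = (\<integral>x. std_normal_density x * f x \<partial>lborel)" by (rule gE_lborel) measurable
  also have "\<dots> = (\<integral>x. std_normal_density (0 + (-1) * x) * f (0 + (-1) * x) \<partial>lborel)"
    using lborel_integral_real_affine[of "-1" "\<lambda>x. std_normal_density x * f x" 0] by simp
  also have "\<dots> = (\<integral>x. std_normal_density x * f (- x) \<partial>lborel)"
    by (simp add: normal_density_def)
  also have "\<dots> = gE (\<lambda>z. f (- z))" by (rule gE_lborel[symmetric]) measurable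
  finally show ?thesis by simp
qed

lemma gE_pos:
  assumes "exp_growth f" "\<And>z. 0 < f z" shows "0 < gE f"
proof -
  have "gE f \<noteq> 0"
  proof
    assume "gE f = 0"
    then have "AE z in std_normal_distribution. f z = 0"
      using integral_nonneg_eq_0_iff_AE[OF exp_growth_integrable[OF assms(1)]] assms(2)
      by (simp add: less_imp_le)
    then have "AE z in std_normal_distribution. False"
      by eventually_elim (metis assms(2) less_irrefl)
    then show False by simp
  qed
  then show ?thesis using gE_nonneg[of f] assms(2) by (simp add: less_le)
qed

section \<open>Tilted expectations\<close>

abbreviation lc :: "real \<Rightarrow> real" where "lc y \<equiv> ln (cosh y)"

lemma lc_derivative: "(lc has_real_derivative tanh y) (at y)"
  by (auto intro!: derivative_eq_intros simp: tanh_def field_simps)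

lemma tanh_derivative: "(tanh has_real_derivative 1 - (tanh y)\<^sup>2) (at (y::real))"
  by (auto intro!: derivative_eq_intros)

lemma abs_tanh_le_1: "\<bar>tanh (y::real)\<bar> \<le> 1"
  using tanh_real_lt_1[of y] tanh_real_gt_neg1[of y] by linarith

lemma tanh_sq_bounds: "(tanh (y::real))\<^sup>2 \<le> 1" "0 \<le> 1 - (tanh y)\<^sup>2"
  using abs_tanh_le_1[of y] by (simp_all add: abs_square_le_1)

lemma lc_nonneg: "0 \<le> lc y"
  using cosh_real_ge_1 by (simp add: ln_ge_zero)

lemma lc_lipschitz: "\<bar>lc a - lc b\<bar> \<le> \<bar>a - b\<bar>"
  using field_differentiable_bound[of UNIV lc tanh 1 b a] lc_derivative abs_tanh_le_1
  by auto

lemma lc_le_abs: "lc y \<le> \<bar>y\<bar>"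
  using lc_lipschitz[of y 0] by simp

lemma lc_ge: "y - ln 2 \<le> lc y"
proof -
  have "exp y / 2 \<le> cosh y" by (simp add: cosh_field_def)
  then have "ln (exp y / 2) \<le> lc y" by (subst ln_le_cancel_iff) auto
  then show ?thesis by (simp add: ln_div)
qed

lemma lc_ge_abs: "\<bar>y\<bar> - ln 2 \<le> lc y"
  using lc_ge[of y] lc_ge[of "- y"] by (auto simp: abs_if)

lemma lc_ge_tanh: "y * tanh y - ln 2 \<le> lc y"
proof -
  have "y * tanh y \<le> \<bar>y\<bar> * \<bar>tanh y\<bar>" by (metis abs_ge_self abs_mult)
  also have "\<dots> \<le> \<bar>y\<bar> * 1" by (intro mult_left_mono abs_tanh_le_1) auto
  finally show ?thesis using lc_ge_abs[of y] by linarith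
qed

lemma lc_convex: "lc y0 + tanh y0 * (y - y0) \<le> lc y"
proof -
  have "convex_on UNIV lc"
    by (rule f''_ge0_imp_convex[where f'=tanh and f''="\<lambda>y. 1 - (tanh y)\<^sup>2"])
       (use tanh_sq_bounds in \<open>auto intro: lc_derivative tanh_derivative\<close>)
  from convex_on_imp_above_tangent[OF this, of y0 y "tanh y0"] lc_derivative[of y0]
  show ?thesis by (auto simp: connected_UNIV)
qed

lemma lc_le_square: "lc y \<le> y\<^sup>2 / 2"
proof -
  have *: "lc y \<le> y\<^sup>2 / 2" if "y \<ge> 0" for y
  proof -
    have t: "tanh x \<le> x" if "x \<ge> 0" for x :: real
      using DERIV_nonneg_imp_nondecreasing[of 0 x "\<lambda>x. x - tanh x"] that
      by (force intro!: derivative_eq_intros exI tanh_derivative)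
    have "0\<^sup>2 / 2 - lc 0 \<le> y\<^sup>2 / 2 - lc y"
    proof (rule DERIV_nonneg_imp_nondecreasing[OF that])
      fix x :: real assume "0 \<le> x"
      then show "\<exists>d. ((\<lambda>y. y\<^sup>2 / 2 - lc y) has_real_derivative d) (at x) \<and> 0 \<le> d"
        using t[of x] by (intro exI[of _ "x - tanh x"]) (auto intro!: derivative_eq_intros simp: tanh_def)
    qed
    then show ?thesis by simp
  qed
  show ?thesis using *[of y] *[of "- y"] by (cases "y \<ge> 0") auto
qed

text \<open>Subadditivity of the power \<open>m \<le> 1\<close> applied to
  \<open>2 * cosh y = exp y + exp (- y)\<close>. It replaces the spin model by the random energy
  model in all upper bounds.\<close>

lemma exp_lc_upper:
  assumes "0 \<le> m" "m \<le> 1"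
  shows "exp (m * lc y) \<le> exp (- m * ln 2) * (exp (m * y) + exp (- m * y))"
proof -
  have *: "exp (m * lc y) \<le> exp (- m * ln 2) * (exp (m * y) + exp (- m * y))" if "y \<ge> 0" for y
  proof -
    define t where "t = exp (- 2 * y)"
    have t: "0 < t" "t \<le> 1" using that by (auto simp: t_def)
    have c: "cosh y = exp y * (1 + t) / 2"
      by (simp add: cosh_field_def t_def algebra_simps exp_add[symmetric])
    have "exp (m * lc y) = exp (m * (y + ln (1 + t) - ln 2))"
      using t by (simp add: c ln_mult ln_div)
    also have "\<dots> = exp (- m * ln 2) * (exp (m * y) * exp (m * ln (1 + t)))"
      by (simp add: exp_add[symmetric] algebra_simps)
    also have "exp (m * ln (1 + t)) \<le> 1 + exp (m * ln t)"
    proof -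
      have "m * ln (1 + t) \<le> 1 * ln (1 + t)" using assms t by (intro mult_right_mono) auto
      then have "exp (m * ln (1 + t)) \<le> exp (ln (1 + t))" by simp
      also have "\<dots> = 1 + t" using t by simp
      finally have 1: "exp (m * ln (1 + t)) \<le> 1 + t" .
      have "1 * ln t \<le> m * ln t" using assms t by (intro mult_right_mono_neg) auto
      then have "exp (1 * ln t) \<le> exp (m * ln t)" by simp
      then show ?thesis using 1 t by simp
    qed
    also have "exp (m * ln t) = exp (- 2 * m * y)" by (simp add: t_def)
    also have "exp (m * y) * (1 + exp (- 2 * m * y)) = exp (m * y) + exp (- m * y)"
      by (simp add: algebra_simps exp_add[symmetric])
    finally show ?thesis by simp
  qed
  show ?thesis using *[of y] *[of "- y"] by (cases "y \<ge> 0") (auto simp: add.commute)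
qed

lemma lc_measurable [measurable]: "lc \<in> borel_measurable borel"
  by (intro borel_measurable_continuous_onI continuous_intros) auto

lemma tanh_measurable [measurable]: "(tanh :: real \<Rightarrow> real) \<in> borel_measurable borel"
  by (intro borel_measurable_continuous_onI continuous_intros) auto

lemma exp_growth_lc: "exp_growth lc"
  by (rule exp_growth_mono[of "\<lambda>z. \<bar>z\<bar>"])
     (auto intro!: exp_growth_intros simp: lc_nonneg lc_le_abs)

lemma exp_growth_exp_lc: "exp_growth (\<lambda>y. exp (m * lc y))"
proof (rule exp_growth_mono[of "\<lambda>z. exp (\<bar>m\<bar> * \<bar>z\<bar>)"])
  show "\<bar>exp (m * lc z)\<bar> \<le> exp (\<bar>m\<bar> * \<bar>z\<bar>)" for z
  proof -
    have "m * lc z \<le> \<bar>m\<bar> * \<bar>z\<bar>"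
      using lc_nonneg[of z] lc_le_abs[of z] by (intro mult_mono) auto
    then show ?thesis by simp
  qed
qed (auto intro!: exp_growth_intros)

lemma exp_growth_tanh: "exp_growth tanh"
  by (rule exp_growth_bounded[OF _ abs_tanh_le_1]) measurable

text \<open>The mean of the \<open>m\<close>-th power of \<open>cosh\<close> at a Gaussian with mean
  \<open>x\<close> and standard deviation \<open>s\<close>.\<close>

definition lc_moment :: "real \<Rightarrow> real \<Rightarrow> real \<Rightarrow> real" where
  "lc_moment m s x = gE (\<lambda>z. exp (m * lc (x + s * z)))"

text \<open>Expectation under the law of \<open>x + s * z\<close> reweighted by the
  \<open>m\<close>-th power of \<open>cosh\<close>; derivatives of the Parisi solution are such
  averages.\<close>

definition tilt :: "real \<Rightarrow> real \<Rightarrow> real \<Rightarrow> (real \<Rightarrow> real) \<Rightarrow> real" where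
  "tilt m s x h = gE (\<lambda>z. exp (m * lc (x + s * z)) * h (x + s * z)) / lc_moment m s x"

lemma exp_growth_weighted:
  assumes "exp_growth h"
  shows "exp_growth (\<lambda>z. exp (m * lc (x + s * z)) * h (x + s * z))"
  by (rule exp_growth_affine[OF exp_growth_mult[OF exp_growth_exp_lc assms]])

lemma exp_growth_weight: "exp_growth (\<lambda>z. exp (m * lc (x + s * z)))"
  by (rule exp_growth_affine[OF exp_growth_exp_lc])

lemma lc_moment_pos: "0 < lc_moment m s x"
  unfolding lc_moment_def by (intro gE_pos exp_growth_weight) auto

text \<open>Keeps one of the two exponentials of \<open>cosh\<close>, which leaves a pure Gaussian
  moment.\<close>

lemma lc_moment_ge:
  assumes "0 \<le> m" shows "exp (m * x - m * ln 2 + (m * s)\<^sup>2 / 2) \<le> lc_moment m s x"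
proof -
  have "exp (m * x - m * ln 2 + (m * s)\<^sup>2 / 2) = gE (\<lambda>z. exp (m * x - m * ln 2) * exp ((m * s) * z))"
    by (simp add: gE_exp exp_add)
  also have "\<dots> \<le> lc_moment m s x" unfolding lc_moment_def
  proof (rule gE_mono)
    fix z
    have "m * (x + s * z - ln 2) \<le> m * lc (x + s * z)" by (intro mult_left_mono lc_ge assms)
    then show "exp (m * x - m * ln 2) * exp (m * s * z) \<le> exp (m * lc (x + s * z))"
      by (simp add: exp_add[symmetric] algebra_simps)
  qed (intro exp_growth_intros exp_growth_weight)+
  finally show ?thesis .
qed

text \<open>Both exponentials of \<open>exp_lc_upper\<close> contribute equally, which turns
  \<open>- m * ln 2\<close> into \<open>(1 - m) * ln 2\<close>; the bound is exact at
  \<open>m = 1\<close>.\<close>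

lemma lc_moment_le:
  assumes "0 \<le> m" "m \<le> 1" shows "lc_moment m s 0 \<le> exp ((1 - m) * ln 2 + (m * s)\<^sup>2 / 2)"
proof -
  have "lc_moment m s 0 \<le> gE (\<lambda>z. exp (- m * ln 2) * (exp ((m * s) * z) + exp ((- m * s) * z)))"
    unfolding lc_moment_def
  proof (rule gE_mono)
    show "exp (m * lc (0 + s * z)) \<le> exp (- m * ln 2) * (exp (m * s * z) + exp (- m * s * z))" for z
      using exp_lc_upper[OF assms, of "s * z"] by (simp add: mult.assoc)
  qed (intro exp_growth_intros exp_growth_weight)+
  also have "\<dots> = exp (- m * ln 2) * (exp ((m * s)\<^sup>2 / 2) + exp ((- m * s)\<^sup>2 / 2))"
    by (subst integral_mult_right_zero, subst gE_add, (intro exp_growth_exp)+) (simp only: gE_exp)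
  also have "\<dots> = exp ((1 - m) * ln 2 + (m * s)\<^sup>2 / 2)"
  proof -
    have "exp ((1 - m) * ln 2 + (m * s)\<^sup>2 / 2) = exp (ln 2 + - m * ln 2 + (m * s)\<^sup>2 / 2)"
      by (simp add: algebra_simps)
    also have "\<dots> = exp (- m * ln 2) * (2 * exp ((m * s)\<^sup>2 / 2))" unfolding exp_add by simp
    finally show ?thesis by simp
  qed
  finally show ?thesis .
qed

lemma lc_moment_even: "lc_moment m s (- x) = lc_moment m s x"
proof -
  have "lc_moment m s (- x) = gE (\<lambda>z. exp (m * lc (x + s * (- z))))"
    unfolding lc_moment_def by (rule Bochner_Integration.integral_cong) (auto simp: cosh_minus[of "x - s * _", symmetric])
  also have "\<dots> = lc_moment m s x"
    unfolding lc_moment_def by (rule gE_uminus[OF exp_growth_meas[OF exp_growth_weight]])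
  finally show ?thesis .
qed

lemma tilt_mono:
  assumes "exp_growth g" "exp_growth h" "\<And>y. g y \<le> h y" shows "tilt m s x g \<le> tilt m s x h"
  unfolding tilt_def using lc_moment_pos[of m s x]
  by (intro divide_right_mono gE_mono exp_growth_weighted assms mult_left_mono) auto

lemma tilt_const: "tilt m s x (\<lambda>y. c) = c"
  using lc_moment_pos[of m s x] by (simp add: tilt_def lc_moment_def)

lemma tilt_add: "exp_growth g \<Longrightarrow> exp_growth h \<Longrightarrow> tilt m s x (\<lambda>y. g y + h y) = tilt m s x g + tilt m s x h"
  by (simp add: tilt_def distrib_left gE_add exp_growth_weighted add_divide_distrib)

lemma tilt_mult: "tilt m s x (\<lambda>y. c * h y) = c * tilt m s x h"
  by (simp add: tilt_def mult.left_commute[of _ c])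

lemma tilt_diff: "exp_growth g \<Longrightarrow> exp_growth h \<Longrightarrow> tilt m s x (\<lambda>y. g y - h y) = tilt m s x g - tilt m s x h"
  by (simp add: tilt_def right_diff_distrib gE_diff exp_growth_weighted diff_divide_distrib)

lemma tilt_bounds:
  assumes "h \<in> borel_measurable borel" "\<And>y. a \<le> h y" "\<And>y. h y \<le> b"
  shows "a \<le> tilt m s x h" "tilt m s x h \<le> b"
proof -
  have h: "exp_growth h"
    by (rule exp_growth_bounded[of _ "\<bar>a\<bar> + \<bar>b\<bar>"]) (use assms in auto, smt (verit) assms(2,3))
  show "a \<le> tilt m s x h" "tilt m s x h \<le> b"
    using tilt_mono[OF exp_growth_const h, of a m s x] tilt_mono[OF h exp_growth_const, of b m s x] assms
    by (auto simp: tilt_const)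
qed

text \<open>Jensen for the density \<open>w / gE w\<close>, obtained from the tangent of
  \<open>exp\<close> at the weighted mean of \<open>Y\<close>.\<close>

lemma gE_jensen_weighted:
  assumes w: "exp_growth w" "\<And>z. 0 < w z" and Y: "exp_growth Y" and wY: "exp_growth (\<lambda>z. w z * exp (Y z))"
  shows "gE w * exp (gE (\<lambda>z. w z * Y z) / gE w) \<le> gE (\<lambda>z. w z * exp (Y z))"
proof -
  define c where "c = gE (\<lambda>z. w z * Y z) / gE w"
  have p: "gE w > 0" by (rule gE_pos[OF w])
  have "gE (\<lambda>z. exp c * (w z * (1 - c) + w z * Y z)) \<le> gE (\<lambda>z. w z * exp (Y z))"
  proof (rule gE_mono)
    fix z
    have "1 + (Y z - c) \<le> exp (Y z - c)" by (rule exp_ge_add_one_self)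
    then have "exp c * (1 + (Y z - c)) \<le> exp c * exp (Y z - c)" by (intro mult_left_mono) auto
    then have "exp c * (1 + (Y z - c)) \<le> exp (Y z)" by (simp add: exp_diff)
    then have "w z * (exp c * (1 + (Y z - c))) \<le> w z * exp (Y z)"
      using w(2)[of z] by (intro mult_left_mono) auto
    then show "exp c * (w z * (1 - c) + w z * Y z) \<le> w z * exp (Y z)" by (simp add: algebra_simps)
  qed (intro exp_growth_intros w Y wY)+
  also have "gE (\<lambda>z. exp c * (w z * (1 - c) + w z * Y z)) = exp c * (gE w * (1 - c) + gE (\<lambda>z. w z * Y z))"
    by (subst integral_mult_right_zero, subst gE_add) (auto intro: exp_growth_intros w Y)
  also have "gE (\<lambda>z. w z * Y z) = c * gE w" using p by (simp add: c_def)
  finally show ?thesis unfolding c_def[symmetric] by (simp add: algebra_simps)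
qed

section \<open>Continuity, derivatives and integration by parts for tilted expectations\<close>

lemma weighted_tendsto:
  assumes X: "X \<longlonglongrightarrow> x" and S: "S \<longlonglongrightarrow> s"
    and h: "continuous_on UNIV h" "\<And>y. \<bar>h y\<bar> \<le> C"
  shows "(\<lambda>n. gE (\<lambda>z. exp (m * lc (X n + S n * z)) * h (X n + S n * z)))
    \<longlonglongrightarrow> gE (\<lambda>z. exp (m * lc (x + s * z)) * h (x + s * z))"
proof -
  obtain A where A: "\<And>n. \<bar>X n\<bar> \<le> A"
    using convergent_imp_Bseq[OF convergentI[OF X]] by (auto simp: Bseq_def)
  obtain B where B: "\<And>n. \<bar>S n\<bar> \<le> B"
    using convergent_imp_Bseq[OF convergentI[OF S]] by (auto simp: Bseq_def)
  have C: "C \<ge> 0" using h(2)[of 0] by linarith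
  have [measurable]: "h \<in> borel_measurable borel" using h(1) by (rule borel_measurable_continuous_onI)
  show ?thesis
  proof (rule gE_tendsto[where g="\<lambda>z. exp (\<bar>m\<bar> * A) * exp ((\<bar>m\<bar> * B) * \<bar>z\<bar>) * C"])
    show "exp_growth (\<lambda>z. exp (\<bar>m\<bar> * A) * exp ((\<bar>m\<bar> * B) * \<bar>z\<bar>) * C)"
      by (intro exp_growth_intros)
    fix n z
    have "m * lc (X n + S n * z) \<le> \<bar>m\<bar> * \<bar>X n + S n * z\<bar>"
      using lc_nonneg lc_le_abs by (intro mult_mono) auto
    also have "\<dots> \<le> \<bar>m\<bar> * (A + B * \<bar>z\<bar>)"
    proof (rule mult_left_mono)
      have "\<bar>S n * z\<bar> \<le> B * \<bar>z\<bar>" using B[of n] by (simp add: abs_mult mult_right_mono)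
      then show "\<bar>X n + S n * z\<bar> \<le> A + B * \<bar>z\<bar>" using A[of n] by linarith
    qed simp
    finally have e: "exp (m * lc (X n + S n * z)) \<le> exp (\<bar>m\<bar> * A) * exp ((\<bar>m\<bar> * B) * \<bar>z\<bar>)"
      by (simp add: exp_add[symmetric] algebra_simps)
    have "exp (m * lc (X n + S n * z)) * \<bar>h (X n + S n * z)\<bar>
       \<le> (exp (\<bar>m\<bar> * A) * exp ((\<bar>m\<bar> * B) * \<bar>z\<bar>)) * C"
      by (rule mult_mono[OF e h(2)]) auto
    then show "\<bar>exp (m * lc (X n + S n * z)) * h (X n + S n * z)\<bar>
       \<le> exp (\<bar>m\<bar> * A) * exp ((\<bar>m\<bar> * B) * \<bar>z\<bar>) * C"
      by (simp add: abs_mult)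
  next
    fix z
    have y: "(\<lambda>n. X n + S n * z) \<longlonglongrightarrow> x + s * z" by (intro tendsto_intros X S)
    have "isCont (\<lambda>y. exp (m * lc y) * h y) (x + s * z)"
      using h(1) by (intro continuous_intros) (auto simp: continuous_on_eq_continuous_at)
    from isCont_tendsto_compose[OF this y]
    show "(\<lambda>n. exp (m * lc (X n + S n * z)) * h (X n + S n * z))
       \<longlonglongrightarrow> exp (m * lc (x + s * z)) * h (x + s * z)" .
  qed measurable
qed

lemma lc_moment_tendsto:
  assumes "X \<longlonglongrightarrow> x" "S \<longlonglongrightarrow> s"
  shows "(\<lambda>n. lc_moment m (S n) (X n)) \<longlonglongrightarrow> lc_moment m s x"
  using weighted_tendsto[OF assms, of "\<lambda>_. 1" 1 m] by (simp add: lc_moment_def)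

lemma tilt_tendsto:
  assumes "X \<longlonglongrightarrow> x" "S \<longlonglongrightarrow> s" "continuous_on UNIV h" "\<And>y. \<bar>h y\<bar> \<le> C"
  shows "(\<lambda>n. tilt m (S n) (X n) h) \<longlonglongrightarrow> tilt m s x h"
  unfolding tilt_def
  by (intro tendsto_divide weighted_tendsto[OF assms] lc_moment_tendsto assms)
     (use lc_moment_pos[of m s x] in auto)

lemma tilt_continuous:
  assumes "continuous_on UNIV h" "\<And>y. \<bar>h y\<bar> \<le> C"
  shows "continuous_on UNIV (\<lambda>x. tilt m s (a * x) h)"
  unfolding continuous_on_sequentially comp_def
  by (auto intro!: tilt_tendsto assms tendsto_intros)

lemma weighted_has_derivative:
  assumes d: "\<And>y. (h has_real_derivative h' y) (at y)"
    and b: "\<And>y. \<bar>h y\<bar> \<le> C" "\<And>y. \<bar>h' y\<bar> \<le> C'" "h' \<in> borel_measurable borel"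
  shows "((\<lambda>x. gE (\<lambda>z. exp (m * lc (x + s * z)) * h (x + s * z))) has_real_derivative
     gE (\<lambda>z. exp (m * lc (x + s * z)) * (m * tanh (x + s * z) * h (x + s * z) + h' (x + s * z)))) (at x)"
proof -
  have C: "C \<ge> 0" "C' \<ge> 0" using b(1)[of 0] b(2)[of 0] by linarith+
  have "continuous_on UNIV h" by (meson d DERIV_isCont continuous_at_imp_continuous_on)
  then have [measurable]: "h \<in> borel_measurable borel" by (rule borel_measurable_continuous_onI)
  note b(3)[measurable]
  have eg: "exp_growth h" by (rule exp_growth_bounded[OF _ b(1)]) measurable
  show ?thesis
  proof (rule gE_has_derivative[where g="\<lambda>z. exp (\<bar>m\<bar> * (\<bar>x\<bar> + 1)) * exp ((\<bar>m\<bar> * \<bar>s\<bar>) * \<bar>z\<bar>) * (\<bar>m\<bar> * C + C')"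
      and F="\<lambda>x z. exp (m * lc (x + s * z)) * h (x + s * z)"
      and F'="\<lambda>x z. exp (m * lc (x + s * z)) * (m * tanh (x + s * z) * h (x + s * z) + h' (x + s * z))"])
    fix x z
    have 1: "((\<lambda>x. x + s * z) has_real_derivative 1) (at x)"
      by (auto intro!: derivative_eq_intros)
    note c1 = DERIV_chain2[OF lc_derivative 1] and c2 = DERIV_chain2[OF d 1]
    show "((\<lambda>x. exp (m * lc (x + s * z)) * h (x + s * z)) has_real_derivative
        exp (m * lc (x + s * z)) * (m * tanh (x + s * z) * h (x + s * z) + h' (x + s * z))) (at x)"
      by (rule derivative_eq_intros c1 c2 refl)+ (simp add: algebra_simps)
  next
    show "exp_growth (\<lambda>z. exp (m * lc (x + s * z)) * h (x + s * z))" for x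
      by (rule exp_growth_weighted[OF eg])
  next
    fix x' z
    assume x': "\<bar>x' - x\<bar> \<le> 1"
    have "m * lc (x' + s * z) \<le> \<bar>m\<bar> * \<bar>x' + s * z\<bar>"
      using lc_nonneg lc_le_abs by (intro mult_mono) auto
    also have "\<dots> \<le> \<bar>m\<bar> * (\<bar>x\<bar> + 1 + \<bar>s\<bar> * \<bar>z\<bar>)"
    proof (rule mult_left_mono)
      show "\<bar>x' + s * z\<bar> \<le> \<bar>x\<bar> + 1 + \<bar>s\<bar> * \<bar>z\<bar>" using x' abs_mult[of s z] by linarith
    qed simp
    finally have e: "exp (m * lc (x' + s * z)) \<le> exp (\<bar>m\<bar> * (\<bar>x\<bar> + 1)) * exp ((\<bar>m\<bar> * \<bar>s\<bar>) * \<bar>z\<bar>)"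
      by (simp add: exp_add[symmetric] algebra_simps)
    have "\<bar>m * tanh (x' + s * z) * h (x' + s * z)\<bar> \<le> \<bar>m\<bar> * C"
    proof -
      have "\<bar>tanh (x' + s * z)\<bar> * \<bar>h (x' + s * z)\<bar> \<le> 1 * C"
        by (intro mult_mono abs_tanh_le_1 b) auto
      then show ?thesis by (simp add: abs_mult mult.assoc mult_left_mono)
    qed
    then have "\<bar>m * tanh (x' + s * z) * h (x' + s * z) + h' (x' + s * z)\<bar> \<le> \<bar>m\<bar> * C + C'"
      using b(2)[of "x' + s * z"] by linarith
    then show "\<bar>exp (m * lc (x' + s * z)) * (m * tanh (x' + s * z) * h (x' + s * z) + h' (x' + s * z))\<bar>
       \<le> exp (\<bar>m\<bar> * (\<bar>x\<bar> + 1)) * exp ((\<bar>m\<bar> * \<bar>s\<bar>) * \<bar>z\<bar>) * (\<bar>m\<bar> * C + C')"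
      unfolding abs_mult using e by (intro mult_mono) auto
  qed (measurable, intro exp_growth_intros)
qed

lemma weighted_ibp:
  assumes d: "\<And>y. (h has_real_derivative h' y) (at y)" and h: "exp_growth h" "exp_growth h'"
  shows "gE (\<lambda>z. z * (exp (m * lc (x + s * z)) * h (x + s * z)))
    = s * gE (\<lambda>z. exp (m * lc (x + s * z)) * (m * tanh (x + s * z) * h (x + s * z) + h' (x + s * z)))"
proof -
  have eg: "exp_growth (\<lambda>z. exp (m * lc (x + s * z)) * (m * tanh (x + s * z) * h (x + s * z) + h' (x + s * z)))"
    by (rule exp_growth_weighted) (intro exp_growth_intros exp_growth_tanh h)
  have "gE (\<lambda>z. z * (exp (m * lc (x + s * z)) * h (x + s * z)))
    = gE (\<lambda>z. s * (exp (m * lc (x + s * z)) * (m * tanh (x + s * z) * h (x + s * z) + h' (x + s * z))))"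
  proof (rule gauss_ibp)
    fix z
    have 1: "((\<lambda>z. x + s * z) has_real_derivative s) (at z)"
      by (auto intro!: derivative_eq_intros)
    note c1 = DERIV_chain2[OF lc_derivative 1] and c2 = DERIV_chain2[OF d 1]
    show "((\<lambda>z. exp (m * lc (x + s * z)) * h (x + s * z)) has_real_derivative
       s * (exp (m * lc (x + s * z)) * (m * tanh (x + s * z) * h (x + s * z) + h' (x + s * z)))) (at z)"
      by (rule derivative_eq_intros c1 c2 refl)+ (simp add: algebra_simps)
  qed (intro exp_growth_weighted h exp_growth_mult[OF exp_growth_const] eg)+
  then show ?thesis by simp
qed

text \<open>\<open>lc_pot\<close> is the Parisi solution \<open>\<Phi>\<^sub>\<mu>(\<cdot>, q)\<close> below a single remaining atom,
  \<open>lc_curv\<close> the part of its second derivative that is linear in the tilted measure.\<close>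

definition lc_pot :: "real \<Rightarrow> real \<Rightarrow> real \<Rightarrow> real" where
  "lc_pot m s x = 1 / m * ln (lc_moment m s x)"

definition lc_curv :: "real \<Rightarrow> real \<Rightarrow> real" where
  "lc_curv m y = m * (tanh y)\<^sup>2 + (1 - (tanh y)\<^sup>2)"

lemma lc_curv_bounds:
  assumes "0 \<le> m" "m \<le> 1" shows "m \<le> lc_curv m y" "lc_curv m y \<le> 1" "\<bar>lc_curv m y\<bar> \<le> 1"
proof -
  have "(1 - m) * (tanh y)\<^sup>2 \<le> (1 - m) * 1" "0 \<le> (1 - m) * (tanh y)\<^sup>2"
    using assms tanh_sq_bounds[of y] by (auto intro!: mult_left_mono simp del: mult_1_right mult.right_neutral)
  then show "m \<le> lc_curv m y" "lc_curv m y \<le> 1"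
    unfolding lc_curv_def by (simp_all add: algebra_simps)
  then show "\<bar>lc_curv m y\<bar> \<le> 1" using assms by linarith
qed

lemma lc_curv_continuous: "continuous_on A (lc_curv m)"
  unfolding lc_curv_def by (intro continuous_intros) auto

lemma lc_curv_measurable [measurable]: "lc_curv m \<in> borel_measurable borel"
  by (rule borel_measurable_continuous_onI[OF lc_curv_continuous])

lemma lc_moment_has_derivative:
  "(lc_moment m s has_real_derivative m * lc_moment m s x * tilt m s x tanh) (at x)"
  using weighted_has_derivative[of "\<lambda>_. 1" "\<lambda>_. 0" 1 0 m s x] lc_moment_pos[of m s x]
  by (simp add: lc_moment_def[abs_def] tilt_def mult_ac)

lemma lc_pot_has_derivative:
  assumes "m \<noteq> 0"
  shows "(lc_pot m s has_real_derivative tilt m s x tanh) (at x)"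
  unfolding lc_pot_def[abs_def] using assms lc_moment_pos[of m s x]
  by (auto intro!: derivative_eq_intros lc_moment_has_derivative simp: field_simps)

lemma tilt_tanh_has_derivative:
  "((\<lambda>x. tilt m s x tanh) has_real_derivative
     tilt m s x (lc_curv m) - m * (tilt m s x tanh)\<^sup>2) (at x)"
proof -
  have "((\<lambda>x. gE (\<lambda>z. exp (m * lc (x + s * z)) * tanh (x + s * z))) has_real_derivative
     gE (\<lambda>z. exp (m * lc (x + s * z)) * (m * tanh (x + s * z) * tanh (x + s * z) + (1 - (tanh (x + s * z))\<^sup>2)))) (at x)"
    by (rule weighted_has_derivative[where C=1 and C'=1])
       (use tanh_sq_bounds in \<open>auto intro: tanh_derivative abs_tanh_le_1\<close>)
  also have "gE (\<lambda>z. exp (m * lc (x + s * z)) * (m * tanh (x + s * z) * tanh (x + s * z) + (1 - (tanh (x + s * z))\<^sup>2)))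
     = lc_moment m s x * tilt m s x (lc_curv m)"
    using lc_moment_pos[of m s x] by (simp add: tilt_def lc_curv_def power2_eq_square mult.assoc)
  finally have 1: "((\<lambda>x. gE (\<lambda>z. exp (m * lc (x + s * z)) * tanh (x + s * z))) has_real_derivative
     lc_moment m s x * tilt m s x (lc_curv m)) (at x)" .
  have n: "gE (\<lambda>z. exp (m * lc (x + s * z)) * tanh (x + s * z)) = lc_moment m s x * tilt m s x tanh" for x
    using lc_moment_pos[of m s x] by (simp add: tilt_def)
  have eq: "(\<lambda>x. lc_moment m s x * tilt m s x tanh / lc_moment m s x) = (\<lambda>x. tilt m s x tanh)"
    using lc_moment_pos[of m s] by (auto simp: less_le)
  have "((\<lambda>x. tilt m s x tanh) has_real_derivative
      (lc_moment m s x * tilt m s x (lc_curv m) * lc_moment m s x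
        - lc_moment m s x * tilt m s x tanh * (m * lc_moment m s x * tilt m s x tanh))
      / (lc_moment m s x * lc_moment m s x)) (at x)"
    using DERIV_divide[OF 1 lc_moment_has_derivative[of m s x]] lc_moment_pos[of m s x]
    unfolding n eq by simp
  also have "(lc_moment m s x * tilt m s x (lc_curv m) * lc_moment m s x
        - lc_moment m s x * tilt m s x tanh * (m * lc_moment m s x * tilt m s x tanh))
      / (lc_moment m s x * lc_moment m s x) = tilt m s x (lc_curv m) - m * (tilt m s x tanh)\<^sup>2"
    using lc_moment_pos[of m s x] by (simp add: field_simps power2_eq_square)
  finally show ?thesis .
qed

lemma tilt_tanh_abs_le: "\<bar>tilt m s x tanh\<bar> \<le> 1"
  using tilt_bounds[of tanh "-1" 1 m s x] tanh_real_lt_1 tanh_real_gt_neg1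
  by (auto simp: less_imp_le abs_le_iff)

text \<open>As \<open>lc\<close> is convex, \<open>ln (lc_moment m s x)\<close> is a log-sum-exp of functions convex in
  \<open>(x, s)\<close>, hence lies above its tangents.\<close>

lemma ln_lc_moment_tangent:
  assumes "0 \<le> m"
  shows "ln (lc_moment m s0 x0) + m * ((x - x0) * tilt m s0 x0 tanh + (s - s0) * s0 * tilt m s0 x0 (lc_curv m))
    \<le> ln (lc_moment m s x)"
proof -
  define w where "w = (\<lambda>z. exp (m * lc (x0 + s0 * z)))"
  define t where "t = (\<lambda>z. tanh (x0 + s0 * z))"
  \<comment> \<open>The tangent of \<open>lc\<close> at \<open>x0 + s0 * z\<close> bounds the new
    weight below by \<open>w * exp Y\<close>. Jensen moves the mean of \<open>Y\<close> into the
    exponent, and integration by parts evaluates its part containing \<open>z\<close>.\<close>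
  define Y where "Y = (\<lambda>z. m * ((x - x0) + (s - s0) * z) * t z)"
  have w: "exp_growth w" "\<And>z. 0 < w z" unfolding w_def by (auto intro: exp_growth_weight)
  have t: "exp_growth t" unfolding t_def by (rule exp_growth_affine[OF exp_growth_tanh])
  have Y: "exp_growth Y" unfolding Y_def by (intro exp_growth_intros t)
  have p: "lc_moment m s0 x0 > 0" by (rule lc_moment_pos)
  have Wm: "gE w = lc_moment m s0 x0" by (simp add: w_def lc_moment_def)
  have le: "w z * exp (Y z) \<le> exp (m * lc (x + s * z))" for z
  proof -
    have "m * (lc (x0 + s0 * z) + tanh (x0 + s0 * z) * ((x + s * z) - (x0 + s0 * z))) \<le> m * lc (x + s * z)"
      by (intro mult_left_mono lc_convex assms)
    then show ?thesis by (simp add: w_def Y_def t_def exp_add[symmetric] algebra_simps)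
  qed
  have eg: "exp_growth (\<lambda>z. exp (m * lc (x + s * z)))" by (rule exp_growth_weight)
  have wY: "exp_growth (\<lambda>z. w z * exp (Y z))"
    by (rule exp_growth_mono[OF eg]) (use le exp_growth_meas[OF w(1)] exp_growth_meas[OF Y] w(2)[THEN less_imp_le] in \<open>auto simp: abs_mult\<close>)
  have "gE (\<lambda>z. w z * Y z) = m * (x - x0) * gE (\<lambda>z. w z * t z) + m * (s - s0) * gE (\<lambda>z. z * (w z * t z))"
  proof -
    have "gE (\<lambda>z. w z * Y z) = gE (\<lambda>z. m * (x - x0) * (w z * t z) + m * (s - s0) * (z * (w z * t z)))"
      by (rule Bochner_Integration.integral_cong) (auto simp: Y_def algebra_simps)
    also have "\<dots> = gE (\<lambda>z. m * (x - x0) * (w z * t z)) + gE (\<lambda>z. m * (s - s0) * (z * (w z * t z)))"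
      by (intro gE_add exp_growth_intros w t)
    finally show ?thesis by simp
  qed
  also have "gE (\<lambda>z. z * (w z * t z)) = s0 * (lc_moment m s0 x0 * tilt m s0 x0 (lc_curv m))"
    unfolding w_def t_def
    by (subst weighted_ibp[OF tanh_derivative exp_growth_tanh])
       (use p in \<open>auto simp: tilt_def lc_curv_def power2_eq_square mult.assoc intro!: exp_growth_intros exp_growth_tanh\<close>)
  also have "gE (\<lambda>z. w z * t z) = lc_moment m s0 x0 * tilt m s0 x0 tanh"
    using p by (simp add: tilt_def w_def t_def)
  finally have "gE (\<lambda>z. w z * Y z) / gE w
      = m * ((x - x0) * tilt m s0 x0 tanh + (s - s0) * s0 * tilt m s0 x0 (lc_curv m))"
    using p by (simp add: Wm field_simps)
  then have "lc_moment m s0 x0 * exp (m * ((x - x0) * tilt m s0 x0 tanh + (s - s0) * s0 * tilt m s0 x0 (lc_curv m)))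
      \<le> gE (\<lambda>z. w z * exp (Y z))"
    using gE_jensen_weighted[OF w Y wY] by (simp add: Wm)
  also have "\<dots> \<le> lc_moment m s x" unfolding lc_moment_def by (rule gE_mono[OF wY eg le])
  finally have "ln (lc_moment m s0 x0 * exp (m * ((x - x0) * tilt m s0 x0 tanh + (s - s0) * s0 * tilt m s0 x0 (lc_curv m))))
     \<le> ln (lc_moment m s x)"
    using p lc_moment_pos by (subst ln_le_cancel_iff) auto
  then show ?thesis using p by (simp add: ln_mult)
qed

section \<open>The mixture function\<close>

lemma diffs_nonneg: "(\<And>n. 0 \<le> c n) \<Longrightarrow> 0 \<le> diffs c n" for c :: "nat \<Rightarrow> real"
  by (simp add: diffs_def)

lemma diffs_summable:
  assumes "\<And>u::real. \<bar>u\<bar> < 2 \<Longrightarrow> summable (\<lambda>n. c n * u ^ n)" "\<bar>u\<bar> < 2"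
  shows "summable (\<lambda>n. diffs c n * u ^ n)"
  by (rule termdiff_converges[where K=2]) (use assms in auto)

lemma powser_derivative:
  assumes "\<And>u::real. \<bar>u\<bar> < 2 \<Longrightarrow> summable (\<lambda>n. c n * u ^ n)" "\<bar>u\<bar> < 2"
  shows "((\<lambda>x. \<Sum>n. c n * x ^ n) has_real_derivative (\<Sum>n. diffs c n * u ^ n)) (at u)"
  by (rule termdiffs_strong'[where K=2]) (use assms in auto)

lemma deriv_series:
  fixes f :: "real \<Rightarrow> real"
  assumes f: "\<And>u. \<bar>u\<bar> < 2 \<Longrightarrow> f u = (\<Sum>n. c n * u ^ n)"
    and c: "\<And>u::real. \<bar>u\<bar> < 2 \<Longrightarrow> summable (\<lambda>n. c n * u ^ n)" and u: "\<bar>u\<bar> < 2"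
  shows "(f has_real_derivative (\<Sum>n. diffs c n * u ^ n)) (at u)"
    and "deriv f u = (\<Sum>n. diffs c n * u ^ n)"
proof -
  show "(f has_real_derivative (\<Sum>n. diffs c n * u ^ n)) (at u)"
    by (rule has_field_derivative_transform_within_open[OF powser_derivative[OF c u], of "{-2<..<2}"])
       (use f u in auto)
  then show "deriv f u = (\<Sum>n. diffs c n * u ^ n)" by (rule DERIV_imp_deriv)
qed

locale mixture_model =
  fixes \<beta> :: "nat \<Rightarrow> real" and \<xi> :: "real \<Rightarrow> real"
  assumes summ: "summable (\<lambda>p. 2 ^ (p + 2) * (\<beta> (p + 2))\<^sup>2)"
    and xi_eq: "\<xi> = mixture \<beta>"
    and xi1_pos: "0 < \<xi> 1"
begin

text \<open>Padding with zeros in degrees 0 and 1 makes \<open>\<xi>\<close> an ordinary power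
  series. It converges at 2, so \<open>\<xi>\<close> is smooth on both sides of the endpoint
  1.\<close>

definition coef :: "nat \<Rightarrow> real" where "coef n = (if n < 2 then 0 else (\<beta> n)\<^sup>2)"

abbreviation "\<xi>' \<equiv> deriv \<xi>"
abbreviation "\<xi>'' \<equiv> deriv (deriv \<xi>)"

text \<open>Vanishes at 0 and has derivative \<open>u * \<xi>'' u\<close>, so the penalty integral
  of an atomic measure becomes a finite sum.\<close>

definition \<theta> :: "real \<Rightarrow> real" where "\<theta> u = u * \<xi>' u - \<xi> u"

lemma coef_summable2: "summable (\<lambda>n. coef n * 2 ^ n)"
  using summ by (subst summable_iff_shift[of _ 2, symmetric]) (simp add: coef_def mult.commute)

lemma coef_summable: "\<bar>u\<bar> < 2 \<Longrightarrow> summable (\<lambda>n. coef n * u ^ n)"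
  by (rule powser_inside[OF coef_summable2]) auto

lemma xi_series: "\<bar>u\<bar> < 2 \<Longrightarrow> \<xi> u = (\<Sum>n. coef n * u ^ n)"
  using suminf_split_initial_segment[OF coef_summable, of u 2]
  by (simp add: xi_eq mixture_def coef_def lessThan_nat_numeral numeral_2_eq_2)

lemma xi'_series: "\<bar>u\<bar> < 2 \<Longrightarrow> \<xi>' u = (\<Sum>n. diffs coef n * u ^ n)"
  by (rule deriv_series(2)[OF xi_series coef_summable])

lemma xi''_series: "\<bar>u\<bar> < 2 \<Longrightarrow> \<xi>'' u = (\<Sum>n. diffs (diffs coef) n * u ^ n)"
  by (rule deriv_series(2)[OF xi'_series diffs_summable[OF coef_summable]])

lemma xi_derivative: "\<bar>u\<bar> < 2 \<Longrightarrow> (\<xi> has_real_derivative \<xi>' u) (at u)"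
  using deriv_series(1)[OF xi_series coef_summable] xi'_series by simp

lemma xi'_derivative: "\<bar>u\<bar> < 2 \<Longrightarrow> (\<xi>' has_real_derivative \<xi>'' u) (at u)"
  using deriv_series(1)[OF xi'_series diffs_summable[OF coef_summable]] xi''_series by simp

lemma coef''_summable: "\<bar>u\<bar> < 2 \<Longrightarrow> summable (\<lambda>n. diffs (diffs coef) n * u ^ n)"
  by (intro diffs_summable coef_summable)

lemma xi''_isCont: "\<bar>u\<bar> < 2 \<Longrightarrow> isCont \<xi>'' u"
  by (rule DERIV_isCont[OF deriv_series(1)[OF xi''_series coef''_summable]])

lemma coef''_nonneg: "0 \<le> diffs (diffs coef) n"
  by (intro diffs_nonneg) (simp add: coef_def)

lemma xi''_nonneg: "0 \<le> u \<Longrightarrow> u < 2 \<Longrightarrow> 0 \<le> \<xi>'' u"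
  by (subst xi''_series) (auto intro!: suminf_nonneg coef''_summable mult_nonneg_nonneg coef''_nonneg)

lemma xi''_mono: "0 \<le> u \<Longrightarrow> u \<le> v \<Longrightarrow> v < 2 \<Longrightarrow> \<xi>'' u \<le> \<xi>'' v"
  by (subst (1 2) xi''_series)
     (auto intro!: suminf_le coef''_summable mult_left_mono coef''_nonneg power_mono)

lemma xi_0: "\<xi> 0 = 0" and xi'_0: "\<xi>' 0 = 0"
proof -
  show "\<xi> 0 = 0" using powser_zero[of coef] by (simp add: xi_series coef_def)
  show "\<xi>' 0 = 0" using powser_zero[of "diffs coef"] by (simp add: xi'_series diffs_def coef_def)
qed

lemma xi'_mvt:
  assumes "0 \<le> u" "u < v" "v \<le> 1"
  obtains c where "u < c" "c < v" "\<xi>' v - \<xi>' u = (v - u) * \<xi>'' c"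
  using MVT2[OF assms(2), of \<xi>' \<xi>''] xi'_derivative assms by force

lemma xi_mvt:
  assumes "0 \<le> u" "u < v" "v \<le> 1"
  obtains c where "u < c" "c < v" "\<xi> v - \<xi> u = (v - u) * \<xi>' c"
  using MVT2[OF assms(2), of \<xi> \<xi>'] xi_derivative assms by force

lemma xi'_mono:
  assumes "0 \<le> u" "u \<le> v" "v \<le> 1" shows "\<xi>' u \<le> \<xi>' v"
proof (cases "u = v")
  case False
  then obtain c where c: "u < c" "c < v" "\<xi>' v - \<xi>' u = (v - u) * \<xi>'' c"
    using xi'_mvt[of u v] assms by auto
  then have "0 \<le> (v - u) * \<xi>'' c" using assms by (intro mult_nonneg_nonneg xi''_nonneg) auto
  then show ?thesis using c by linarith
qed simp

lemma xi'_nonneg: "0 \<le> u \<Longrightarrow> u \<le> 1 \<Longrightarrow> 0 \<le> \<xi>' u"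
  using xi'_mono[of 0 u] xi'_0 by simp

lemma xi_mono:
  assumes "0 \<le> u" "u \<le> v" "v \<le> 1" shows "\<xi> u \<le> \<xi> v"
proof (cases "u = v")
  case False
  then obtain c where c: "u < c" "c < v" "\<xi> v - \<xi> u = (v - u) * \<xi>' c"
    using xi_mvt[of u v] assms by auto
  then have "0 \<le> (v - u) * \<xi>' c" using assms by (intro mult_nonneg_nonneg xi'_nonneg) auto
  then show ?thesis using c by linarith
qed simp

lemma xi_nonneg: "0 \<le> u \<Longrightarrow> u \<le> 1 \<Longrightarrow> 0 \<le> \<xi> u"
  using xi_mono[of 0 u] xi_0 by simp

lemma xi'_le: "0 \<le> u \<Longrightarrow> u \<le> 1 \<Longrightarrow> \<xi>' u \<le> u * \<xi>'' u"
proof (cases "u = 0")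
  case False
  assume u: "0 \<le> u" "u \<le> 1"
  then obtain c where c: "0 < c" "c < u" "\<xi>' u - \<xi>' 0 = (u - 0) * \<xi>'' c"
    using xi'_mvt[of 0 u] False by auto
  then have "u * \<xi>'' c \<le> u * \<xi>'' u" using u by (intro mult_left_mono xi''_mono) auto
  then show ?thesis using c xi'_0 by simp
qed (simp add: xi'_0)

lemma xi'_le_xi'': "0 \<le> u \<Longrightarrow> u \<le> 1 \<Longrightarrow> \<xi>' u \<le> \<xi>'' u"
  using xi'_le[of u] mult_left_le_one_le[of "\<xi>'' u" u] xi''_nonneg[of u] by linarith

text \<open>All degrees are at least 2. This enters as \<open>\<xi>' u \<le> u * \<xi>'' u\<close>,
  which makes the difference of the two sides nondecreasing from 0.\<close>

lemma xi_le:
  assumes "0 \<le> u" "u \<le> 1" shows "2 * \<xi> u \<le> u * \<xi>' u"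
proof -
  have "0 * \<xi>' 0 - 2 * \<xi> 0 \<le> u * \<xi>' u - 2 * \<xi> u"
  proof (rule DERIV_nonneg_imp_nondecreasing[OF assms(1)])
    fix x assume x: "0 \<le> x" "x \<le> u"
    have "((\<lambda>u. u * \<xi>' u - 2 * \<xi> u) has_real_derivative 1 * \<xi>' x + \<xi>'' x * x - 2 * \<xi>' x) (at x)"
      by (intro DERIV_diff DERIV_mult DERIV_cmult DERIV_ident xi'_derivative xi_derivative)
         (use x assms in auto)
    with xi'_le[of x] x assms show "\<exists>y. ((\<lambda>u. u * \<xi>' u - 2 * \<xi> u) has_real_derivative y) (at x) \<and> 0 \<le> y"
      by (auto simp: mult.commute)
  qed
  then show ?thesis by (simp add: xi_0)
qed

text \<open>With nonnegative coefficients, a zero at one positive point kills the whole series,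
  which \<open>\<xi> 1 > 0\<close> forbids.\<close>

lemma xi''_pos:
  assumes "0 < u" "u \<le> 1" shows "0 < \<xi>'' u"
proof (rule ccontr)
  assume "\<not> 0 < \<xi>'' u"
  then have "\<xi>'' u = 0" using xi''_nonneg[of u] assms by simp
  then have z: "(\<Sum>n. diffs (diffs coef) n * u ^ n) = 0" using xi''_series[of u] assms by simp
  have "diffs (diffs coef) n * u ^ n = 0" for n
    using suminf_eq_zero_iff[OF coef''_summable, of u] z assms coef''_nonneg by simp
  then have d0: "diffs (diffs coef) n = 0" for n using assms by simp
  then have "\<xi>'' 1 = 0" by (simp add: xi''_series)
  then have "\<xi>' 1 \<le> 0" using xi'_le[of 1] by simp
  then show False using xi_le[of 1] xi1_pos by simp
qed

lemma xi'_less: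
  assumes "0 \<le> u" "u < v" "v \<le> 1" shows "\<xi>' u < \<xi>' v"
proof -
  obtain c where c: "u < c" "c < v" "\<xi>' v - \<xi>' u = (v - u) * \<xi>'' c"
    using xi'_mvt[of u v] assms by auto
  then have "0 < (v - u) * \<xi>'' c" using assms by (intro mult_pos_pos xi''_pos) auto
  then show ?thesis using c by linarith
qed

lemma xi'_pos: "0 < u \<Longrightarrow> u \<le> 1 \<Longrightarrow> 0 < \<xi>' u"
  using xi'_less[of 0 u] xi'_0 by simp

lemma theta_derivative: "\<bar>u\<bar> < 2 \<Longrightarrow> (\<theta> has_real_derivative u * \<xi>'' u) (at u)"
  unfolding \<theta>_def[abs_def]
  by (rule derivative_eq_intros xi_derivative xi'_derivative refl | assumption)+ simp

lemma theta_0: "\<theta> 0 = 0"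
  by (simp add: \<theta>_def xi_0)

lemma theta_ge: "0 \<le> u \<Longrightarrow> u \<le> 1 \<Longrightarrow> 1 / 2 * u * \<xi>' u \<le> \<theta> u"
  using xi_le[of u] by (simp add: \<theta>_def)

text \<open>\<open>\<theta>\<close> integrates the position against the increments of
  \<open>\<xi>'\<close>, so over \<open>[u, v]\<close> its increment lies between \<open>u\<close>
  and \<open>v\<close> times that of \<open>\<xi>'\<close>; the next lemma is the lower
  half.\<close>

lemma theta_diff_le:
  assumes "0 \<le> u" "u \<le> v" "v \<le> 1" shows "\<theta> v - \<theta> u \<le> v * (\<xi>' v - \<xi>' u)"
proof (cases "u = v")
  case False
  then obtain c where c: "u < c" "c < v" "\<xi> v - \<xi> u = (v - u) * \<xi>' c"
    using xi_mvt[of u v] assms by auto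
  then have "(v - u) * \<xi>' u \<le> (v - u) * \<xi>' c" using assms by (intro mult_left_mono xi'_mono) auto
  then show ?thesis using c(3) by (simp add: \<theta>_def algebra_simps)
qed simp

lemma theta_diff_ge:
  assumes "0 \<le> u" "u \<le> v" "v \<le> 1" shows "u * (\<xi>' v - \<xi>' u) \<le> \<theta> v - \<theta> u"
proof (cases "u = v")
  case False
  then obtain c where c: "u < c" "c < v" "\<xi> v - \<xi> u = (v - u) * \<xi>' c"
    using xi_mvt[of u v] assms by auto
  then have "(v - u) * \<xi>' c \<le> (v - u) * \<xi>' v" using assms by (intro mult_left_mono xi'_mono) auto
  then show ?thesis using c(3) by (simp add: \<theta>_def algebra_simps)
qed simp

lemma theta_1: "\<xi>' 1 - \<theta> 1 = \<xi> 1"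
  by (simp add: \<theta>_def)

lemma theta_nonneg: "0 \<le> u \<Longrightarrow> u \<le> 1 \<Longrightarrow> 0 \<le> \<theta> u"
  using theta_diff_ge[of 0 u] theta_0 by simp

text \<open>In the variable \<open>s = \<xi>' u\<close> one has \<open>d\<theta> = u ds\<close>, and \<open>u\<close> is a concave function of \<open>s\<close>.\<close>

lemma theta_diff_le2:
  assumes q: "0 < q" "q \<le> v" "v \<le> 1"
  shows "\<theta> v - \<theta> q \<le> q * (\<xi>' v - \<xi>' q) + (\<xi>' v - \<xi>' q)\<^sup>2 / (2 * \<xi>'' q)"
proof -
  define f where "f = (\<lambda>u. q * (\<xi>' u - \<xi>' q) + (\<xi>' u - \<xi>' q)\<^sup>2 / (2 * \<xi>'' q) - \<theta> u)"
  have p: "0 < \<xi>'' q" using q by (intro xi''_pos) auto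
  have "f q \<le> f v"
  proof (rule DERIV_nonneg_imp_nondecreasing[OF q(2)])
    fix x assume x: "q \<le> x" "x \<le> v"
    have x2: "\<bar>x\<bar> < 2" using x q by auto
    have d: "(f has_real_derivative (q + (\<xi>' x - \<xi>' q) / \<xi>'' q - x) * \<xi>'' x) (at x)"
      unfolding f_def using p
      by (auto intro!: derivative_eq_intros xi'_derivative[OF x2] theta_derivative[OF x2] simp: field_simps)
    have "(x - q) * \<xi>'' q \<le> \<xi>' x - \<xi>' q"
    proof (cases "x = q")
      case False
      then obtain c where c: "q < c" "c < x" "\<xi>' x - \<xi>' q = (x - q) * \<xi>'' c"
        using xi'_mvt[of q x] x q by auto
      show ?thesis unfolding c(3) using c x q by (intro mult_left_mono xi''_mono) auto
    qed simp
    then have "0 \<le> q + (\<xi>' x - \<xi>' q) / \<xi>'' q - x" using p by (simp add: field_simps)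
    then show "\<exists>y. (f has_real_derivative y) (at x) \<and> 0 \<le> y"
      using d xi''_nonneg[of x] x q by (intro exI[of _ "(q + (\<xi>' x - \<xi>' q) / \<xi>'' q - x) * \<xi>'' x"]) auto
  qed
  then show ?thesis by (simp add: f_def)
qed

end

text \<open>\<open>cosh\<close> is an eigenfunction of Gaussian convolution. Hence a step of weight
  1 maps \<open>lc\<close> to itself plus a constant, the explicit case around which weights close
  to 1 are expanded.\<close>

lemma lc_moment_1: "lc_moment 1 r y = cosh y * exp (r\<^sup>2 / 2)"
proof -
  have "lc_moment 1 r y = gE (\<lambda>z. exp y / 2 * exp (r * z) + exp (- y) / 2 * exp ((- r) * z))"
    unfolding lc_moment_def
    by (rule Bochner_Integration.integral_cong)
       (auto simp: cosh_field_def add_divide_distrib exp_add[symmetric] intro!: add_pos_pos)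
  also have "\<dots> = exp y / 2 * exp (r\<^sup>2 / 2) + exp (- y) / 2 * exp ((- r)\<^sup>2 / 2)"
    by (subst gE_add, (intro exp_growth_intros)+) (simp only: integral_mult_right_zero gE_exp)
  finally show ?thesis by (simp add: cosh_field_def distrib_left add_divide_distrib mult.commute)
qed

lemma lc_pot_1: "lc_pot 1 s x = lc x + s\<^sup>2 / 2"
  by (simp add: lc_pot_def lc_moment_1 ln_mult)

lemma tilt_abs_le_1:
  assumes "continuous_on UNIV h" "\<And>y. \<bar>h y\<bar> \<le> 1"
  shows "\<bar>tilt m s x h\<bar> \<le> 1"
proof -
  have "-1 \<le> h y" "h y \<le> 1" for y using assms(2)[of y] by linarith+
  then have "-1 \<le> tilt m s x h" "tilt m s x h \<le> 1"
    using tilt_bounds[of h "-1" 1 m s x] borel_measurable_continuous_onI[OF assms(1)] by auto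
  then show ?thesis by linarith
qed

lemma exp_growth_tilt:
  assumes "continuous_on UNIV h" "\<And>y. \<bar>h y\<bar> \<le> 1"
  shows "exp_growth (\<lambda>z. tilt m s (a * z) h)"
  by (rule exp_growth_bounded[OF borel_measurable_continuous_onI[OF tilt_continuous[OF assms]] tilt_abs_le_1[OF assms]])

lemma lc_pot_tangent:
  assumes "0 < m"
  shows "lc_pot m s0 x0 + ((x - x0) * tilt m s0 x0 tanh + (s - s0) * s0 * tilt m s0 x0 (lc_curv m)) \<le> lc_pot m s x"
proof -
  define D where "D = (x - x0) * tilt m s0 x0 tanh + (s - s0) * s0 * tilt m s0 x0 (lc_curv m)"
  have "1 / m * (ln (lc_moment m s0 x0) + m * D) \<le> 1 / m * ln (lc_moment m s x)"
    using ln_lc_moment_tangent[of m s0 x0 x s] assms by (intro mult_left_mono) (auto simp: D_def)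
  then show ?thesis using assms unfolding D_def[symmetric] lc_pot_def by (simp add: distrib_left)
qed

lemma tanh_continuous: "continuous_on UNIV (tanh :: real \<Rightarrow> real)"
  by (intro continuous_intros) auto

lemma sqrt_diff_eq:
  assumes "0 < x" "0 \<le> y" shows "sqrt x - sqrt y = (x - y) / (sqrt x + sqrt y)"
proof -
  have "sqrt x + sqrt y \<noteq> 0" using assms by (simp add: add_pos_nonneg less_imp_neq[symmetric])
  moreover have "(sqrt x - sqrt y) * (sqrt x + sqrt y) = x - y" using assms by (simp add: algebra_simps)
  ultimately show ?thesis by (simp add: field_simps)
qed

section \<open>The Parisi functional at measures with few atoms\<close>

lemma singleton_in_borel01: "q \<in> {0..1} \<Longrightarrow> {q} \<in> sets borel01"
  by (simp add: sets_restrict_space_iff)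

lemma atomic_in_borel01: "A \<subseteq> {0..1} \<Longrightarrow> finite A \<Longrightarrow> A \<in> sets borel01"
  by (simp add: sets_restrict_space_iff finite_imp_closed borel_closed)

lemma interval_in_borel01: "u \<le> 1 \<Longrightarrow> {0..u} \<in> sets borel01"
  by (subst sets_restrict_space_iff) auto

lemma discrete_measure_eq_sum:
  assumes "\<nu> \<in> discrete_measures" "X \<in> sets borel01"
  shows "measure \<nu> X = (\<Sum>q\<in>atoms \<nu> \<inter> X. measure \<nu> {q})"
proof -
  interpret prob_space \<nu> using assms by (auto simp: discrete_measures_def prob_measures_def)
  have s: "sets \<nu> = sets borel01" using assms by (auto simp: discrete_measures_def prob_measures_def)
  have fin: "finite (atoms \<nu>)" and one: "prob (atoms \<nu>) = 1"
    using assms by (auto simp: discrete_measures_def)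
  have sub: "atoms \<nu> \<subseteq> {0..1}" by (auto simp: atoms_def)
  have A: "atoms \<nu> \<in> events" using atomic_in_borel01[OF sub fin] s by simp
  have X: "X \<in> events" using assms s by simp
  have "prob (X - atoms \<nu>) \<le> prob (space \<nu> - atoms \<nu>)"
    using X A sets.sets_into_space[OF X] by (intro finite_measure_mono) auto
  also have "\<dots> = 0" using prob_compl[OF A] one by simp
  finally have "prob (X - atoms \<nu>) = 0" by (simp add: measure_le_0_iff)
  then have "prob X = prob (atoms \<nu> \<inter> X)"
    using finite_measure_Diff'[OF X A] by (simp add: Int_commute)
  also have "\<dots> = (\<Sum>q\<in>atoms \<nu> \<inter> X. prob {q})"
    using fin sub singleton_in_borel01 s by (intro finite_measure_eq_sum_singleton) auto
  finally show ?thesis .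
qed

lemma gauss_prob_UNIV [simp]: "measure std_normal_distribution UNIV = 1"
  using gauss.prob_space by simp

lemma atomic_measure_exists:
  assumes A: "finite A" "A \<subseteq> {0..1}" and w: "\<And>q. q \<in> A \<Longrightarrow> 0 < w q" "sum w A = 1"
  obtains \<nu> where "\<nu> \<in> discrete_measures" "atoms \<nu> = A" "\<And>q. q \<in> A \<Longrightarrow> measure \<nu> {q} = w q"
proof -
  \<comment> \<open>\<open>point_measure\<close> lives on the power set of \<open>A\<close>; the
    push-forward supplies the sigma-algebra demanded by \<open>prob_measures\<close>.\<close>
  define \<nu> where "\<nu> = distr (point_measure A (\<lambda>q. ennreal (w q))) borel01 (\<lambda>x. x)"
  have m: "(\<lambda>x. x) \<in> measurable (point_measure A (\<lambda>q. ennreal (w q))) borel01"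
    using A by (auto simp: measurable_point_measure_eq1 space_restrict_space)
  have em: "emeasure \<nu> X = ennreal (\<Sum>q\<in>X \<inter> A. w q)" if "X \<in> sets borel01" for X
  proof -
    have "emeasure \<nu> X = emeasure (point_measure A (\<lambda>q. ennreal (w q))) (X \<inter> A)"
      unfolding \<nu>_def using m that by (simp add: emeasure_distr space_point_measure)
    also have "\<dots> = (\<Sum>q\<in>X \<inter> A. ennreal (w q))"
      using A by (intro emeasure_point_measure_finite) auto
    also have "\<dots> = ennreal (\<Sum>q\<in>X \<inter> A. w q)"
      using w by (intro sum_ennreal) (auto intro: less_imp_le)
    finally show ?thesis .
  qed
  have meas: "measure \<nu> X = (\<Sum>q\<in>X \<inter> A. w q)" if "X \<in> sets borel01" for X
    unfolding measure_def em[OF that] using w by (subst enn2real_ennreal) (auto intro!: sum_nonneg intro: less_imp_le)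
  have s: "sets \<nu> = sets borel01" by (simp add: \<nu>_def)
  have p: "prob_space \<nu>"
  proof
    have "{0..1} \<inter> A = A" using A by auto
    then show "emeasure \<nu> (space \<nu>) = 1"
      using em[of "{0..1}"] w by (simp add: \<nu>_def space_restrict_space sets_restrict_space_iff)
  qed
  have sing: "measure \<nu> {q} = (if q \<in> A then w q else 0)" if "q \<in> {0..1}" for q
    using meas[OF singleton_in_borel01[OF that]] by auto
  have at: "atoms \<nu> = A"
    using A w(1) sing by (auto simp: atoms_def split: if_splits)
  have "measure \<nu> A = 1" using meas[OF atomic_in_borel01[OF A(2,1)]] w by simp
  then have "\<nu> \<in> discrete_measures"
    using s p A at by (simp add: discrete_measures_def prob_measures_def)
  with at sing A that show ?thesis by (metis subsetD)
qed

lemma gauss_step_lc_pot: "m \<noteq> 0 \<Longrightarrow> gauss_step m s lc = lc_pot m (sqrt s)"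
  by (auto simp: gauss_step_def lc_pot_def lc_moment_def mult.commute)

lemma gauss_step_zero: "gauss_step 0 s f x = gE (\<lambda>z. f (x + sqrt s * z))"
  by (simp add: gauss_step_def mult.commute)

lemma gauss_step_add_const:
  assumes "exp_growth f" "exp_growth (\<lambda>y. exp (m * f y))"
  shows "gauss_step m s (\<lambda>y. f y + c) x = gauss_step m s f x + c"
proof (cases "m = 0")
  case True
  then show ?thesis unfolding True gauss_step_zero
    by (subst gE_add) (auto intro: exp_growth_affine assms exp_growth_const)
next
  case False
  have p: "0 < gE (\<lambda>z. exp (m * f (x + sqrt s * z)))"
    by (rule gE_pos[OF exp_growth_affine[OF assms(2)]]) simp
  have eq: "gE (\<lambda>z. exp (m * (f (x + sqrt s * z) + c))) = exp (m * c) * gE (\<lambda>z. exp (m * f (x + sqrt s * z)))"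
    by (simp add: distrib_left exp_add mult.commute)
  have g: "gauss_step m s f x = 1 / m * ln (gE (\<lambda>z. exp (m * f (x + sqrt s * z))))" for f
    using False unfolding gauss_step_def by (simp only: if_False mult.commute[of _ "sqrt s"])
  show ?thesis unfolding g eq using p False by (simp add: ln_mult add_divide_distrib)
qed

lemma lc_pot_lipschitz:
  assumes "m \<noteq> 0" shows "\<bar>lc_pot m s a - lc_pot m s b\<bar> \<le> \<bar>a - b\<bar>"
  using field_differentiable_bound[of UNIV "lc_pot m s" "\<lambda>x. tilt m s x tanh" 1 b a]
    lc_pot_has_derivative[OF assms] tilt_tanh_abs_le by auto

lemma lc_pot_bounds:
  assumes "m \<noteq> 0" shows "\<bar>lc_pot m s x\<bar> \<le> \<bar>lc_pot m s 0\<bar> + \<bar>x\<bar>"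
  using lc_pot_lipschitz[OF assms, of s x 0] by linarith

lemma lc_pot_measurable: "m \<noteq> 0 \<Longrightarrow> lc_pot m s \<in> borel_measurable borel"
  by (intro borel_measurable_continuous_onI continuous_at_imp_continuous_on ballI
       DERIV_isCont[OF lc_pot_has_derivative])

lemma exp_growth_lc_pot: "m \<noteq> 0 \<Longrightarrow> exp_growth (lc_pot m s)"
  by (rule exp_growth_mono[OF _ lc_pot_measurable lc_pot_bounds]) (auto intro!: exp_growth_intros)

lemma exp_growth_exp_lipschitz:
  assumes [measurable]: "f \<in> borel_measurable borel" and b: "\<And>x. \<bar>f x\<bar> \<le> c + \<bar>x\<bar>"
  shows "exp_growth (\<lambda>y. exp (m * f y))"
proof (rule exp_growth_mono[of "\<lambda>y. exp (\<bar>m\<bar> * c) * exp (\<bar>m\<bar> * \<bar>y\<bar>)"])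
  fix y
  have "m * f y \<le> \<bar>m\<bar> * \<bar>f y\<bar>" by (metis abs_ge_self abs_mult)
  also have "\<dots> \<le> \<bar>m\<bar> * (c + \<bar>y\<bar>)" by (intro mult_left_mono b) auto
  finally show "\<bar>exp (m * f y)\<bar> \<le> exp (\<bar>m\<bar> * c) * exp (\<bar>m\<bar> * \<bar>y\<bar>)"
    by (simp add: exp_add[symmetric] distrib_left)
qed (intro exp_growth_intros, measurable)

lemma exp_growth_exp_lc_pot: "n \<noteq> 0 \<Longrightarrow> exp_growth (\<lambda>y. exp (m * lc_pot n s y))"
  by (rule exp_growth_exp_lipschitz[OF lc_pot_measurable lc_pot_bounds])

lemma measure_Icc_discrete:
  assumes "\<nu> \<in> discrete_measures" "u \<le> 1"
  shows "measure \<nu> {0..u} = (\<Sum>q\<in>{q \<in> atoms \<nu>. q \<le> u}. measure \<nu> {q})"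
proof -
  have "atoms \<nu> \<inter> {0..u} = {q \<in> atoms \<nu>. q \<le> u}" by (auto simp: atoms_def)
  then show ?thesis using discrete_measure_eq_sum[OF assms(1) interval_in_borel01[OF assms(2)]] by simp
qed

context mixture_model
begin

lemma integral_indicator_theta:
  assumes "0 \<le> q" "q \<le> 1"
  shows "integrable lborel (\<lambda>u. u * \<xi>'' u * indicator {q..1} u)"
    and "(\<integral>u. u * \<xi>'' u * indicator {q..1} u \<partial>lborel) = \<theta> 1 - \<theta> q"
proof -
  have c: "isCont (\<lambda>u. u * \<xi>'' u) x" if "q \<le> x" "x \<le> 1" for x
    using that assms by (intro continuous_intros xi''_isCont) auto
  show "integrable lborel (\<lambda>u. u * \<xi>'' u * indicator {q..1} u)"
    by (rule borel_integrable_atLeastAtMost) (use c in auto)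
  show "(\<integral>u. u * \<xi>'' u * indicator {q..1} u \<partial>lborel) = \<theta> 1 - \<theta> q"
    by (rule integral_FTC_Icc_real) (use c assms in \<open>auto intro!: theta_derivative\<close>)
qed

text \<open>The distribution function is a sum of steps \<open>indicator {q..1} u\<close>, and each
  step integrates \<open>u * \<xi>'' u\<close> to \<open>\<theta> 1 - \<theta> q\<close>.\<close>

lemma parisi_discrete:
  assumes \<nu>: "\<nu> \<in> discrete_measures"
  shows "parisi_functional \<xi> \<nu> =
    Phi_rec \<xi> (\<lambda>q. measure \<nu> {0..q}) 0 (sorted_list_of_set (atoms \<nu>)) 0 0
    - 1 / 2 * (\<Sum>q\<in>atoms \<nu>. measure \<nu> {q} * (\<theta> 1 - \<theta> q))"
proof -
  have fin: "finite (atoms \<nu>)" using \<nu> by (auto simp: discrete_measures_def)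
  have sub: "q \<in> atoms \<nu> \<Longrightarrow> 0 \<le> q \<and> q \<le> 1" for q by (auto simp: atoms_def)
  have "(LBINT u:{0..1}. u * \<xi>'' u * measure \<nu> {0..u})
     = (\<integral>u. (\<Sum>q\<in>atoms \<nu>. measure \<nu> {q} * (u * \<xi>'' u * indicator {q..1} u)) \<partial>lborel)"
    unfolding set_lebesgue_integral_def
  proof (rule Bochner_Integration.integral_cong[OF refl])
    fix u :: real
    show "indicator {0..1} u *\<^sub>R (u * \<xi>'' u * measure \<nu> {0..u}) =
      (\<Sum>q\<in>atoms \<nu>. measure \<nu> {q} * (u * \<xi>'' u * indicator {q..1} u))"
    proof (cases "u \<in> {0..1}")
      case True
      have "measure \<nu> {0..u} = (\<Sum>q\<in>atoms \<nu> \<inter> {0..u}. measure \<nu> {q})"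
        using True by (intro discrete_measure_eq_sum[OF \<nu>] interval_in_borel01) auto
      also have "\<dots> = (\<Sum>q\<in>atoms \<nu>. measure \<nu> {q} * indicator {q..1} u)"
        using True sub fin by (intro sum.mono_neutral_cong_left) (auto simp: indicator_def)
      finally show ?thesis using True by (simp add: sum_distrib_left mult_ac)
    next
      case False
      then have "indicator {q..1} u = (0::real)" if "q \<in> atoms \<nu>" for q
        using sub[OF that] by (auto simp: indicator_def)
      then show ?thesis using False by simp
    qed
  qed
  also have "\<dots> = (\<Sum>q\<in>atoms \<nu>. measure \<nu> {q} * (\<theta> 1 - \<theta> q))"
    using sub integral_indicator_theta by (subst Bochner_Integration.integral_sum) auto
  finally show ?thesis
    using \<nu> by (simp add: parisi_functional_def Phi_def Phi_discrete_def)
qed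

text \<open>In \<open>P2 a b m\<close> the atom \<open>a\<close> has mass \<open>m\<close>; in \<open>P3 b c m n\<close> the lowest atom is \<open>0\<close>, and
  \<open>m\<close> and \<open>n\<close> are the masses of \<open>[0, b)\<close> and \<open>[0, c)\<close>.\<close>

definition P1 :: "real \<Rightarrow> real" where
  "P1 q = gE (\<lambda>z. lc (sqrt (\<xi>' q) * z)) + (\<xi>' 1 - \<xi>' q) / 2 - 1 / 2 * (\<theta> 1 - \<theta> q)"

definition P2 :: "real \<Rightarrow> real \<Rightarrow> real \<Rightarrow> real" where
  "P2 a b m = gE (\<lambda>z. lc_pot m (sqrt (\<xi>' b - \<xi>' a)) (sqrt (\<xi>' a) * z)) + (\<xi>' 1 - \<xi>' b) / 2
     - 1 / 2 * (m * (\<theta> 1 - \<theta> a) + (1 - m) * (\<theta> 1 - \<theta> b))"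

definition P3 :: "real \<Rightarrow> real \<Rightarrow> real \<Rightarrow> real \<Rightarrow> real" where
  "P3 b c m n = gauss_step m (\<xi>' b) (lc_pot n (sqrt (\<xi>' c - \<xi>' b))) 0 + (\<xi>' 1 - \<xi>' c) / 2
     - 1 / 2 * (m * \<theta> 1 + (n - m) * (\<theta> 1 - \<theta> b) + (1 - n) * (\<theta> 1 - \<theta> c))"

lemma parisi_P1:
  assumes \<nu>: "\<nu> \<in> discrete_measures" "atoms \<nu> = {q}" "measure \<nu> {q} = 1"
  shows "parisi_functional \<xi> \<nu> = P1 q"
proof -
  have q: "0 \<le> q" "q \<le> 1" using assms by (auto simp: atoms_def)
  have e: "exp_growth (\<lambda>y. exp (0 * lc y))" by (simp add: exp_growth_const)
  have "gauss_step 0 (\<xi>' q) (\<lambda>y. lc y + (\<xi>' 1 - \<xi>' q) / 2) 0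
     = gE (\<lambda>z. lc (sqrt (\<xi>' q) * z)) + (\<xi>' 1 - \<xi>' q) / 2"
    unfolding gauss_step_add_const[OF exp_growth_lc e] gauss_step_zero by simp
  \<comment> \<open>\<open>Phi_rec\<close> is evaluated at \<open>u = 0\<close>, where an atom at 0
    fails the test \<open>u < q\<close> and triggers no Gaussian step. The formula still holds
    because \<open>\<xi>' 0 = 0\<close>.\<close>
  then show ?thesis unfolding parisi_discrete[OF \<nu>(1)] P1_def assms
    using q \<nu>(3) by (cases "q = 0") (auto simp: \<nu>(2) xi'_0)
qed

lemma parisi_P2:
  assumes \<nu>: "\<nu> \<in> discrete_measures" "atoms \<nu> = {a, b}" and ab: "a < b"
    and w: "measure \<nu> {a} = m" "measure \<nu> {b} = 1 - m"
  shows "parisi_functional \<xi> \<nu> = P2 a b m"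
proof -
  have q: "0 \<le> a" "b \<le> 1" "0 < m" using assms by (auto simp: atoms_def)
  have s: "sorted_list_of_set {a, b} = [a, b]" using ab by simp
  have "{q \<in> atoms \<nu>. q \<le> a} = {a}" using \<nu> ab by auto
  then have Fa: "measure \<nu> {0..a} = m" using measure_Icc_discrete[OF \<nu>(1), of a] q ab w by simp
  define s2 where "s2 = \<xi>' b - \<xi>' a"
  define c where "c = (\<xi>' 1 - \<xi>' b) / 2"
  have e: "exp_growth (\<lambda>y. exp (0 * lc_pot m (sqrt s2) y))" by (simp add: exp_growth_const)
  have 1: "gauss_step m s2 (\<lambda>y. lc y + c) = (\<lambda>y. lc_pot m (sqrt s2) y + c)"
    using gauss_step_add_const[OF exp_growth_lc exp_growth_exp_lc] gauss_step_lc_pot[of m s2] q by auto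
  have 2: "gauss_step 0 (\<xi>' a) (\<lambda>y. lc_pot m (sqrt s2) y + c) 0 = gE (\<lambda>z. lc_pot m (sqrt s2) (sqrt (\<xi>' a) * z)) + c"
    using q by (subst gauss_step_add_const[OF exp_growth_lc_pot e]) (auto simp: gauss_step_zero)
  have "Phi_rec \<xi> (\<lambda>q. measure \<nu> {0..q}) 0 [a, b] 0 0 = gE (\<lambda>z. lc_pot m (sqrt s2) (sqrt (\<xi>' a) * z)) + c"
  \<comment> \<open>For \<open>a = 0\<close> the recursion skips the step of weight 0; in
    \<open>P2\<close> that step is an expectation with variance \<open>\<xi>' 0 = 0\<close>.\<close>
  proof (cases "a = 0")
    case True
    then show ?thesis using ab Fa fun_cong[OF 1, of 0]
      by (simp add: s2_def c_def True xi'_0)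
  next
    case False
    then show ?thesis using ab q Fa 2 by (simp add: s2_def[symmetric] c_def[symmetric] 1 xi'_0)
  qed
  then show ?thesis unfolding parisi_discrete[OF \<nu>(1)] P2_def \<nu>(2) s
    using ab by (simp add: w s2_def c_def)
qed

lemma parisi_P3:
  assumes \<nu>: "\<nu> \<in> discrete_measures" "atoms \<nu> = {0, b, c}" and bc: "0 < b" "b < c"
    and w: "measure \<nu> {0} = m" "measure \<nu> {b} = n - m" "measure \<nu> {c} = 1 - n"
  shows "parisi_functional \<xi> \<nu> = P3 b c m n"
proof -
  have at: "0 \<in> atoms \<nu>" "b \<in> atoms \<nu>" "c \<in> atoms \<nu>" using \<nu> by auto
  then have q: "c \<le> 1" "0 < m" "m < n" using w by (auto simp: atoms_def)
  have s: "sorted_list_of_set {0, b, c} = [0, b, c]" using bc by simp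
  have "{q \<in> atoms \<nu>. q \<le> 0} = {0}" using \<nu> bc by auto
  then have F0: "measure \<nu> {0..0} = m" using measure_Icc_discrete[OF \<nu>(1), of 0] w by simp
  have "{q \<in> atoms \<nu>. q \<le> b} = {0, b}" using \<nu> bc by auto
  then have Fb: "measure \<nu> {0..b} = n" using measure_Icc_discrete[OF \<nu>(1), of b] q bc w by simp
  define s2 where "s2 = \<xi>' c - \<xi>' b"
  define d where "d = (\<xi>' 1 - \<xi>' c) / 2"
  have 1: "gauss_step n s2 (\<lambda>y. lc y + d) = (\<lambda>y. lc_pot n (sqrt s2) y + d)"
    using gauss_step_add_const[OF exp_growth_lc exp_growth_exp_lc] gauss_step_lc_pot[of n s2] q by auto
  have 2: "gauss_step m (\<xi>' b) (\<lambda>y. lc_pot n (sqrt s2) y + d) 0 = gauss_step m (\<xi>' b) (lc_pot n (sqrt s2)) 0 + d"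
    using q by (intro gauss_step_add_const exp_growth_lc_pot exp_growth_exp_lc_pot) auto
  have "Phi_rec \<xi> (\<lambda>q. measure \<nu> {0..q}) 0 [0, b, c] 0 0 = gauss_step m (\<xi>' b) (lc_pot n (sqrt s2)) 0 + d"
    using bc 2 F0 Fb by (simp add: s2_def[symmetric] d_def[symmetric] 1 xi'_0)
  then show ?thesis unfolding parisi_discrete[OF \<nu>(1)] P3_def \<nu>(2) s
    using bc by (simp add: w s2_def d_def theta_0)
qed

end

section \<open>The lowest atom\<close>

text \<open>An upper bound is what is wanted, since a competitor has to be shown cheap. The factor
  \<open>exp |t|\<close> keeps the remainder Gaussian integrable for \<open>t\<close> of linear
  growth.\<close>

lemma exp_le_taylor2: "exp t \<le> 1 + t + t\<^sup>2 * exp \<bar>t\<bar>" for t :: real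
proof -
  obtain u where u: "\<bar>u\<bar> \<le> \<bar>t\<bar>" "exp t = (\<Sum>k<2. t ^ k / fact k) + exp u / fact 2 * t ^ 2"
    using Maclaurin_exp_le[of t 2] by blast
  have "exp u / 2 \<le> exp u" by simp
  also have "\<dots> \<le> exp \<bar>t\<bar>" using u(1) by simp
  finally have "exp u / 2 * t\<^sup>2 \<le> exp \<bar>t\<bar> * t\<^sup>2" by (intro mult_right_mono) auto
  then show ?thesis using u(2) by (simp add: numeral_2_eq_2 mult.commute)
qed

lemma exp_le_taylor3: "exp t \<le> 1 + t + t\<^sup>2 / 2 + \<bar>t\<bar> ^ 3 * exp \<bar>t\<bar>" for t :: real
proof -
  obtain u where u: "\<bar>u\<bar> \<le> \<bar>t\<bar>" "exp t = (\<Sum>k<3. t ^ k / fact k) + exp u / fact 3 * t ^ 3"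
    using Maclaurin_exp_le[of t 3] by blast
  have "exp u / fact 3 * t ^ 3 \<le> exp u / fact 3 * \<bar>t\<bar> ^ 3"
    by (intro mult_left_mono) (auto simp: power_abs[symmetric])
  also have "\<dots> \<le> exp \<bar>t\<bar> * \<bar>t\<bar> ^ 3"
  proof (rule mult_right_mono)
    have "exp u / fact 3 \<le> exp u / 1" by (intro divide_left_mono) (auto simp: fact_numeral)
    also have "\<dots> \<le> exp \<bar>t\<bar>" using u(1) by simp
    finally show "exp u / fact 3 \<le> exp \<bar>t\<bar>" .
  qed auto
  finally show ?thesis using u(2) by (simp add: numeral_3_eq_3 power2_eq_square mult.commute)
qed

text \<open>Stands in for differentiating at 0: \<open>A\<close> and \<open>B\<close> are
  first-order coefficients in a small mass \<open>e\<close>, and \<open>C * e\<close> is the Taylor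
  error.\<close>

lemma le_of_linear_error:
  fixes A B C e0 :: real
  assumes "0 < e0" "\<And>e. 0 < e \<Longrightarrow> e < e0 \<Longrightarrow> A \<le> B + C * e"
  shows "A \<le> B"
proof (rule tendsto_lowerbound)
  show "((\<lambda>e. B + C * e) \<longlongrightarrow> B) (at_right 0)"
    by (auto intro!: tendsto_eq_intros)
  show "\<forall>\<^sub>F e in at_right 0. A \<le> B + C * e"
    unfolding eventually_at_right_field using assms by blast
qed simp

lemma exp_growth_exp_abs_lipschitz:
  assumes [measurable]: "Y \<in> borel_measurable borel" and b: "\<And>z. \<bar>Y z\<bar> \<le> c + d * \<bar>z\<bar>"
  shows "exp_growth (\<lambda>z. exp \<bar>Y z\<bar>)" "exp_growth Y"
proof -
  show "exp_growth (\<lambda>z. exp \<bar>Y z\<bar>)"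
  proof (rule exp_growth_mono[of "\<lambda>z. exp c * exp (d * \<bar>z\<bar>)"])
    show "\<bar>exp \<bar>Y z\<bar>\<bar> \<le> exp c * exp (d * \<bar>z\<bar>)" for z
      using b[of z] by (simp add: exp_add[symmetric])
  qed (intro exp_growth_intros, measurable)
  show "exp_growth Y"
    by (rule exp_growth_mono[OF _ _ b]) (intro exp_growth_intros, measurable)
qed

context mixture_model
begin

section \<open>Competitors with at most three atoms, and the explicit values of the
  candidates\<close>

lemma exists_P1:
  assumes "0 \<le> q" "q \<le> 1"
  obtains \<nu> where "\<nu> \<in> prob_measures" "parisi_functional \<xi> \<nu> = P1 q"
proof -
  obtain \<nu> where "\<nu> \<in> discrete_measures" "atoms \<nu> = {q}" "\<And>x. x \<in> {q} \<Longrightarrow> measure \<nu> {x} = 1"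
    using atomic_measure_exists[of "{q}" "\<lambda>_. 1"] assms by auto
  then show ?thesis using that[of \<nu>] parisi_P1[of \<nu> q] by (auto simp: discrete_measures_def)
qed

lemma exists_P2:
  assumes "0 \<le> a" "a < b" "b \<le> 1" "0 < m" "m < 1"
  obtains \<nu> where "\<nu> \<in> prob_measures" "parisi_functional \<xi> \<nu> = P2 a b m"
proof -
  define w where "w = (\<lambda>x. if x = a then m else 1 - m)"
  have "finite {a, b}" "{a, b} \<subseteq> {0..1}" "\<And>x. x \<in> {a, b} \<Longrightarrow> 0 < w x" "sum w {a, b} = 1"
    using assms by (auto simp: w_def)
  then show ?thesis
  proof (rule atomic_measure_exists)
    fix \<nu>
    assume \<nu>: "\<nu> \<in> discrete_measures" "atoms \<nu> = {a, b}" "\<And>x. x \<in> {a, b} \<Longrightarrow> measure \<nu> {x} = w x"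
    have "parisi_functional \<xi> \<nu> = P2 a b m"
      by (rule parisi_P2[OF \<nu>(1,2)]) (use assms \<nu>(3)[of a] \<nu>(3)[of b] in \<open>simp_all add: w_def\<close>)
    then show ?thesis using that[of \<nu>] \<nu>(1) by (auto simp: discrete_measures_def)
  qed
qed

lemma exists_P3:
  assumes "0 < b" "b < c" "c \<le> 1" "0 < m" "m < n" "n < 1"
  obtains \<nu> where "\<nu> \<in> prob_measures" "parisi_functional \<xi> \<nu> = P3 b c m n"
proof -
  define w where "w = (\<lambda>x. if x = 0 then m else if x = b then n - m else 1 - n)"
  have "finite {0, b, c}" "{0, b, c} \<subseteq> {0..1}" "\<And>x. x \<in> {0, b, c} \<Longrightarrow> 0 < w x" "sum w {0, b, c} = 1"
    using assms by (auto simp: w_def)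
  then show ?thesis
  proof (rule atomic_measure_exists)
    fix \<nu>
    assume \<nu>: "\<nu> \<in> discrete_measures" "atoms \<nu> = {0, b, c}" "\<And>x. x \<in> {0, b, c} \<Longrightarrow> measure \<nu> {x} = w x"
    have "parisi_functional \<xi> \<nu> = P3 b c m n"
      by (rule parisi_P3[OF \<nu>(1,2)]) (use assms \<nu>(3)[of 0] \<nu>(3)[of b] \<nu>(3)[of c] in \<open>simp_all add: w_def\<close>)
    then show ?thesis using that[of \<nu>] \<nu>(1) by (auto simp: discrete_measures_def)
  qed
qed

lemma replica_symmetric_P1:
  assumes "replica_symmetric \<mu>"
  obtains q where "0 \<le> q" "q \<le> 1" "parisi_functional \<xi> \<mu> = P1 q"
proof -
  obtain q where q: "q \<in> {0..1}" "\<mu> = return borel01 q"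
    using assms by (auto simp: replica_symmetric_def)
  have m: "measure \<mu> {x} = (if x = q then 1 else 0)" if "x \<in> {0..1}" for x
    using singleton_in_borel01[OF that] by (auto simp: q(2) measure_return indicator_def)
  have at: "atoms \<mu> = {q}" using m q(1) by (auto simp: atoms_def split: if_splits)
  have "\<mu> \<in> prob_measures"
    using q by (auto simp: prob_measures_def space_restrict_space intro!: prob_space_return)
  then have "\<mu> \<in> discrete_measures" using at m q(1) by (simp add: discrete_measures_def)
  then show ?thesis using that[of q] q(1) parisi_P1[of \<mu> q] at m by simp
qed

lemma one_step_rsb_P2:
  assumes "one_step_rsb \<mu>"
  obtains a b m where "0 \<le> a" "a < b" "b \<le> 1" "0 < m" "m < 1" "parisi_functional \<xi> \<mu> = P2 a b m"
proof -
  have d: "\<mu> \<in> discrete_measures" and c: "card (atoms \<mu>) = 2"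
    using assms by (auto simp: one_step_rsb_def)
  obtain x y where xy: "atoms \<mu> = {x, y}" "x \<noteq> y" using c by (auto simp: card_2_iff)
  obtain a b where ab: "atoms \<mu> = {a, b}" "a < b"
  proof (cases "x < y")
    case True then show ?thesis using that[of x y] xy by simp
  next
    case False then show ?thesis using that[of y x] xy by (simp add: insert_commute)
  qed
  have "atoms \<mu> \<subseteq> {0..1}" by (auto simp: atoms_def)
  then have "{a, b} \<in> sets borel01" unfolding ab(1) by (rule atomic_in_borel01) simp
  from discrete_measure_eq_sum[OF d this]
  have "measure \<mu> {a, b} = (\<Sum>q\<in>{a, b}. measure \<mu> {q})"
    unfolding ab(1) by simp
  moreover have "measure \<mu> {a, b} = 1" using d ab by (auto simp: discrete_measures_def)
  ultimately have s: "measure \<mu> {a} + measure \<mu> {b} = 1" using ab by simp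
  have "a \<in> atoms \<mu>" "b \<in> atoms \<mu>" using ab by auto
  then have "0 \<le> a" "b \<le> 1" "0 < measure \<mu> {a}" "0 < measure \<mu> {b}" by (auto simp: atoms_def)
  moreover have "parisi_functional \<xi> \<mu> = P2 a b (measure \<mu> {a})"
    using s by (intro parisi_P2[OF d ab(1,2)]) auto
  ultimately show ?thesis using that[of a b "measure \<mu> {a}"] ab(2) s by simp
qed

text \<open>With mass 1 below, the atom at 1 carries nothing, and the step of weight 1 adds exactly
  \<open>(\<xi>' 1 - \<xi>' q) / 2\<close>. This lets the two-atom stationarity argument serve for
  Dirac measures.\<close>

lemma P1_eq_P2:
  assumes "0 \<le> q" "q \<le> 1" shows "P1 q = P2 q 1 1"
proof -
  have "0 \<le> \<xi>' 1 - \<xi>' q" using xi'_mono[of q 1] assms by simp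
  moreover have "exp_growth (\<lambda>z. lc (sqrt (\<xi>' q) * z))"
    using exp_growth_affine[OF exp_growth_lc, of 0] by simp
  ultimately show ?thesis unfolding P1_def P2_def lc_pot_1
    by (simp add: gE_add exp_growth_const)
qed

text \<open>Otherwise it would pay to move the lower atom \<open>a\<close> to the right.\<close>

lemma lower_atom_stationary:
  assumes a: "0 < a" "a < b" "b \<le> 1" and m: "0 < m" "m \<le> 1"
    and opt: "\<And>a'. a < a' \<Longrightarrow> a' < b \<Longrightarrow> P2 a b m \<le> P2 a' b m"
  shows "gE (\<lambda>z. (tilt m (sqrt (\<xi>' b - \<xi>' a)) (sqrt (\<xi>' a) * z) tanh)\<^sup>2) \<le> a"
proof -
  define S where "S = \<xi>' a"
  define s where "s = sqrt (\<xi>' b - \<xi>' a)"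
  \<comment> \<open>The offset 2 keeps \<open>A n\<close> strictly below \<open>b\<close> already
    for \<open>n = 0\<close>.\<close>
  define A where "A = (\<lambda>n. a + (b - a) / (real n + 2))"
  define X where "X = (\<lambda>n. \<xi>' (A n))"
  define s' where "s' = (\<lambda>n. sqrt (\<xi>' b - X n))"
  define V where "V = (\<lambda>n. gE (\<lambda>z. tilt m (s' n) (sqrt (X n) * z) (lc_curv m)))"
  define T where "T = (\<lambda>n. gE (\<lambda>z. (tilt m (s' n) (sqrt (X n) * z) tanh)\<^sup>2))"
  define T0 V0 where "T0 = gE (\<lambda>z. (tilt m s (sqrt S * z) tanh)\<^sup>2)" and "V0 = gE (\<lambda>z. tilt m s (sqrt S * z) (lc_curv m))"
  note c = lc_curv_bounds(3)[OF less_imp_le[OF m(1)] m(2)]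
  have An: "a < A n" "A n < b" for n
  proof -
    show "a < A n" using a by (simp add: A_def)
    have "(b - a) / (real n + 2) < (b - a) / 1" using a by (intro divide_strict_left_mono) auto
    then show "A n < b" by (simp add: A_def)
  qed
  have S: "0 < S" unfolding S_def using a by (intro xi'_pos) auto
  have s: "0 < s" unfolding s_def using xi'_less[of a b] a by simp
  have X: "S < X n" "X n < \<xi>' b" for n
    unfolding S_def X_def using An[of n] a by (auto intro!: xi'_less)
  have s'_pos: "0 < s' n" for n using X[of n] by (simp add: s'_def)
  have Alim: "A \<longlonglongrightarrow> a" unfolding A_def by real_asymp
  have Xlim: "X \<longlonglongrightarrow> S" unfolding X_def S_def
    by (rule isCont_tendsto_compose[OF DERIV_isCont[OF xi'_derivative] Alim]) (use a in auto)
  have slim: "s' \<longlonglongrightarrow> s" unfolding s'_def s_def S_def[symmetric]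
    by (intro tendsto_intros Xlim)
  have Vlim: "V \<longlonglongrightarrow> V0" unfolding V_def V0_def
    by (rule gE_tendsto[OF _ _ exp_growth_const[of 1]])
       (use tilt_abs_le_1[OF lc_curv_continuous c] in \<open>auto intro!: exp_growth_meas[OF exp_growth_tilt] lc_curv_continuous c
          tilt_tendsto[OF _ slim] tendsto_intros Xlim\<close>)
  have Tlim: "T \<longlonglongrightarrow> T0" unfolding T_def T0_def
    by (rule gE_tendsto[OF _ _ exp_growth_const[of 1]])
       (use tilt_tanh_abs_le in \<open>auto intro!: exp_growth_meas[OF exp_growth_power[OF exp_growth_tilt]] tanh_continuous
          abs_tanh_le_1 tilt_tendsto[OF _ slim] tendsto_intros Xlim simp: abs_square_le_1\<close>)
  \<comment> \<open>The tangent at the moved atom \<open>A n\<close> is evaluated at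
    \<open>a\<close>. After division by the increment of \<open>\<xi>'\<close>, the two terms in
    \<open>V\<close> tend to minus and plus half of \<open>V0\<close> and cancel, which leaves
    \<open>m * T0 \<le> m * a\<close>.\<close>
  have key: "- (sqrt (X n) / (sqrt S + sqrt (X n))) * (V n - m * T n) + s' n / (s + s' n) * V n \<le> 1 / 2 * (m * A n)" for n
  proof -
    define x where "x = sqrt (X n)"
    have x: "0 < x" using X[of n] S by (simp add: x_def)
    define \<delta> where "\<delta> = X n - S"
    have \<delta>: "0 < \<delta>" using X[of n] by (simp add: \<delta>_def)
    let ?T = "\<lambda>z. tilt m (s' n) (x * z) tanh" and ?V = "\<lambda>z. tilt m (s' n) (x * z) (lc_curv m)"
    have eT: "exp_growth ?T" by (intro exp_growth_tilt tanh_continuous abs_tanh_le_1)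
    have eV: "exp_growth ?V" by (intro exp_growth_tilt lc_curv_continuous c)
    have ibp: "gE (\<lambda>z. z * ?T z) = gE (\<lambda>z. x * (?V z - m * (?T z)\<^sup>2))"
    proof (rule gauss_ibp[OF _ eT])
      fix z
      have "((\<lambda>z. x * z) has_real_derivative x) (at z)" by (auto intro!: derivative_eq_intros)
      from DERIV_chain2[OF tilt_tanh_has_derivative this, of m "s' n"]
      show "(?T has_real_derivative x * (?V z - m * (?T z)\<^sup>2)) (at z)" by (simp add: mult.commute)
      show "exp_growth (\<lambda>z. x * (?V z - m * (?T z)\<^sup>2))" by (intro exp_growth_intros eT eV)
    qed
    have VT: "gE ?V = V n" "gE (\<lambda>z. (?T z)\<^sup>2) = T n" by (simp_all add: V_def T_def x_def)
    have e1: "exp_growth (\<lambda>z. lc_pot m s (sqrt S * z))"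
      using exp_growth_affine[OF exp_growth_lc_pot, of m s 0] m by simp
    have e2: "exp_growth (\<lambda>z. lc_pot m (s' n) (x * z))"
      using exp_growth_affine[OF exp_growth_lc_pot, of m "s' n" 0] m by simp
    have "gE (\<lambda>z. lc_pot m (s' n) (x * z) + (sqrt S - x) * (z * ?T z) + (s - s' n) * s' n * ?V z)
      \<le> gE (\<lambda>z. lc_pot m s (sqrt S * z))"
    proof (rule gE_mono)
      show "lc_pot m (s' n) (x * z) + (sqrt S - x) * (z * ?T z) + (s - s' n) * s' n * ?V z
        \<le> lc_pot m s (sqrt S * z)" for z
        using lc_pot_tangent[OF m(1), of "s' n" "x * z" "sqrt S * z" s] by (simp add: algebra_simps)
    qed (intro exp_growth_intros e1 e2 eT eV)+
    also have "gE (\<lambda>z. lc_pot m (s' n) (x * z) + (sqrt S - x) * (z * ?T z) + (s - s' n) * s' n * ?V z)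
      = gE (\<lambda>z. lc_pot m (s' n) (x * z)) + (sqrt S - x) * gE (\<lambda>z. z * ?T z) + (s - s' n) * s' n * V n"
      by (simp add: gE_add exp_growth_intros e1 e2 eT eV VT)
    also have "gE (\<lambda>z. z * ?T z) = x * (V n - m * T n)"
      unfolding ibp by (simp add: gE_diff exp_growth_intros eT eV VT)
    finally have 1: "(sqrt S - x) * (x * (V n - m * T n)) + (s - s' n) * s' n * V n
       \<le> gE (\<lambda>z. lc_pot m s (sqrt S * z)) - gE (\<lambda>z. lc_pot m (s' n) (x * z))" by linarith
    have p1: "P2 a b m = gE (\<lambda>z. lc_pot m s (sqrt S * z)) + (\<xi>' 1 - \<xi>' b) / 2
      - 1 / 2 * (m * (\<theta> 1 - \<theta> a) + (1 - m) * (\<theta> 1 - \<theta> b))"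
      unfolding P2_def s_def S_def ..
    have p2: "P2 (A n) b m = gE (\<lambda>z. lc_pot m (s' n) (x * z)) + (\<xi>' 1 - \<xi>' b) / 2
      - 1 / 2 * (m * (\<theta> 1 - \<theta> (A n)) + (1 - m) * (\<theta> 1 - \<theta> b))"
      unfolding P2_def s'_def x_def X_def ..
    have "P2 a b m \<le> P2 (A n) b m" using An[of n] by (rule opt)
    then have "gE (\<lambda>z. lc_pot m s (sqrt S * z)) - gE (\<lambda>z. lc_pot m (s' n) (x * z)) \<le> 1 / 2 * (m * (\<theta> (A n) - \<theta> a))"
      unfolding p1 p2 by (simp add: algebra_simps)
    also have "\<dots> \<le> 1 / 2 * (m * (A n * \<delta>))"
      using theta_diff_le[of a "A n"] An[of n] a m by (simp add: \<delta>_def S_def X_def)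
    finally have 2: "(sqrt S - x) * (x * (V n - m * T n)) + (s - s' n) * s' n * V n \<le> 1 / 2 * (m * (A n * \<delta>))"
      using 1 by linarith
    have 3: "sqrt S - x = - \<delta> / (sqrt S + x)"
      using sqrt_diff_eq[of S "X n"] S X[of n] by (simp add: x_def \<delta>_def)
    have 4: "s - s' n = \<delta> / (s + s' n)"
      using sqrt_diff_eq[of "\<xi>' b - S" "\<xi>' b - X n"] X[of n] by (simp add: s_def s'_def S_def \<delta>_def)
    have "\<delta> * (- (x / (sqrt S + x)) * (V n - m * T n) + s' n / (s + s' n) * V n) \<le> \<delta> * (1 / 2 * (m * A n))"
      using 2 unfolding 3 4 by (simp add: algebra_simps)
    then show ?thesis using \<delta> unfolding x_def by (simp only: mult_le_cancel_left_pos)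
  qed
  have "- (sqrt S / (sqrt S + sqrt S)) * (V0 - m * T0)
      + s / (s + s) * V0 \<le> 1 / 2 * (m * a)"
  proof (rule LIMSEQ_le)
    show "(\<lambda>n. 1 / 2 * (m * A n)) \<longlonglongrightarrow> 1 / 2 * (m * a)" by (intro tendsto_intros Alim)
    show "(\<lambda>n. - (sqrt (X n) / (sqrt S + sqrt (X n))) * (V n - m * T n) + s' n / (s + s' n) * V n)
      \<longlonglongrightarrow> - (sqrt S / (sqrt S + sqrt S)) * (V0 - m * T0)
      + s / (s + s) * V0"
      by (intro tendsto_intros Xlim slim Vlim Tlim) (use S s in auto)
  qed (use key in auto)
  then have "m * T0 \<le> m * a"
    using S s by (simp add: field_simps)
  then show ?thesis using m by (simp add: T0_def S_def s_def)
qed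

text \<open>Moving mass \<open>\<epsilon>\<close> from the lower atom \<open>a\<close> to \<open>0\<close> changes the functional by
  \<open>\<epsilon>/2\<close> times a variance minus \<open>\<theta> a\<close>; the strict Poincare inequality makes this negative.\<close>

lemma lower_atom_unstable:
  assumes a: "0 < a" "a \<le> b" "b \<le> 1" and m: "0 < m" "m \<le> 1" and e0: "0 < e0"
    and stat: "gE (\<lambda>z. (tilt m s (sqrt (\<xi>' a) * z) tanh)\<^sup>2) \<le> a"
    and opt: "\<And>e. 0 < e \<Longrightarrow> e < e0 \<Longrightarrow>
      gE (\<lambda>z. lc_pot m s (sqrt (\<xi>' a) * z)) \<le> gauss_step e (\<xi>' a) (lc_pot m s) 0 - 1 / 2 * e * \<theta> a"
  shows False
proof -
  define r where "r = sqrt (\<xi>' a)"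
  have S: "0 < \<xi>' a" using a by (intro xi'_pos) auto
  have r: "0 < r" "r\<^sup>2 = \<xi>' a" using S by (auto simp: r_def)
  define \<phi> where "\<phi> = (\<lambda>z. lc_pot m s (r * z))"
  define f where "f = (\<lambda>z. r * tilt m s (r * z) tanh)"
  have d: "(\<phi> has_real_derivative f x) (at x)" for x
  proof -
    have "((\<lambda>z. r * z) has_real_derivative r) (at x)" by (auto intro!: derivative_eq_intros)
    from DERIV_chain2[OF lc_pot_has_derivative this, of m s] show ?thesis
      using m by (simp add: \<phi>_def f_def mult.commute)
  qed
  have fb: "\<bar>f x\<bar> \<le> r" for x
    using r mult_left_mono[OF tilt_tanh_abs_le[of m s "r * x"], of r] by (simp add: f_def abs_mult)
  have cf: "continuous_on UNIV f"
    unfolding f_def by (intro continuous_intros tilt_continuous[OF tanh_continuous abs_tanh_le_1])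
  have even: "\<phi> (- x) = \<phi> x" for x
    using lc_moment_even[of m s "r * x"] by (simp add: \<phi>_def lc_pot_def)
  \<comment> \<open>Since \<open>\<phi> y \<ge> r * y - ln 2\<close>, this point satisfies
    \<open>\<phi> y0 \<ge> |\<phi> 1| + 1\<close>: \<open>\<phi>\<close> is not constant beyond 1,
    as the strict inequality requires.\<close>
  define y0 where "y0 = max 2 ((\<bar>\<phi> 1\<bar> + 1 + ln 2) / r)"
  have y0: "1 < y0" "\<phi> y0 \<noteq> \<phi> 1"
  proof -
    show "1 < y0" by (simp add: y0_def)
    have "m * (r * y0) - m * ln 2 + (m * s)\<^sup>2 / 2 \<le> ln (lc_moment m s (r * y0))"
      using lc_moment_ge[of m "r * y0" s] m lc_moment_pos by (subst ln_ge_iff) auto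
    then have "m * (r * y0) - m * ln 2 \<le> ln (lc_moment m s (r * y0))"
      using zero_le_power2[of "m * s"] by linarith
    then have "r * y0 - ln 2 \<le> \<phi> y0" using m by (simp add: \<phi>_def lc_pot_def field_simps)
    moreover have "\<bar>\<phi> 1\<bar> + 1 + ln 2 \<le> r * y0"
    proof -
      have "(\<bar>\<phi> 1\<bar> + 1 + ln 2) / r \<le> y0" by (simp add: y0_def)
      then show ?thesis using r by (simp add: field_simps)
    qed
    ultimately show "\<phi> y0 \<noteq> \<phi> 1" by linarith
  qed
  \<comment> \<open>Centring at \<open>\<phi> 1\<close> instead of the mean can only enlarge the
    second moment, and this is the moment that the Poincare inequality controls.\<close>
  define Y where "Y = (\<lambda>z. \<phi> z - \<phi> 1)"
  have strict: "gE (\<lambda>z. (Y z)\<^sup>2) < 1 / 2 * gE (\<lambda>z. (f z)\<^sup>2)"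
    unfolding Y_def by (rule even_poincare_strict[OF d cf even fb y0])
  \<comment> \<open>Stationarity gives \<open>E f\<^sup>2 \<le> a * \<xi>' a\<close>, so the
    Poincare constant 1/2 meets \<open>theta_ge\<close> with nothing to spare.\<close>
  have "gE (\<lambda>z. (f z)\<^sup>2) = \<xi>' a * gE (\<lambda>z. (tilt m s (r * z) tanh)\<^sup>2)"
    by (simp add: f_def power_mult_distrib r)
  also have "\<dots> \<le> \<xi>' a * a" using stat S by (intro mult_left_mono) (auto simp: r_def)
  finally have "1 / 2 * gE (\<lambda>z. (f z)\<^sup>2) \<le> \<theta> a" using theta_ge[of a] a by (simp add: mult.commute)
  with strict have lt: "gE (\<lambda>z. (Y z)\<^sup>2) < \<theta> a" by simp
  have "continuous_on UNIV \<phi>" by (meson d DERIV_isCont continuous_at_imp_continuous_on)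
  then have Ymeas [measurable]: "Y \<in> borel_measurable borel"
    unfolding Y_def by (intro borel_measurable_continuous_onI continuous_intros)
  have Yb: "\<bar>Y z\<bar> \<le> r + r * \<bar>z\<bar>" for z
  proof -
    have "\<bar>Y z\<bar> \<le> \<bar>r * z - r * 1\<bar>" unfolding Y_def \<phi>_def using m by (intro lc_pot_lipschitz) auto
    also have "\<dots> \<le> r + r * \<bar>z\<bar>" using r by (simp add: abs_mult order_trans[OF abs_triangle_ineq4])
    finally show ?thesis .
  qed
  note eY = exp_growth_exp_abs_lipschitz[OF Ymeas Yb]
  \<comment> \<open>Third-order remainder, uniform in \<open>e\<close> below 1; relative to the
    leading \<open>e / 2\<close> it becomes the error \<open>2 * C * e\<close>.\<close>
  define C where "C = gE (\<lambda>z. \<bar>Y z\<bar> ^ 3 * exp \<bar>Y z\<bar>)"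
  have bound: "\<theta> a \<le> gE (\<lambda>z. (Y z)\<^sup>2) + 2 * C * e" if e: "0 < e" "e < min e0 1" for e
  proof -
    have eE: "exp_growth (\<lambda>z. exp (e * Y z))"
    proof (rule exp_growth_mono[OF eY(1)])
      show "\<bar>exp (e * Y z)\<bar> \<le> exp \<bar>Y z\<bar>" for z
      proof -
        have "e * Y z \<le> e * \<bar>Y z\<bar>" using e by (intro mult_left_mono) auto
        also have "\<dots> \<le> 1 * \<bar>Y z\<bar>" using e by (intro mult_right_mono) auto
        finally show ?thesis by simp
      qed
    qed measurable
    have "gE (\<lambda>z. exp (e * Y z)) \<le> gE (\<lambda>z. 1 + e * Y z + e\<^sup>2 / 2 * (Y z)\<^sup>2 + e ^ 3 * (\<bar>Y z\<bar> ^ 3 * exp \<bar>Y z\<bar>))"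
    proof (rule gE_mono[OF eE])
      fix z
      have ae: "\<bar>e * Y z\<bar> = e * \<bar>Y z\<bar>" using e by (simp add: abs_mult)
      have "exp (e * \<bar>Y z\<bar>) \<le> exp \<bar>Y z\<bar>" using e by (simp add: mult_left_le_one_le)
      then have "e ^ 3 * (\<bar>Y z\<bar> ^ 3 * exp (e * \<bar>Y z\<bar>)) \<le> e ^ 3 * (\<bar>Y z\<bar> ^ 3 * exp \<bar>Y z\<bar>)"
        using e by (intro mult_left_mono zero_le_power) auto
      then have "\<bar>e * Y z\<bar> ^ 3 * exp \<bar>e * Y z\<bar> \<le> e ^ 3 * (\<bar>Y z\<bar> ^ 3 * exp \<bar>Y z\<bar>)"
        by (simp only: ae power_mult_distrib mult.assoc)
      moreover have "(e * Y z)\<^sup>2 / 2 = e\<^sup>2 / 2 * (Y z)\<^sup>2" by (simp add: power_mult_distrib)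
      ultimately show "exp (e * Y z) \<le> 1 + e * Y z + e\<^sup>2 / 2 * (Y z)\<^sup>2 + e ^ 3 * (\<bar>Y z\<bar> ^ 3 * exp \<bar>Y z\<bar>)"
        using exp_le_taylor3[of "e * Y z"] by linarith
    qed (intro exp_growth_intros eY)
    also have "\<dots> = 1 + e * gE Y + e\<^sup>2 / 2 * gE (\<lambda>z. (Y z)\<^sup>2) + e ^ 3 * C"
      by (simp add: gE_add exp_growth_intros eY C_def del: times_divide_eq_left)
    finally have le: "gE (\<lambda>z. exp (e * Y z)) \<le> 1 + (e * gE Y + e\<^sup>2 / 2 * gE (\<lambda>z. (Y z)\<^sup>2) + e ^ 3 * C)" by simp
    have p: "0 < gE (\<lambda>z. exp (e * Y z))" by (rule gE_pos[OF eE]) simp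
    have "ln (gE (\<lambda>z. exp (e * Y z))) \<le> gE (\<lambda>z. exp (e * Y z)) - 1" by (rule ln_le_minus_one[OF p])
    with le have ln_le: "ln (gE (\<lambda>z. exp (e * Y z))) \<le> e * gE Y + e\<^sup>2 / 2 * gE (\<lambda>z. (Y z)\<^sup>2) + e ^ 3 * C"
      by linarith
    have "gauss_step e (\<xi>' a) (lc_pot m s) 0 = 1 / e * ln (gE (\<lambda>z. exp (e * \<phi> z)))"
      using e by (simp add: gauss_step_def \<phi>_def r_def mult.commute)
    also have "(\<lambda>z. exp (e * \<phi> z)) = (\<lambda>z. exp (e * \<phi> 1) * exp (e * Y z))"
      by (simp add: Y_def exp_add[symmetric] algebra_simps)
    also have "1 / e * ln (gE (\<lambda>z. exp (e * \<phi> 1) * exp (e * Y z))) = \<phi> 1 + 1 / e * ln (gE (\<lambda>z. exp (e * Y z)))"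
      using p e by (simp add: ln_mult field_simps)
    also have "\<dots> \<le> \<phi> 1 + 1 / e * (e * gE Y + e\<^sup>2 / 2 * gE (\<lambda>z. (Y z)\<^sup>2) + e ^ 3 * C)"
      using ln_le e by (intro add_left_mono mult_left_mono) auto
    also have "\<dots> = \<phi> 1 + gE Y + e / 2 * gE (\<lambda>z. (Y z)\<^sup>2) + e\<^sup>2 * C"
      using e by (simp add: field_simps power2_eq_square power3_eq_cube)
    finally have 1: "gauss_step e (\<xi>' a) (lc_pot m s) 0 \<le> \<phi> 1 + gE Y + e / 2 * gE (\<lambda>z. (Y z)\<^sup>2) + e\<^sup>2 * C" .
    have "gE \<phi> = gE (\<lambda>z. \<phi> 1 + Y z)" by (simp add: Y_def)
    also have "\<dots> = \<phi> 1 + gE Y"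
      using gE_add[OF exp_growth_const[of "\<phi> 1"] eY(2)] by (simp only: gE_const)
    finally have "gE \<phi> = \<phi> 1 + gE Y" .
    moreover have "gE \<phi> \<le> gauss_step e (\<xi>' a) (lc_pot m s) 0 - 1 / 2 * e * \<theta> a"
      using opt[of e] e by (simp add: \<phi>_def r_def)
    ultimately have "1 / 2 * e * \<theta> a \<le> e / 2 * gE (\<lambda>z. (Y z)\<^sup>2) + e\<^sup>2 * C"
      using 1 by linarith
    then have "e * \<theta> a \<le> e * (gE (\<lambda>z. (Y z)\<^sup>2) + 2 * C * e)"
      by (simp add: algebra_simps power2_eq_square)
    then show ?thesis using e by (simp only: mult_le_cancel_left_pos)
  qed
  have "\<theta> a \<le> gE (\<lambda>z. (Y z)\<^sup>2)"
    by (rule le_of_linear_error[of "min e0 1", OF _ bound]) (use e0 in auto)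
  with lt show False by simp
qed

end

section \<open>The mass and position of the upper atom\<close>

lemma tilt_square_le:
  assumes "exp_growth f" shows "(tilt m s x f)\<^sup>2 \<le> tilt m s x (\<lambda>y. (f y)\<^sup>2)"
proof -
  define c where "c = tilt m s x f"
  have "0 \<le> tilt m s x (\<lambda>y. (f y - c)\<^sup>2)"
    using tilt_mono[OF exp_growth_const[of 0], of "\<lambda>y. (f y - c)\<^sup>2" m s x]
    by (simp add: tilt_const exp_growth_intros assms)
  also have "(\<lambda>y. (f y - c)\<^sup>2) = (\<lambda>y. (f y)\<^sup>2 - 2 * c * f y + c\<^sup>2)"
    by (auto simp: power2_eq_square algebra_simps)
  also have "tilt m s x \<dots> = tilt m s x (\<lambda>y. (f y)\<^sup>2) - 2 * c * c + c\<^sup>2"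
    by (simp add: tilt_add tilt_diff tilt_mult tilt_const exp_growth_intros assms c_def[symmetric])
  finally show ?thesis by (simp add: c_def power2_eq_square)
qed

lemma tilt_lc_curv: "tilt m s x (lc_curv m) = 1 - (1 - m) * tilt m s x (\<lambda>y. (tanh y)\<^sup>2)"
proof -
  have "lc_curv m = (\<lambda>y. 1 - (1 - m) * (tanh y)\<^sup>2)"
    by (auto simp: lc_curv_def algebra_simps)
  then show ?thesis
    by (simp add: tilt_diff tilt_mult tilt_const exp_growth_intros exp_growth_tanh)
qed

text \<open>The derivative of \<open>ln (lc_moment m s 0)\<close> in \<open>m\<close>: \<open>lc y\<close> is at least \<open>y tanh y - ln 2\<close>,
  whose mean is computed by Gaussian integration by parts.\<close>

lemma tilt_lc_ge:
  assumes "0 \<le> m" "m \<le> 1" shows "m * s\<^sup>2 - ln 2 \<le> tilt m s 0 lc"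
proof -
  have p: "0 < lc_moment m s 0" by (rule lc_moment_pos)
  have "gE (\<lambda>z. exp (m * lc (0 + s * z)) * ((0 + s * z) * tanh (0 + s * z)))
      = s * gE (\<lambda>z. z * (exp (m * lc (0 + s * z)) * tanh (0 + s * z)))"
    by (subst integral_mult_right_zero[symmetric]) (simp add: mult_ac)
  also have "gE (\<lambda>z. z * (exp (m * lc (0 + s * z)) * tanh (0 + s * z)))
      = s * (lc_moment m s 0 * tilt m s 0 (lc_curv m))"
    by (subst weighted_ibp[OF tanh_derivative exp_growth_tanh])
       (use p in \<open>auto simp: tilt_def lc_curv_def power2_eq_square mult.assoc intro!: exp_growth_intros exp_growth_tanh\<close>)
  finally have "tilt m s 0 (\<lambda>y. y * tanh y) = s\<^sup>2 * tilt m s 0 (lc_curv m)"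
    using p by (simp add: tilt_def power2_eq_square)
  moreover have "m \<le> tilt m s 0 (lc_curv m)"
    by (rule tilt_bounds(1)[OF _ lc_curv_bounds(1,2)]) (use assms in auto)
  then have "s\<^sup>2 * m \<le> s\<^sup>2 * tilt m s 0 (lc_curv m)" by (intro mult_left_mono) auto
  moreover have "tilt m s 0 (\<lambda>y. y * tanh y - ln 2) = tilt m s 0 (\<lambda>y. y * tanh y) - ln 2"
    by (simp add: tilt_diff tilt_const exp_growth_intros exp_growth_tanh)
  moreover have "tilt m s 0 (\<lambda>y. y * tanh y - ln 2) \<le> tilt m s 0 lc"
    by (intro tilt_mono exp_growth_intros exp_growth_tanh exp_growth_lc lc_ge_tanh)
  ultimately show ?thesis by (simp add: mult.commute)
qed

text \<open>Convexity of the log-moment in the exponent, as the tangent at \<open>m'\<close>: Jensen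
  for the law tilted with exponent \<open>m'\<close>.\<close>

lemma ln_lc_moment_convex:
  "ln (lc_moment m' s x) + (m - m') * tilt m' s x lc \<le> ln (lc_moment m s x)"
proof -
  define w where "w = (\<lambda>z. exp (m' * lc (x + s * z)))"
  define Y where "Y = (\<lambda>z. (m - m') * lc (x + s * z))"
  have w: "exp_growth w" "\<And>z. 0 < w z" unfolding w_def by (auto intro: exp_growth_weight)
  have Y: "exp_growth Y" unfolding Y_def
    by (intro exp_growth_mult exp_growth_const exp_growth_affine[OF exp_growth_lc])
  have eq: "w z * exp (Y z) = exp (m * lc (x + s * z))" for z
    by (simp add: w_def Y_def exp_add[symmetric] algebra_simps)
  have "gE w * exp (gE (\<lambda>z. w z * Y z) / gE w) \<le> gE (\<lambda>z. w z * exp (Y z))"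
    by (rule gE_jensen_weighted[OF w Y]) (simp add: eq exp_growth_weight)
  moreover have "gE w = lc_moment m' s x" by (simp add: w_def lc_moment_def)
  moreover have "gE (\<lambda>z. w z * exp (Y z)) = lc_moment m s x" by (simp add: eq lc_moment_def)
  moreover have "gE (\<lambda>z. w z * Y z) / lc_moment m' s x = (m - m') * tilt m' s x lc"
    by (simp add: w_def Y_def tilt_def mult.left_commute[of _ "m - m'"])
  ultimately have "lc_moment m' s x * exp ((m - m') * tilt m' s x lc) \<le> lc_moment m s x" by simp
  then have "ln (lc_moment m' s x * exp ((m - m') * tilt m' s x lc)) \<le> ln (lc_moment m s x)"
    using lc_moment_pos by (subst ln_le_cancel_iff) auto
  then show ?thesis using lc_moment_pos[of m' s x] by (simp add: ln_mult)
qed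

context mixture_model
begin

lemma P2_zero: "P2 0 q m = lc_pot m (sqrt (\<xi>' q)) 0 + (\<xi>' 1 - \<xi>' q) / 2 - 1 / 2 * (\<theta> 1 - (1 - m) * \<theta> q)"
  by (simp add: P2_def xi'_0 theta_0 algebra_simps)

text \<open>Only smaller masses are compared. Convexity bounds the change of the log-moment by its
  slope at \<open>m'\<close>, \<open>tilt_lc_ge\<close> bounds this slope below and
  \<open>lc_moment_le\<close> the value above. Letting \<open>m'\<close> tend to \<open>m\<close>
  gives \<open>m\<^sup>2 * (\<xi>' q - \<theta> q) \<le> 2 * ln 2\<close>, the freezing condition of
  a random energy model.\<close>

lemma weight_bound:
  assumes q: "0 < q" "q \<le> 1" and m: "0 < m" "m < 1"
    and opt: "\<And>m'. 0 < m' \<Longrightarrow> m' < m \<Longrightarrow> P2 0 q m \<le> P2 0 q m'"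
  shows "m\<^sup>2 * \<xi> q \<le> 2 * ln 2"
proof -
  define A where "A = \<xi>' q"
  define s where "s = sqrt A"
  define t where "t = \<theta> q"
  have A: "0 < A" unfolding A_def using q by (rule xi'_pos)
  have s2: "s\<^sup>2 = A" using A by (simp add: s_def)
  have t0: "0 \<le> t" unfolding t_def using q by (intro theta_nonneg) auto
  have bound: "m\<^sup>2 * A \<le> (2 * ln 2 + m\<^sup>2 * t) + 2 * m * A * e" if e: "0 < e" "e < m" for e
  proof -
    define m' where "m' = m - e"
    define l l' L where "l = ln (lc_moment m s 0)" and "l' = ln (lc_moment m' s 0)" and "L = tilt m' s 0 lc"
    have m': "0 < m'" "m' < m" using e by (auto simp: m'_def)
    have "P2 0 q m \<le> P2 0 q m'" using m' by (rule opt)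
    then have 1: "l / m - l' / m' \<le> 1 / 2 * (e * t)"
      unfolding P2_zero lc_pot_def l_def l'_def s_def A_def t_def by (simp add: m'_def algebra_simps)
    have "l' + e * L \<le> l"
      using ln_lc_moment_convex[of m' s 0 m] by (simp add: l_def l'_def L_def m'_def)
    then have "(l' + e * L) / m - l' / m' \<le> 1 / 2 * (e * t)"
      using 1 divide_right_mono[of "l' + e * L" l m] m by linarith
    then have "e * (L - l' / m') \<le> e * (1 / 2 * (m * t))"
      using m m' by (simp add: m'_def field_simps)
    then have 2: "L - l' / m' \<le> 1 / 2 * (m * t)" using e by (simp only: mult_le_cancel_left_pos)
    have 3: "m' * A - ln 2 \<le> L"
      using tilt_lc_ge[of m' s] m m' by (simp add: L_def s2)
    have "lc_moment m' s 0 \<le> exp ((1 - m') * ln 2 + (m' * s)\<^sup>2 / 2)"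
      using m m' by (intro lc_moment_le) auto
    then have "l' \<le> (1 - m') * ln 2 + (m' * s)\<^sup>2 / 2"
      unfolding l'_def using lc_moment_pos[of m' s 0] by (metis ln_exp ln_le_cancel_iff exp_gt_zero)
    moreover have "(m' * s)\<^sup>2 = m'\<^sup>2 * A" by (simp add: power_mult_distrib s2)
    moreover have "(1 - m') * ln 2 + m'\<^sup>2 * A / 2 = m' * (((1 - m') * ln 2) / m' + m' * A / 2)"
      using m' by (simp add: field_simps power2_eq_square)
    ultimately have "l' \<le> m' * (((1 - m') * ln 2) / m' + m' * A / 2)" by simp
    then have "l' / m' \<le> ((1 - m') * ln 2) / m' + m' * A / 2"
      using m' by (simp add: divide_le_eq mult.commute)
    then have "m' * A - ln 2 - ((1 - m') * ln 2) / m' - m' * A / 2 \<le> 1 / 2 * (m * t)"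
      using 2 3 by linarith
    then have 4: "m' * (m' * A - ln 2 - ((1 - m') * ln 2) / m' - m' * A / 2) \<le> m' * (1 / 2 * (m * t))"
      using m' by (intro mult_left_mono) auto
    have 5: "m' * (m' * A - ln 2 - ((1 - m') * ln 2) / m' - m' * A / 2) = m'\<^sup>2 * A / 2 - ln 2"
      using m' by (simp add: field_simps power2_eq_square)
    have "m'\<^sup>2 * A \<le> 2 * ln 2 + m * m' * t" using 4 unfolding 5 by (simp add: field_simps)
    moreover have "m'\<^sup>2 * A = m\<^sup>2 * A - 2 * m * A * e + e\<^sup>2 * A"
      by (simp add: m'_def power2_eq_square algebra_simps)
    moreover have "0 \<le> e\<^sup>2 * A" using A by simp
    moreover have "m * m' * t \<le> m\<^sup>2 * t"
      using m m' t0 by (intro mult_right_mono) (auto simp: power2_eq_square)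
    ultimately show ?thesis by linarith
  qed
  have "m\<^sup>2 * A \<le> 2 * ln 2 + m\<^sup>2 * t"
    by (rule le_of_linear_error[OF m(1) bound])
  then have "m\<^sup>2 * (A - t) \<le> 2 * ln 2" by (simp add: algebra_simps)
  \<comment> \<open>By definition \<open>\<xi> q = q * A - t\<close>, and
    \<open>q \<le> 1\<close>.\<close>
  moreover have "\<xi> q \<le> A - t"
    using mult_left_le_one_le[of A q] A q by (simp add: t_def \<theta>_def A_def)
  then have "m\<^sup>2 * \<xi> q \<le> m\<^sup>2 * (A - t)" by (intro mult_left_mono) auto
  ultimately show ?thesis by linarith
qed

text \<open>Moves to the left are possible even for \<open>q = 1\<close> and give this direction of
  stationarity; the reverse one comes from splitting. The slope of \<open>lc_pot\<close> in
  \<open>s\<close> is \<open>s\<close> times the tilted \<open>lc_curv\<close>, which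
  \<open>tilt_lc_curv\<close> expresses through the tilted \<open>tanh\<^sup>2\<close>.\<close>

lemma upper_atom_stationary:
  assumes q: "0 < q" "q \<le> 1" and m: "0 < m" "m < 1"
    and opt: "\<And>q'. 0 < q' \<Longrightarrow> q' < q \<Longrightarrow> P2 0 q m \<le> P2 0 q' m"
  shows "q \<le> tilt m (sqrt (\<xi>' q)) 0 (\<lambda>y. (tanh y)\<^sup>2)"
proof -
  define s where "s = sqrt (\<xi>' q)"
  define Q where "Q = (\<lambda>n. q - q / (real n + 2))"
  define s' where "s' = (\<lambda>n. sqrt (\<xi>' (Q n)))"
  define V where "V = (\<lambda>n. tilt m (s' n) 0 (lc_curv m))"
  have Qn: "0 < Q n" "Q n < q" for n
  proof -
    have "q / (real n + 2) < q / 1" using q by (intro divide_strict_left_mono) auto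
    then show "0 < Q n" by (simp add: Q_def)
    show "Q n < q" using q by (simp add: Q_def)
  qed
  have Qlim: "Q \<longlonglongrightarrow> q" unfolding Q_def by real_asymp
  have s'lim: "s' \<longlonglongrightarrow> s" unfolding s'_def s_def
    by (intro tendsto_real_sqrt isCont_tendsto_compose[OF DERIV_isCont[OF xi'_derivative] Qlim]) (use q in auto)
  have spos: "0 < s" "s\<^sup>2 = \<xi>' q" using xi'_pos[of q] q by (auto simp: s_def)
  have s'pos: "0 < s' n" "(s' n)\<^sup>2 = \<xi>' (Q n)" for n
    using xi'_pos[of "Q n"] Qn[of n] q by (auto simp: s'_def)
  have Vlim: "V \<longlonglongrightarrow> tilt m s 0 (lc_curv m)" unfolding V_def
    by (rule tilt_tendsto[OF tendsto_const s'lim lc_curv_continuous lc_curv_bounds(3)]) (use m in auto)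
  have key: "s' n / (s + s' n) * V n \<le> 1 / 2 * (1 - (1 - m) * Q n)" for n
  proof -
    define \<delta> where "\<delta> = \<xi>' q - \<xi>' (Q n)"
    have \<delta>: "0 < \<delta>" unfolding \<delta>_def using xi'_less[of "Q n" q] Qn[of n] q by simp
    have p1: "P2 0 q m = lc_pot m s 0 + (\<xi>' 1 - \<xi>' q) / 2 - 1 / 2 * (\<theta> 1 - (1 - m) * \<theta> q)"
      unfolding P2_zero s_def ..
    have p2: "P2 0 (Q n) m = lc_pot m (s' n) 0 + (\<xi>' 1 - \<xi>' (Q n)) / 2 - 1 / 2 * (\<theta> 1 - (1 - m) * \<theta> (Q n))"
      unfolding P2_zero s'_def ..
    \<comment> \<open>Linear bookkeeping over plain variables, to be applied to the two values
      \<open>p1\<close> and \<open>p2\<close>.\<close>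
    have gen: "T \<le> 1 / 2 * (y - w - (u - v))"
      if "a + (x - y) / 2 - 1 / 2 * (z - u) \<le> b + (x - w) / 2 - 1 / 2 * (z - v)" "b + T \<le> a"
      for a b u v w x y z T :: real
      using that by argo
    have "P2 0 q m \<le> P2 0 (Q n) m" using Qn[of n] by (intro opt) auto
    moreover have "lc_pot m (s' n) 0 + (s - s' n) * s' n * V n \<le> lc_pot m s 0"
      using lc_pot_tangent[OF m(1), of "s' n" 0 0 s] by (simp add: V_def)
    ultimately have 1: "(s - s' n) * s' n * V n \<le> 1 / 2 * (\<delta> - (1 - m) * (\<theta> q - \<theta> (Q n)))"
      unfolding p1 p2 \<delta>_def right_diff_distrib[of "1 - m"] by (rule gen)
    have "(1 - m) * (Q n * \<delta>) \<le> (1 - m) * (\<theta> q - \<theta> (Q n))"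
      using theta_diff_ge[of "Q n" q] Qn[of n] q m by (intro mult_left_mono) (auto simp: \<delta>_def)
    with 1 have 2: "(s - s' n) * s' n * V n \<le> 1 / 2 * (\<delta> - (1 - m) * (Q n * \<delta>))" by argo
    have "s - s' n = \<delta> / (s + s' n)"
      using sqrt_diff_eq[of "\<xi>' q" "\<xi>' (Q n)"] spos s'pos[of n] by (simp add: s_def s'_def \<delta>_def)
    with 2 have "\<delta> * (s' n / (s + s' n) * V n) \<le> \<delta> * (1 / 2 * (1 - (1 - m) * Q n))"
      by (simp add: algebra_simps)
    then show ?thesis using \<delta> by (simp only: mult_le_cancel_left_pos)
  qed
  have "s / (s + s) * tilt m s 0 (lc_curv m) \<le> 1 / 2 * (1 - (1 - m) * q)"
  proof (rule LIMSEQ_le)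
    show "(\<lambda>n. s' n / (s + s' n) * V n) \<longlonglongrightarrow> s / (s + s) * tilt m s 0 (lc_curv m)"
      by (intro tendsto_intros s'lim Vlim) (use spos in auto)
    show "(\<lambda>n. 1 / 2 * (1 - (1 - m) * Q n)) \<longlonglongrightarrow> 1 / 2 * (1 - (1 - m) * q)"
      by (intro tendsto_intros Qlim)
  qed (use key in auto)
  then have "tilt m s 0 (lc_curv m) \<le> 1 - (1 - m) * q" using spos by simp
  then have "(1 - m) * q \<le> (1 - m) * tilt m s 0 (\<lambda>y. (tanh y)\<^sup>2)" by (simp add: tilt_lc_curv)
  then show ?thesis using m by (simp add: s_def)
qed

end

section \<open>Splitting the upper atom\<close>

text \<open>The derivatives of \<open>ln cosh\<close> are polynomials in \<open>tanh\<close>, hence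
  the fifth-order remainder is uniform in \<open>y\<close>. The terms up to order 4 all contribute
  to the deciding order \<open>r ^ 4\<close>.\<close>

lemma lc_taylor:
  fixes y h :: real
  defines "t \<equiv> tanh y"
  defines "c \<equiv> 1 - t\<^sup>2"
  shows "t * h + c / 2 * h\<^sup>2 - t * c / 3 * h ^ 3 + (6 * t\<^sup>2 - 2) * c / 24 * h ^ 4 - \<bar>h\<bar> ^ 5 \<le> lc (y + h) - lc y"
proof -
  define D where "D = (\<lambda>k::nat. \<lambda>x.
    if k = 0 then lc (y + x) else if k = 1 then tanh (y + x)
    else if k = 2 then 1 - tanh (y + x) ^ 2
    else if k = 3 then 2 * tanh (y + x) ^ 3 - 2 * tanh (y + x)
    else if k = 4 then 8 * tanh (y + x) ^ 2 - 2 - 6 * tanh (y + x) ^ 4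
    else (16 * tanh (y + x) - 24 * tanh (y + x) ^ 3) * (1 - tanh (y + x) ^ 2))"
  have shift: "((\<lambda>x. y + x) has_real_derivative 1) (at x)" for x
    by (auto intro!: derivative_eq_intros)
  have dt: "((\<lambda>x. tanh (y + x)) has_real_derivative 1 - (tanh (y + x))\<^sup>2) (at x)" for x
    using DERIV_chain2[OF tanh_derivative shift] by simp
  have dl: "((\<lambda>x. lc (y + x)) has_real_derivative tanh (y + x)) (at x)" for x
    using DERIV_chain2[OF lc_derivative shift] by simp
  have der: "(D k has_real_derivative D (Suc k) x) (at x)" if "k < 5" for k x
  proof -
    consider "k = 0" | "k = 1" | "k = 2" | "k = 3" | "k = 4" using \<open>k < 5\<close> by linarith
    then show ?thesis
    proof cases
      case 1 then show ?thesis using dl by (simp add: D_def)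
    next
      case 2 then show ?thesis using dt by (simp add: D_def)
    next
      case 3 then show ?thesis unfolding D_def
        by (auto intro!: derivative_eq_intros dt simp: algebra_simps power2_eq_square power3_eq_cube)
    next
      case 4 then show ?thesis unfolding D_def
        by (auto intro!: derivative_eq_intros dt simp: algebra_simps power2_eq_square power3_eq_cube power4_eq_xxxx)
    next
      case 5 then show ?thesis unfolding D_def
        by (auto intro!: derivative_eq_intros dt simp: algebra_simps power2_eq_square power3_eq_cube power4_eq_xxxx)
    qed
  qed
  have "\<exists>u. \<bar>u\<bar> \<le> \<bar>h\<bar> \<and> D 0 h = (\<Sum>k<5. D k 0 / fact k * h ^ k) + D 5 u / fact 5 * h ^ 5"
    by (rule Maclaurin_bi_le) (use der in auto)
  then obtain u where u: "D 0 h = (\<Sum>k<5. D k 0 / fact k * h ^ k) + D 5 u / fact 5 * h ^ 5" by blast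
  have e: "(\<Sum>k<5. D k 0 / fact k * h ^ k)
      = lc y + (t * h + c / 2 * h\<^sup>2 - t * c / 3 * h ^ 3 + (6 * t\<^sup>2 - 2) * c / 24 * h ^ 4)"
    by (simp add: D_def t_def c_def eval_nat_numeral field_simps)
  have "\<bar>D 5 u / fact 5 * h ^ 5\<bar> \<le> 1 * \<bar>h\<bar> ^ 5"
    unfolding abs_mult power_abs
  proof (rule mult_right_mono)
    define T where "T = tanh (y + u)"
    have T: "\<bar>T\<bar> \<le> 1" "0 \<le> 1 - T\<^sup>2" "1 - T\<^sup>2 \<le> 1"
      using abs_tanh_le_1[of "y + u"] tanh_sq_bounds[of "y + u"] by (auto simp: T_def)
    have "\<bar>T ^ 3\<bar> \<le> 1" using T by (simp add: power_abs power_le_one)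
    \<comment> \<open>16 + 24 = 40, and 40 / 5! is below the coefficient 1 of the error
      term.\<close>
    then have "\<bar>16 * T - 24 * T ^ 3\<bar> \<le> 40" using T by linarith
    then have "\<bar>16 * T - 24 * T ^ 3\<bar> * \<bar>1 - T\<^sup>2\<bar> \<le> 40 * 1" using T by (intro mult_mono) auto
    then have "\<bar>D 5 u\<bar> \<le> 40" by (simp add: D_def T_def abs_mult)
    then show "\<bar>D 5 u / fact 5\<bar> \<le> 1" by (simp add: fact_numeral)
  qed simp
  then have "- (\<bar>h\<bar> ^ 5) \<le> D 5 u / fact 5 * h ^ 5" by linarith
  moreover have "lc (y + h) = D 0 h" by (simp add: D_def)
  ultimately show ?thesis using u e by linarith
qed

lemma gE_shifted_moments:
  "gE (\<lambda>z. a + r * z) = a"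
  "gE (\<lambda>z. (a + r * z) ^ 2) = a ^ 2 + r ^ 2"
  "gE (\<lambda>z. (a + r * z) ^ 3) = a ^ 3 + 3 * a * r ^ 2"
  "gE (\<lambda>z. (a + r * z) ^ 4) = a ^ 4 + 6 * a ^ 2 * r ^ 2 + 3 * r ^ 4"
proof -
  show "gE (\<lambda>z. a + r * z) = a"
    by (simp add: gE_add exp_growth_intros gE_moments)
  have "(\<lambda>z. (a + r * z) ^ 2) = (\<lambda>z. a ^ 2 + (2 * a * r) * z + r ^ 2 * z ^ 2)"
    by (auto simp: power2_eq_square algebra_simps)
  then show "gE (\<lambda>z. (a + r * z) ^ 2) = a ^ 2 + r ^ 2"
    by (simp add: gE_add exp_growth_intros gE_moments)
  have "(\<lambda>z. (a + r * z) ^ 3) = (\<lambda>z. a ^ 3 + (3 * a ^ 2 * r) * z + (3 * a * r ^ 2) * z ^ 2 + r ^ 3 * z ^ 3)"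
    by (auto simp: power2_eq_square power3_eq_cube algebra_simps)
  then show "gE (\<lambda>z. (a + r * z) ^ 3) = a ^ 3 + 3 * a * r ^ 2"
    by (simp add: gE_add exp_growth_intros gE_moments)
  have "(\<lambda>z. (a + r * z) ^ 4) = (\<lambda>z. a ^ 4 + (4 * a ^ 3 * r) * z + (6 * a ^ 2 * r ^ 2) * z ^ 2 + (4 * a * r ^ 3) * z ^ 3 + r ^ 4 * z ^ 4)"
    by (auto simp: power2_eq_square power3_eq_cube power4_eq_xxxx algebra_simps)
  then show "gE (\<lambda>z. (a + r * z) ^ 4) = a ^ 4 + 6 * a ^ 2 * r ^ 2 + 3 * r ^ 4"
    by (simp add: gE_add exp_growth_intros gE_moments)
qed

definition lc_err :: real where "lc_err = gE (\<lambda>z. (1 + \<bar>z\<bar>) ^ 5)"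

text \<open>The increment \<open>a + r * z\<close> has explicit moments, and
  \<open>|a| \<le> r\<close> bounds it by \<open>r * (1 + |z|)\<close>. Applied with
  \<open>a\<close> equal to plus and minus \<open>r\<^sup>2\<close>, the shifts of
  \<open>tilt_1\<close>.\<close>

lemma gE_lc_expansion:
  fixes y r a :: real
  defines "t \<equiv> tanh y"
  defines "c \<equiv> 1 - t\<^sup>2"
  assumes r: "0 < r" "r \<le> 1" and a: "\<bar>a\<bar> \<le> r"
  shows "t * a + c / 2 * (a ^ 2 + r ^ 2) - t * c / 3 * (a ^ 3 + 3 * a * r ^ 2)
      + (6 * t\<^sup>2 - 2) * c / 24 * (a ^ 4 + 6 * a ^ 2 * r ^ 2 + 3 * r ^ 4) - r ^ 5 * lc_err
    \<le> gE (\<lambda>z. lc (y + a + r * z)) - lc y"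
proof -
  let ?h = "\<lambda>z. a + r * z"
  have eh: "exp_growth ?h" by (intro exp_growth_intros)
  have ec: "exp_growth (\<lambda>z. lc (y + a + r * z))" by (rule exp_growth_affine[OF exp_growth_lc])
  have "gE (\<lambda>z. t * ?h z + c / 2 * ?h z ^ 2 - t * c / 3 * ?h z ^ 3
      + (6 * t\<^sup>2 - 2) * c / 24 * ?h z ^ 4 - r ^ 5 * (1 + \<bar>z\<bar>) ^ 5) \<le> gE (\<lambda>z. lc (y + a + r * z) - lc y)"
  proof (rule gE_mono)
    fix z
    have "\<bar>a + r * z\<bar> \<le> r * (1 + \<bar>z\<bar>)"
      using a r abs_triangle_ineq[of a "r * z"] by (simp add: abs_mult distrib_left)
    then have "\<bar>a + r * z\<bar> ^ 5 \<le> (r * (1 + \<bar>z\<bar>)) ^ 5" by (intro power_mono) auto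
    then have "\<bar>a + r * z\<bar> ^ 5 \<le> r ^ 5 * (1 + \<bar>z\<bar>) ^ 5" by (simp only: power_mult_distrib)
    then show "t * ?h z + c / 2 * ?h z ^ 2 - t * c / 3 * ?h z ^ 3
      + (6 * t\<^sup>2 - 2) * c / 24 * ?h z ^ 4 - r ^ 5 * (1 + \<bar>z\<bar>) ^ 5 \<le> lc (y + a + r * z) - lc y"
      using lc_taylor[of y "a + r * z"] unfolding t_def c_def add.assoc[of y a] by linarith
  qed (intro exp_growth_intros eh ec)+
  also have "gE (\<lambda>z. t * ?h z + c / 2 * ?h z ^ 2 - t * c / 3 * ?h z ^ 3
      + (6 * t\<^sup>2 - 2) * c / 24 * ?h z ^ 4 - r ^ 5 * (1 + \<bar>z\<bar>) ^ 5)
    = gE (\<lambda>z. t * ?h z) + gE (\<lambda>z. c / 2 * ?h z ^ 2) - gE (\<lambda>z. t * c / 3 * ?h z ^ 3)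
      + gE (\<lambda>z. (6 * t\<^sup>2 - 2) * c / 24 * ?h z ^ 4) - gE (\<lambda>z. r ^ 5 * (1 + \<bar>z\<bar>) ^ 5)"
    by (subst gE_diff gE_add, (intro exp_growth_intros eh)+)+ (rule refl)
  also have "\<dots> = t * a + c / 2 * (a ^ 2 + r ^ 2) - t * c / 3 * (a ^ 3 + 3 * a * r ^ 2)
      + (6 * t\<^sup>2 - 2) * c / 24 * (a ^ 4 + 6 * a ^ 2 * r ^ 2 + 3 * r ^ 4) - r ^ 5 * lc_err"
    unfolding integral_mult_right_zero gE_shifted_moments lc_err_def ..
  also have "gE (\<lambda>z. lc (y + a + r * z) - lc y) = gE (\<lambda>z. lc (y + a + r * z)) - lc y"
    by (simp add: gE_diff ec exp_growth_const)
  finally show ?thesis .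
qed

text \<open>For \<open>m = 1\<close> the tilted Gaussian is a mixture of two Gaussians shifted by \<open>r\<^sup>2\<close> and \<open>- r\<^sup>2\<close>.\<close>

lemma tilt_1:
  assumes h: "exp_growth h"
  shows "tilt 1 r y h = (1 + tanh y) / 2 * gE (\<lambda>z. h (y + r\<^sup>2 + r * z)) + (1 - tanh y) / 2 * gE (\<lambda>z. h (y + (- (r\<^sup>2)) + r * z))"
proof -
  have eh: "exp_growth (\<lambda>z. h (y + r * z))" by (rule exp_growth_affine[OF h])
  have "gE (\<lambda>z. exp (1 * lc (y + r * z)) * h (y + r * z))
    = gE (\<lambda>z. exp y / 2 * (h (y + r * z) * exp (r * z)) + exp (- y) / 2 * (h (y + r * z) * exp ((- r) * z)))"
  proof (rule Bochner_Integration.integral_cong[OF refl])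
    fix z
    have "exp (1 * lc (y + r * z)) = cosh (y + r * z)" by simp
    also have "\<dots> = exp y * exp (r * z) / 2 + exp (- y) * exp ((- r) * z) / 2"
      by (simp add: cosh_field_def add_divide_distrib exp_add[symmetric])
    finally have "exp (1 * lc (y + r * z)) = exp y * exp (r * z) / 2 + exp (- y) * exp ((- r) * z) / 2" .
    then show "exp (1 * lc (y + r * z)) * h (y + r * z)
      = exp y / 2 * (h (y + r * z) * exp (r * z)) + exp (- y) / 2 * (h (y + r * z) * exp ((- r) * z))"
      by (simp only:) (simp add: algebra_simps)
  qed
  also have "\<dots> = exp y / 2 * gE (\<lambda>z. h (y + r * z) * exp (r * z)) + exp (- y) / 2 * gE (\<lambda>z. h (y + r * z) * exp ((- r) * z))"
    by (subst gE_add, (intro exp_growth_intros eh)+) (simp only: integral_mult_right_zero)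
  also have "\<dots> = exp (r\<^sup>2 / 2) * (exp y / 2 * gE (\<lambda>z. h (y + r\<^sup>2 + r * z)) + exp (- y) / 2 * gE (\<lambda>z. h (y + (- (r\<^sup>2)) + r * z)))"
    unfolding gE_shift[OF eh] by (simp add: algebra_simps power2_eq_square)
  finally have n: "gE (\<lambda>z. exp (1 * lc (y + r * z)) * h (y + r * z))
    = exp (r\<^sup>2 / 2) * (exp y / 2 * gE (\<lambda>z. h (y + r\<^sup>2 + r * z)) + exp (- y) / 2 * gE (\<lambda>z. h (y + (- (r\<^sup>2)) + r * z)))" .
  have cp: "cosh y \<noteq> 0" by simp
  have p: "exp y / 2 = cosh y * ((1 + tanh y) / 2)" "exp (- y) / 2 = cosh y * ((1 - tanh y) / 2)"
    by (simp_all add: tanh_def distrib_left right_diff_distrib cosh_plus_sinh cosh_minus_sinh)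
  show ?thesis unfolding tilt_def lc_moment_1 n p
    using cp by (simp add: field_simps)
qed

text \<open>\<open>ent r y\<close> is the relative entropy of the tilted law with respect to the Gaussian; it is the
  derivative at \<open>m = 1\<close> of \<open>m \<mapsto> lc_pot m r y\<close>.\<close>

definition ent :: "real \<Rightarrow> real \<Rightarrow> real" where
  "ent r y = tilt 1 r y lc - lc y - r\<^sup>2 / 2"

text \<open>With \<open>t = tanh y\<close> and \<open>c = 1 - t\<^sup>2\<close>, the coefficient of
  \<open>r ^ 2\<close> is \<open>t\<^sup>2 + c / 2 - 1 / 2 = t\<^sup>2 / 2\<close>, and that of
  \<open>r ^ 4\<close> is \<open>c / 2 - t\<^sup>2 * c + (6 * t\<^sup>2 - 2) * c / 8 = c\<^sup>2 /
  4\<close>. The first is to be balanced by the position \<open>q\<close>, the second by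
  \<open>1 / \<xi>'' q\<close>.\<close>

lemma ent_expansion:
  assumes r: "0 < r" "r \<le> 1"
  shows "r\<^sup>2 / 2 * (tanh y)\<^sup>2 + r ^ 4 / 4 * (1 - (tanh y)\<^sup>2)\<^sup>2 - (2 + lc_err) * r ^ 5 \<le> ent r y"
proof -
  define t c where "t = tanh y" and "c = 1 - t\<^sup>2"
  define B where "B = (\<lambda>a. t * a + c / 2 * (a ^ 2 + r ^ 2) - t * c / 3 * (a ^ 3 + 3 * a * r ^ 2)
      + (6 * t\<^sup>2 - 2) * c / 24 * (a ^ 4 + 6 * a ^ 2 * r ^ 2 + 3 * r ^ 4) - r ^ 5 * lc_err)"
  have rr: "\<bar>r\<^sup>2\<bar> \<le> r" "\<bar>- (r\<^sup>2)\<bar> \<le> r" using r by (auto simp: power2_eq_square mult_left_le)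
  have t: "\<bar>t\<bar> \<le> 1" "t\<^sup>2 \<le> 1" "0 \<le> t\<^sup>2" using abs_tanh_le_1[of y] tanh_sq_bounds[of y] by (auto simp: t_def)
  have c: "0 \<le> c" "c \<le> 1" using t by (auto simp: c_def)
  have 1: "B (r\<^sup>2) \<le> gE (\<lambda>z. lc (y + r\<^sup>2 + r * z)) - lc y"
    using gE_lc_expansion[OF r rr(1), of y] unfolding B_def t_def c_def .
  have 2: "B (- (r\<^sup>2)) \<le> gE (\<lambda>z. lc (y + (- (r\<^sup>2)) + r * z)) - lc y"
    using gE_lc_expansion[OF r rr(2), of y] unfolding B_def t_def c_def .
  have "(1 + t) / 2 * B (r\<^sup>2) + (1 - t) / 2 * B (- (r\<^sup>2))
     \<le> (1 + t) / 2 * (gE (\<lambda>z. lc (y + r\<^sup>2 + r * z)) - lc y) + (1 - t) / 2 * (gE (\<lambda>z. lc (y + (- (r\<^sup>2)) + r * z)) - lc y)"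
    using 1 2 t by (intro add_mono mult_left_mono) auto
  also have "\<dots> = tilt 1 r y lc - lc y"
    unfolding tilt_1[OF exp_growth_lc] t_def[symmetric] by (simp add: field_simps)
  finally have 3: "(1 + t) / 2 * B (r\<^sup>2) + (1 - t) / 2 * B (- (r\<^sup>2)) - r\<^sup>2 / 2 \<le> ent r y"
    by (simp add: ent_def)
  \<comment> \<open>The weights \<open>(1 + t) / 2\<close> and \<open>(1 - t) / 2\<close> preserve
    even powers of the shift and multiply odd ones by \<open>t\<close>.\<close>
  have sym: "(1 + t) / 2 * B (r\<^sup>2) + (1 - t) / 2 * B (- (r\<^sup>2)) - r\<^sup>2 / 2
     = r\<^sup>2 / 2 * t\<^sup>2 + r ^ 4 / 4 * c\<^sup>2 - (t\<^sup>2 * c / 3 + (2 - 6 * t\<^sup>2) * c / 4) * r ^ 6 - (2 - 6 * t\<^sup>2) * c / 24 * r ^ 8 - r ^ 5 * lc_err"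
    unfolding B_def c_def by (simp add: field_simps power2_eq_square) algebra
  have tc: "t\<^sup>2 * c \<le> 1" using mult_mono[OF t(2) c(2)] c by simp
  have tc2: "(2 - 6 * t\<^sup>2) * c \<le> 2 * 1" using t c by (intro mult_mono) auto
  have r6: "r ^ 6 \<le> r ^ 5" "r ^ 8 \<le> r ^ 5" using r by (auto intro!: power_decreasing)
  have "(t\<^sup>2 * c / 3 + (2 - 6 * t\<^sup>2) * c / 4) * r ^ 6 \<le> 1 * r ^ 6"
    using tc tc2 r by (intro mult_right_mono) auto
  moreover have "(2 - 6 * t\<^sup>2) * c / 24 * r ^ 8 \<le> 1 * r ^ 8"
    using tc2 r by (intro mult_right_mono) auto
  ultimately have "r\<^sup>2 / 2 * t\<^sup>2 + r ^ 4 / 4 * c\<^sup>2 - 2 * r ^ 5 - r ^ 5 * lc_err \<le> ent r y"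
    using 3 sym r6 by linarith
  then show ?thesis by (simp add: t_def c_def algebra_simps)
qed

section \<open>Expansion of the potential in the weight near 1\<close>

definition pot_err :: real where "pot_err = gE (\<lambda>z. z\<^sup>2 * exp (2 * \<bar>z\<bar>))"

lemma pot_err_nonneg: "0 \<le> pot_err"
  unfolding pot_err_def by (intro gE_nonneg) simp

text \<open>\<open>exp (X z)\<close> is integrated exactly by \<open>lc_moment_1\<close>, and only
  \<open>exp (- \<eta> * X z)\<close> is expanded. As \<open>|X z| \<le> |z|\<close>, the remainder
  \<open>pot_err\<close> is uniform in \<open>y\<close> and \<open>r\<close>. The denominator
  \<open>1 - \<eta>\<close> is the prefactor \<open>1 / m\<close> of \<open>lc_pot\<close>.\<close>

lemma lc_pot_near_1:
  assumes r: "0 < r" "r \<le> 1" and \<eta>: "0 < \<eta>" "\<eta> \<le> 1 / 2"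
  shows "lc_pot (1 - \<eta>) r y \<le> lc y + r\<^sup>2 / 2 - \<eta> / (1 - \<eta>) * (ent r y - pot_err * \<eta>)"
proof -
  define n where "n = 1 - \<eta>"
  have n: "0 < n" using \<eta> by (simp add: n_def)
  define X where "X = (\<lambda>z. lc (y + r * z) - lc y)"
  have el: "exp_growth (\<lambda>z. lc (y + r * z))" by (rule exp_growth_affine[OF exp_growth_lc])
  have eX: "exp_growth X" unfolding X_def by (intro exp_growth_intros el)
  have Xb: "\<bar>X z\<bar> \<le> \<bar>z\<bar>" for z
  proof -
    have "\<bar>X z\<bar> \<le> \<bar>r * z\<bar>" using lc_lipschitz[of "y + r * z" y] by (simp add: X_def)
    also have "\<dots> \<le> 1 * \<bar>z\<bar>" using r unfolding abs_mult by (intro mult_right_mono) auto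
    finally show ?thesis by simp
  qed
  have cp: "0 < cosh y" by simp
  have expX: "exp (X z) = exp (1 * lc (y + r * z)) / cosh y" for z
    by (simp add: X_def exp_diff)
  have eeX: "exp_growth (\<lambda>z. exp (X z))"
    unfolding expX by (intro exp_growth_divide exp_growth_weight)
  have E0: "gE (\<lambda>z. exp (X z)) = exp (r\<^sup>2 / 2)"
    using lc_moment_1[of r y] cp unfolding expX by (simp add: lc_moment_def)
  have E1: "gE (\<lambda>z. exp (X z) * X z) = exp (r\<^sup>2 / 2) * (ent r y + r\<^sup>2 / 2)"
  proof -
    have "gE (\<lambda>z. exp (X z) * X z) = gE (\<lambda>z. exp (1 * lc (y + r * z)) * lc (y + r * z) / cosh y - lc y * exp (X z))"
    proof (rule Bochner_Integration.integral_cong[OF refl])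
      fix z
      have "exp (X z) * X z = exp (X z) * lc (y + r * z) - lc y * exp (X z)"
        unfolding X_def by (simp add: algebra_simps)
      also have "exp (X z) * lc (y + r * z) = exp (1 * lc (y + r * z)) * lc (y + r * z) / cosh y"
        by (simp only: expX times_divide_eq_left)
      finally show "exp (X z) * X z = exp (1 * lc (y + r * z)) * lc (y + r * z) / cosh y - lc y * exp (X z)" .
    qed
    also have "\<dots> = gE (\<lambda>z. exp (1 * lc (y + r * z)) * lc (y + r * z) / cosh y) - gE (\<lambda>z. lc y * exp (X z))"
      by (intro gE_diff exp_growth_divide exp_growth_weighted exp_growth_lc exp_growth_mult exp_growth_const eeX)
    also have "\<dots> = exp (r\<^sup>2 / 2) * tilt 1 r y lc - lc y * exp (r\<^sup>2 / 2)"
      using cp by (simp add: E0 tilt_def lc_moment_1)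
    finally show ?thesis by (simp add: ent_def algebra_simps)
  qed
  let ?B = "\<lambda>z. exp (X z) - \<eta> * (exp (X z) * X z) + \<eta>\<^sup>2 * (z\<^sup>2 * exp (2 * \<bar>z\<bar>))"
  have "lc_moment n r y = gE (\<lambda>z. exp (n * lc y) * (exp (X z) * exp (- \<eta> * X z)))"
    unfolding lc_moment_def
    by (rule Bochner_Integration.integral_cong)
       (auto simp: X_def n_def exp_add[symmetric] exp_diff[symmetric] algebra_simps simp del: exp_ln)
  also have "\<dots> \<le> gE (\<lambda>z. exp (n * lc y) * ?B z)"
  proof (rule gE_mono)
    have "(\<lambda>z. exp (n * lc y) * (exp (X z) * exp (- \<eta> * X z))) = (\<lambda>z. exp (n * lc (y + r * z)))"
      by (auto simp: X_def n_def exp_add[symmetric] exp_diff[symmetric] algebra_simps simp del: exp_ln)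
    then show "exp_growth (\<lambda>z. exp (n * lc y) * (exp (X z) * exp (- \<eta> * X z)))"
      by (simp add: exp_growth_weight del: exp_ln)
    fix z
    have "(- \<eta> * X z)\<^sup>2 * exp \<bar>- \<eta> * X z\<bar> \<le> \<eta>\<^sup>2 * (z\<^sup>2 * exp \<bar>z\<bar>)"
    proof -
      have "\<bar>- \<eta> * X z\<bar> \<le> 1 * \<bar>z\<bar>" unfolding abs_mult using \<eta> Xb[of z] by (intro mult_mono) auto
      moreover have "(X z)\<^sup>2 \<le> z\<^sup>2" using Xb[of z] by (simp add: abs_le_square_iff)
      ultimately have "(X z)\<^sup>2 * exp \<bar>- \<eta> * X z\<bar> \<le> z\<^sup>2 * exp \<bar>z\<bar>" by (intro mult_mono) auto
      then have "\<eta>\<^sup>2 * ((X z)\<^sup>2 * exp \<bar>- \<eta> * X z\<bar>) \<le> \<eta>\<^sup>2 * (z\<^sup>2 * exp \<bar>z\<bar>)" by (intro mult_left_mono) auto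
      then show ?thesis by (simp add: power_mult_distrib mult.assoc)
    qed
    then have "exp (- \<eta> * X z) \<le> 1 - \<eta> * X z + \<eta>\<^sup>2 * (z\<^sup>2 * exp \<bar>z\<bar>)"
      using exp_le_taylor2[of "- \<eta> * X z"] by simp
    then have "exp (X z) * exp (- \<eta> * X z) \<le> exp (X z) * (1 - \<eta> * X z + \<eta>\<^sup>2 * (z\<^sup>2 * exp \<bar>z\<bar>))"
      by (intro mult_left_mono) auto
    also have "\<dots> = exp (X z) - \<eta> * (exp (X z) * X z) + \<eta>\<^sup>2 * z\<^sup>2 * (exp (X z) * exp \<bar>z\<bar>)"
      by (simp add: algebra_simps)
    also have "\<eta>\<^sup>2 * z\<^sup>2 * (exp (X z) * exp \<bar>z\<bar>) \<le> \<eta>\<^sup>2 * z\<^sup>2 * exp (2 * \<bar>z\<bar>)"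
    proof -
      have "exp (X z + \<bar>z\<bar>) \<le> exp (2 * \<bar>z\<bar>)" using Xb[of z] by simp
      then show ?thesis by (intro mult_left_mono) (auto simp: exp_add)
    qed
    finally have "exp (X z) * exp (- \<eta> * X z) \<le> exp (X z) - \<eta> * (exp (X z) * X z) + \<eta>\<^sup>2 * (z\<^sup>2 * exp (2 * \<bar>z\<bar>))"
      by (simp add: mult.assoc)
    then show "exp (n * lc y) * (exp (X z) * exp (- \<eta> * X z))
      \<le> exp (n * lc y) * ?B z"
      by (intro mult_left_mono) auto
  qed (intro exp_growth_intros eX eeX)
  also have "\<dots> = exp (n * lc y) * (gE (\<lambda>z. exp (X z)) - \<eta> * gE (\<lambda>z. exp (X z) * X z) + \<eta>\<^sup>2 * pot_err)"
    unfolding pot_err_def integral_mult_right_zero[symmetric]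
    by (subst gE_diff[symmetric] gE_add[symmetric], (intro exp_growth_intros eX eeX)+)+ (simp only: integral_mult_right_zero)
  also have "\<dots> \<le> exp (n * lc y) * (exp (r\<^sup>2 / 2) * (1 + (- \<eta> * (ent r y + r\<^sup>2 / 2) + \<eta>\<^sup>2 * pot_err)))"
  proof (rule mult_left_mono)
    have "1 * (\<eta>\<^sup>2 * pot_err) \<le> exp (r\<^sup>2 / 2) * (\<eta>\<^sup>2 * pot_err)"
      by (intro mult_right_mono) (auto simp: pot_err_nonneg)
    then show "gE (\<lambda>z. exp (X z)) - \<eta> * gE (\<lambda>z. exp (X z) * X z) + \<eta>\<^sup>2 * pot_err
      \<le> exp (r\<^sup>2 / 2) * (1 + (- \<eta> * (ent r y + r\<^sup>2 / 2) + \<eta>\<^sup>2 * pot_err))"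
      unfolding E0 E1 by (simp add: algebra_simps)
  qed simp
  finally have le: "lc_moment n r y \<le> exp (n * lc y) * (exp (r\<^sup>2 / 2) * (1 + (- \<eta> * (ent r y + r\<^sup>2 / 2) + \<eta>\<^sup>2 * pot_err)))" .
  define v where "v = - \<eta> * (ent r y + r\<^sup>2 / 2) + \<eta>\<^sup>2 * pot_err"
  have v: "0 < 1 + v"
    using less_le_trans[OF lc_moment_pos le] by (simp add: zero_less_mult_iff v_def del: exp_ln)
  have "ln (lc_moment n r y) \<le> ln (exp (n * lc y) * (exp (r\<^sup>2 / 2) * (1 + v)))"
    using le lc_moment_pos v by (subst ln_le_cancel_iff) (auto simp: v_def)
  also have "\<dots> = n * lc y + r\<^sup>2 / 2 + ln (1 + v)" using v by (simp add: ln_mult del: exp_ln)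
  also have "\<dots> \<le> n * lc y + r\<^sup>2 / 2 + v" using ln_add_one_self_le_self2[of v] v by simp
  finally have "1 / n * ln (lc_moment n r y) \<le> 1 / n * (n * lc y + r\<^sup>2 / 2 + v)"
    using n by (intro mult_left_mono) auto
  also have "1 / n * (n * lc y + r\<^sup>2 / 2 + v) = lc y + r\<^sup>2 / 2 - \<eta> / n * (ent r y - pot_err * \<eta>)"
  proof -
    have "n * lc y + r\<^sup>2 / 2 + v = n * (lc y + r\<^sup>2 / 2) - \<eta> * (ent r y - pot_err * \<eta>)"
      by (simp add: v_def n_def field_simps power2_eq_square)
    then show ?thesis using n by (simp add: field_simps)
  qed
  finally show ?thesis by (simp add: lc_pot_def n_def)
qed

lemma gE_lc_continuous: "continuous_on UNIV (\<lambda>y. gE (\<lambda>z. lc (y + a + r * z)))"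
proof (intro continuous_at_imp_continuous_on ballI)
  fix y
  have "((\<lambda>y. gE (\<lambda>z. lc (y + a + r * z))) has_real_derivative gE (\<lambda>z. tanh (y + a + r * z))) (at y)"
  proof (rule gE_has_derivative[where g="\<lambda>_. 1"])
    fix x z
    have "((\<lambda>x. x + a + r * z) has_real_derivative 1) (at x)" by (auto intro!: derivative_eq_intros)
    from DERIV_chain2[OF lc_derivative this]
    show "((\<lambda>x. lc (x + a + r * z)) has_real_derivative tanh (x + a + r * z)) (at x)" by simp
  qed (auto intro: exp_growth_affine[OF exp_growth_lc] exp_growth_const abs_tanh_le_1)
  then show "isCont (\<lambda>y. gE (\<lambda>z. lc (y + a + r * z))) y" by (rule DERIV_isCont)
qed

lemma ent_measurable [measurable]: "ent r \<in> borel_measurable borel"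
proof -
  note [measurable] = borel_measurable_continuous_onI[OF gE_lc_continuous]
  have "ent r = (\<lambda>y. (1 + tanh y) / 2 * gE (\<lambda>z. lc (y + r\<^sup>2 + r * z))
      + (1 - tanh y) / 2 * gE (\<lambda>z. lc (y + (- (r\<^sup>2)) + r * z)) - lc y - r\<^sup>2 / 2)"
    unfolding ent_def[abs_def] tilt_1[OF exp_growth_lc] ..
  also have "\<dots> \<in> borel_measurable borel" by measurable
  finally show ?thesis .
qed

text \<open>\<open>lc\<close> is 1-Lipschitz and the shifts are at most 1. The uniform bound allows
  an expansion of the exponential of \<open>ent\<close> with a constant remainder.\<close>

lemma ent_bounded:
  assumes r: "0 < r" "r \<le> 1" shows "\<bar>ent r y\<bar> \<le> 4"
proof -
  have b: "\<bar>gE (\<lambda>z. lc (y + a + r * z)) - lc y\<bar> \<le> 3" if a: "\<bar>a\<bar> \<le> 1" for a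
  proof -
    have e: "exp_growth (\<lambda>z. lc (y + a + r * z))" by (rule exp_growth_affine[OF exp_growth_lc])
    have "gE (\<lambda>z. lc (y + a + r * z)) - lc y = gE (\<lambda>z. lc (y + a + r * z) - lc y)"
      by (simp add: gE_diff e exp_growth_const)
    also have "\<bar>\<dots>\<bar> \<le> gE (\<lambda>z. 2 + z ^ 2)"
    proof (rule gE_abs_le)
      fix z
      have "\<bar>lc (y + a + r * z) - lc y\<bar> \<le> \<bar>a + r * z\<bar>"
        using lc_lipschitz[of "y + a + r * z" y] by (simp add: add.assoc)
      also have "\<dots> \<le> 1 + 1 * \<bar>z\<bar>"
        using a r abs_triangle_ineq[of a "r * z"] mult_right_mono[of r 1 "\<bar>z\<bar>"] by (simp add: abs_mult)
      also have "\<bar>z\<bar> \<le> 1 + z ^ 2"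
      proof -
        have "0 \<le> (\<bar>z\<bar> - 1 / 2)\<^sup>2" by simp
        then show ?thesis by (simp add: power2_eq_square algebra_simps)
      qed
      finally show "\<bar>lc (y + a + r * z) - lc y\<bar> \<le> 2 + z ^ 2" by simp
    qed (measurable, intro exp_growth_intros)
    also have "\<dots> = 3" by (simp add: gE_add exp_growth_intros gE_moments)
    finally show ?thesis .
  qed
  define p where "p = (1 + tanh y) / 2"
  have p: "0 \<le> p" "p \<le> 1" using abs_tanh_le_1[of y] by (auto simp: p_def)
  have r1: "\<bar>r\<^sup>2\<bar> \<le> 1" "\<bar>- (r\<^sup>2)\<bar> \<le> 1" using r by (auto simp: power_le_one)
  define u v where "u = gE (\<lambda>z. lc (y + r\<^sup>2 + r * z)) - lc y" and "v = gE (\<lambda>z. lc (y + (- (r\<^sup>2)) + r * z)) - lc y"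
  have uv: "\<bar>u\<bar> \<le> 3" "\<bar>v\<bar> \<le> 3" unfolding u_def v_def using b r1 by blast+
  have "ent r y = p * u + (1 - p) * v - r\<^sup>2 / 2"
    unfolding ent_def tilt_1[OF exp_growth_lc] u_def v_def p_def by (simp add: field_simps)
  moreover have "\<bar>p * u + (1 - p) * v\<bar> \<le> p * 3 + (1 - p) * 3"
  proof -
    have "\<bar>p * u + (1 - p) * v\<bar> \<le> \<bar>p * u\<bar> + \<bar>(1 - p) * v\<bar>" by (rule abs_triangle_ineq)
    also have "\<dots> \<le> p * 3 + (1 - p) * 3"
      unfolding abs_mult using p uv by (intro add_mono mult_mono) auto
    finally show ?thesis .
  qed
  moreover have "p * 3 + (1 - p) * 3 = 3" by (simp add: algebra_simps)
  ultimately show ?thesis using r1(1) zero_le_power2[of r] by linarith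
qed

lemma exp_growth_ent: "0 < r \<Longrightarrow> r \<le> 1 \<Longrightarrow> exp_growth (ent r)"
  by (rule exp_growth_bounded[OF ent_measurable ent_bounded])

context mixture_model
begin

text \<open>Lowering the weight on \<open>[q, q')\<close> from \<open>1\<close> to \<open>1 - \<eta>\<close>, to first order in \<open>\<eta>\<close>.\<close>

lemma split_upper_atom:
  assumes q: "0 < q" "q < q'" "q' \<le> 1" and m: "0 < m" "m < 1"
    and r: "r = sqrt (\<xi>' q' - \<xi>' q)" "r \<le> 1"
    and opt: "\<And>n. m < n \<Longrightarrow> n < 1 \<Longrightarrow> P2 0 q m \<le> P3 q q' m n"
  shows "tilt m (sqrt (\<xi>' q)) 0 (ent r) \<le> 1 / 2 * (\<theta> q' - \<theta> q)"
proof -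
  define s where "s = sqrt (\<xi>' q)"
  define N where "N = lc_moment m s 0"
  define E where "E = tilt m s 0 (ent r)"
  \<comment> \<open>Bounds \<open>|ent r y - pot_err * \<eta>|\<close>: 4 from
    \<open>ent_bounded\<close>, the rest from \<open>\<eta> \<le> 1\<close>.\<close>
  define M where "M = 4 + pot_err"
  define d where "d = \<theta> q' - \<theta> q"
  have M0: "0 \<le> M" using pot_err_nonneg by (simp add: M_def)
  have r0: "0 < r" unfolding r(1) using xi'_less[of q q'] q by simp
  have r2: "r\<^sup>2 = \<xi>' q' - \<xi>' q" unfolding r(1) using xi'_less[of q q'] q by simp
  have Npos: "0 < N" unfolding N_def by (rule lc_moment_pos)
  have d0: "0 \<le> d"
  proof -
    have "0 \<le> q * (\<xi>' q' - \<xi>' q)" using xi'_mono[of q q'] q by (intro mult_nonneg_nonneg) auto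
    then show ?thesis using theta_diff_ge[of q q'] q by (simp add: d_def)
  qed
  note eent = exp_growth_ent[OF r0 r(2)]
  have bound: "E \<le> 1 / 2 * d + (pot_err + 2 * (M\<^sup>2 * exp M)) * \<eta>" if \<eta>: "0 < \<eta>" "\<eta> < min (1 / 2) (1 - m)" for \<eta>
  proof -
    define n where "n = 1 - \<eta>"
    have n: "m < n" "n < 1" "1 / 2 \<le> n" "0 < n" using \<eta> m by (auto simp: n_def)
    \<comment> \<open>The correction \<open>\<eta> / n\<close> of \<open>lc_pot_near_1\<close> times
      the weight \<open>m\<close> of the outer step.\<close>
    define \<kappa> where "\<kappa> = m * \<eta> / n"
    have \<kappa>: "0 < \<kappa>" "\<kappa> \<le> 2 * \<eta>" "\<kappa> \<le> 1"
    proof -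
      show "0 < \<kappa>" using m n \<eta> by (simp add: \<kappa>_def)
      have "m * \<eta> \<le> 1 * \<eta>" using m \<eta> by (intro mult_right_mono) auto
      also have "\<dots> \<le> (2 * \<eta>) * n" using n \<eta> by simp
      finally show k: "\<kappa> \<le> 2 * \<eta>" using n by (simp add: \<kappa>_def divide_le_eq)
      then show "\<kappa> \<le> 1" using \<eta> by simp
    qed
    define u where "u = (\<lambda>y. ent r y - pot_err * \<eta>)"
    have ub: "\<bar>u y\<bar> \<le> M" for y
    proof -
      have "0 \<le> pot_err * \<eta>" "pot_err * \<eta> \<le> pot_err * 1"
        using pot_err_nonneg \<eta> by (simp_all add: mult_left_le)
      then show ?thesis using ent_bounded[OF r0 r(2), of y] unfolding u_def M_def by linarith
    qed
    let ?W = "\<lambda>z. exp (m * lc (0 + s * z))"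
    have eu: "exp_growth u" unfolding u_def by (intro exp_growth_intros eent)
    have eW: "exp_growth ?W" by (rule exp_growth_weight)
    have eWu: "exp_growth (\<lambda>z. ?W z * u (0 + s * z))" by (rule exp_growth_weighted[OF eu])
    have ep: "exp_growth (\<lambda>z. exp (m * lc_pot n r (0 + s * z)))"
      using n by (intro exp_growth_affine[OF exp_growth_exp_lc_pot]) auto
    have "gE (\<lambda>z. exp (m * lc_pot n r (0 + s * z)))
      \<le> gE (\<lambda>z. exp (m * r\<^sup>2 / 2) * (?W z * (1 + \<kappa>\<^sup>2 * (M\<^sup>2 * exp M)) - \<kappa> * (?W z * u (0 + s * z))))"
    proof (rule gE_mono[OF ep])
      fix z
      define y where "y = 0 + s * z"
      have "m * lc_pot n r y \<le> m * (lc y + r\<^sup>2 / 2 - \<eta> / n * u y)"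
        using lc_pot_near_1[OF r0 r(2), of \<eta> y] \<eta> m by (intro mult_left_mono) (auto simp: n_def u_def)
      also have "\<dots> = m * r\<^sup>2 / 2 + (m * lc y + - \<kappa> * u y)" by (simp add: \<kappa>_def algebra_simps)
      finally have "exp (m * lc_pot n r y) \<le> exp (m * r\<^sup>2 / 2 + (m * lc y + - \<kappa> * u y))" by simp
      also have "\<dots> = exp (m * r\<^sup>2 / 2) * (exp (m * lc y) * exp (- \<kappa> * u y))" unfolding exp_add ..
      also have "\<dots> \<le> exp (m * r\<^sup>2 / 2) * (exp (m * lc y) * (1 + - \<kappa> * u y + \<kappa>\<^sup>2 * (M\<^sup>2 * exp M)))"
      proof (intro mult_left_mono)
        have "\<bar>- \<kappa> * u y\<bar> \<le> 1 * M" unfolding abs_mult using \<kappa> ub[of y] by (intro mult_mono) auto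
        moreover have "(u y)\<^sup>2 \<le> M\<^sup>2" using ub[of y] M0 by (simp add: abs_le_square_iff[symmetric])
        ultimately have "(u y)\<^sup>2 * exp \<bar>- \<kappa> * u y\<bar> \<le> M\<^sup>2 * exp M" by (intro mult_mono) auto
        then have "\<kappa>\<^sup>2 * ((u y)\<^sup>2 * exp \<bar>- \<kappa> * u y\<bar>) \<le> \<kappa>\<^sup>2 * (M\<^sup>2 * exp M)" by (intro mult_left_mono) auto
        moreover have "(- \<kappa> * u y)\<^sup>2 = \<kappa>\<^sup>2 * (u y)\<^sup>2" by (simp add: power_mult_distrib)
        ultimately show "exp (- \<kappa> * u y) \<le> 1 + - \<kappa> * u y + \<kappa>\<^sup>2 * (M\<^sup>2 * exp M)"
          using exp_le_taylor2[of "- \<kappa> * u y"] by (simp add: mult.assoc)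
      qed auto
      also have "\<dots> = exp (m * r\<^sup>2 / 2) * (exp (m * lc y) * (1 + \<kappa>\<^sup>2 * (M\<^sup>2 * exp M)) - \<kappa> * (exp (m * lc y) * u y))"
        by (simp add: algebra_simps del: exp_ln)
      finally show "exp (m * lc_pot n r (0 + s * z))
        \<le> exp (m * r\<^sup>2 / 2) * (?W z * (1 + \<kappa>\<^sup>2 * (M\<^sup>2 * exp M)) - \<kappa> * (?W z * u (0 + s * z)))"
        unfolding y_def .
    qed (intro exp_growth_mult exp_growth_diff exp_growth_const eW eWu)
    also have "\<dots> = exp (m * r\<^sup>2 / 2) * (gE ?W * (1 + \<kappa>\<^sup>2 * (M\<^sup>2 * exp M)) - \<kappa> * gE (\<lambda>z. ?W z * u (0 + s * z)))"
      by (subst integral_mult_right_zero, subst gE_diff)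
         (intro exp_growth_mult exp_growth_const eW eWu | simp only: integral_mult_right_zero integral_mult_left_zero)+
    also have "gE (\<lambda>z. ?W z * u (0 + s * z)) = N * (E - pot_err * \<eta>)"
    proof -
      have "tilt m s 0 u = E - pot_err * \<eta>"
        unfolding u_def E_def by (simp add: tilt_diff eent exp_growth_const tilt_const)
      then show ?thesis using Npos unfolding tilt_def N_def by (simp add: field_simps)
    qed
    also have "gE ?W = N" by (simp add: N_def lc_moment_def)
    also have "N * (1 + \<kappa>\<^sup>2 * (M\<^sup>2 * exp M)) - \<kappa> * (N * (E - pot_err * \<eta>))
       = N * (1 + (\<kappa>\<^sup>2 * (M\<^sup>2 * exp M) - \<kappa> * (E - pot_err * \<eta>)))" by (simp add: algebra_simps)
    finally have le: "gE (\<lambda>z. exp (m * lc_pot n r (0 + s * z)))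
       \<le> exp (m * r\<^sup>2 / 2) * (N * (1 + (\<kappa>\<^sup>2 * (M\<^sup>2 * exp M) - \<kappa> * (E - pot_err * \<eta>))))" .
    define v where "v = \<kappa>\<^sup>2 * (M\<^sup>2 * exp M) - \<kappa> * (E - pot_err * \<eta>)"
    have gp: "0 < gE (\<lambda>z. exp (m * lc_pot n r (0 + s * z)))" by (rule gE_pos[OF ep]) simp
    have v: "0 < 1 + v"
      using less_le_trans[OF gp le] Npos by (simp add: zero_less_mult_iff v_def)
    have "ln (gE (\<lambda>z. exp (m * lc_pot n r (0 + s * z)))) \<le> ln (exp (m * r\<^sup>2 / 2) * (N * (1 + v)))"
      using le gp v Npos by (subst ln_le_cancel_iff) (auto simp: v_def)
    also have "\<dots> = m * r\<^sup>2 / 2 + (ln N + ln (1 + v))" using v Npos by (simp add: ln_mult)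
    also have "\<dots> \<le> m * r\<^sup>2 / 2 + (ln N + v)" using ln_add_one_self_le_self2[of v] v by simp
    finally have "1 / m * ln (gE (\<lambda>z. exp (m * lc_pot n r (0 + s * z)))) \<le> 1 / m * (m * r\<^sup>2 / 2 + (ln N + v))"
      using m by (intro mult_left_mono) auto
    also have "\<dots> = r\<^sup>2 / 2 + lc_pot m s 0 + v / m"
      using m by (simp add: lc_pot_def N_def field_simps)
    finally have gs: "gauss_step m (\<xi>' q) (lc_pot n r) 0 \<le> r\<^sup>2 / 2 + lc_pot m s 0 + v / m"
      using m by (simp add: gauss_step_def s_def mult.commute)
    have p2: "P2 0 q m = lc_pot m s 0 + (\<xi>' 1 - \<xi>' q) / 2 - 1 / 2 * (\<theta> 1 - (1 - m) * \<theta> q)"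
      unfolding P2_zero s_def ..
    have p3: "P3 q q' m n = gauss_step m (\<xi>' q) (lc_pot n r) 0 + (\<xi>' 1 - \<xi>' q') / 2
      - 1 / 2 * (m * \<theta> 1 + (n - m) * (\<theta> 1 - \<theta> q) + (1 - n) * (\<theta> 1 - \<theta> q'))"
      unfolding P3_def r(1) ..
    have c: "- (1 / 2 * (m * \<theta> 1 + (n - m) * (\<theta> 1 - \<theta> q) + (1 - n) * (\<theta> 1 - \<theta> q')))
      = - (1 / 2 * (\<theta> 1 - (1 - m) * \<theta> q)) + 1 / 2 * (\<eta> * d)"
      by (simp add: n_def d_def field_simps)
    have "P2 0 q m \<le> P3 q q' m n" using n by (intro opt) auto
    then have "0 \<le> v / m + 1 / 2 * (\<eta> * d)"
      unfolding p2 p3 using gs c r2 by argo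
    \<comment> \<open>\<open>n / \<eta>\<close> undoes the scale
      \<open>\<kappa> / m = \<eta> / n\<close> and leaves the first-order inequality with errors
      linear in \<open>\<eta>\<close>.\<close>
    then have "0 \<le> (n / \<eta>) * (v / m + 1 / 2 * (\<eta> * d))" using n \<eta> by (intro mult_nonneg_nonneg) auto
    also have "(n / \<eta>) * (v / m + 1 / 2 * (\<eta> * d)) = \<kappa> * (M\<^sup>2 * exp M) - (E - pot_err * \<eta>) + n * (1 / 2 * d)"
    proof -
      have "v = \<kappa> * (\<kappa> * (M\<^sup>2 * exp M) - (E - pot_err * \<eta>))" by (simp add: v_def power2_eq_square algebra_simps)
      moreover have "n / \<eta> * (\<kappa> * w / m) = w" for w using n \<eta> m by (simp add: \<kappa>_def)
      ultimately have "n / \<eta> * (v / m) = \<kappa> * (M\<^sup>2 * exp M) - (E - pot_err * \<eta>)" by simp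
      then show ?thesis using \<eta> by (simp add: distrib_left)
    qed
    finally have "E \<le> \<kappa> * (M\<^sup>2 * exp M) + pot_err * \<eta> + n * (1 / 2 * d)" by linarith
    also have "\<kappa> * (M\<^sup>2 * exp M) \<le> 2 * \<eta> * (M\<^sup>2 * exp M)" using \<kappa> by (intro mult_right_mono) auto
    also have "n * (1 / 2 * d) \<le> 1 * (1 / 2 * d)" using n d0 by (intro mult_right_mono) auto
    finally show ?thesis by (simp add: algebra_simps)
  qed
  have "E \<le> 1 / 2 * d"
    by (rule le_of_linear_error[of "min (1 / 2) (1 - m)", OF _ bound]) (use m in auto)
  then show ?thesis by (simp add: E_def d_def s_def)
qed

text \<open>Write \<open>\<Gamma>\<close> and \<open>G\<close> for the two tilted means and
  \<open>r\<^sup>2 = \<xi>' q' - \<xi>' q\<close>. Splitting gives \<open>r\<^sup>2 / 2 * (\<Gamma>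
  - q) + r ^ 4 / 4 * (G - 1 / \<xi>'' q) \<le> C * r ^ 5\<close>. The leading order is the first
  claim. By \<open>ge\<close> the first term is nonnegative and may be dropped, and the next order
  is the second claim.\<close>

lemma upper_atom_stable:
  assumes q: "0 < q" "q < 1" and m: "0 < m" "m < 1"
    and opt: "\<And>q' n. q < q' \<Longrightarrow> q' \<le> 1 \<Longrightarrow> m < n \<Longrightarrow> n < 1 \<Longrightarrow> P2 0 q m \<le> P3 q q' m n"
    and ge: "q \<le> tilt m (sqrt (\<xi>' q)) 0 (\<lambda>y. (tanh y)\<^sup>2)"
  shows "tilt m (sqrt (\<xi>' q)) 0 (\<lambda>y. (tanh y)\<^sup>2) \<le> q"
    and "tilt m (sqrt (\<xi>' q)) 0 (\<lambda>y. (1 - (tanh y)\<^sup>2)\<^sup>2) \<le> 1 / \<xi>'' q"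
proof -
  define s where "s = sqrt (\<xi>' q)"
  define \<Gamma> where "\<Gamma> = tilt m s 0 (\<lambda>y. (tanh y)\<^sup>2)"
  define G where "G = tilt m s 0 (\<lambda>y. (1 - (tanh y)\<^sup>2)\<^sup>2)"
  define x where "x = \<xi>'' q"
  define C where "C = 2 + lc_err"
  define Q where "Q = (\<lambda>n. q + (1 - q) / (real n + 2))"
  define R where "R = (\<lambda>n. sqrt (\<xi>' (Q n) - \<xi>' q))"
  have x: "0 < x" unfolding x_def using q by (intro xi''_pos) auto
  have Qn: "q < Q n" "Q n \<le> 1" for n
  proof -
    show "q < Q n" using q by (simp add: Q_def)
    have "(1 - q) / (real n + 2) \<le> (1 - q) / 1" using q by (intro divide_left_mono) auto
    then show "Q n \<le> 1" by (simp add: Q_def)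
  qed
  have Qlim: "Q \<longlonglongrightarrow> q" unfolding Q_def by real_asymp
  have "(\<lambda>n. \<xi>' (Q n)) \<longlonglongrightarrow> \<xi>' q"
    by (rule isCont_tendsto_compose[OF DERIV_isCont[OF xi'_derivative] Qlim]) (use q in auto)
  then have "(\<lambda>n. sqrt (\<xi>' (Q n) - \<xi>' q)) \<longlonglongrightarrow> sqrt (\<xi>' q - \<xi>' q)" by (intro tendsto_intros)
  then have Rlim: "R \<longlonglongrightarrow> 0" by (simp add: R_def)
  have "\<xi>' q < \<xi>' (Q n)" for n using xi'_less[of q "Q n"] Qn[of n] q by simp
  then have Rpos: "0 < R n" "(R n)\<^sup>2 = \<xi>' (Q n) - \<xi>' q" for n by (simp_all add: R_def less_imp_le)
  have "\<forall>\<^sub>F n in sequentially. R n < 1" using Rlim by (rule order_tendstoD) simp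
  then obtain n0 where n0: "\<And>n. n \<ge> n0 \<Longrightarrow> R n < 1" unfolding eventually_sequentially by blast
  have et: "exp_growth (\<lambda>y. (tanh y)\<^sup>2)" "exp_growth (\<lambda>y. (1 - (tanh y)\<^sup>2)\<^sup>2)"
    by (intro exp_growth_intros exp_growth_tanh)+
  have key: "1 / 2 * (\<Gamma> - q) + (R n)\<^sup>2 / 4 * (G - 1 / x) \<le> C * R n ^ 3" if n: "n \<ge> n0" for n
  proof -
    define r where "r = R n"
    have r: "0 < r" "r \<le> 1" "r\<^sup>2 = \<xi>' (Q n) - \<xi>' q"
      using Rpos[of n] n0[OF n] by (auto simp: r_def)
    have "r\<^sup>2 / 2 * \<Gamma> + r ^ 4 / 4 * G - C * r ^ 5
      = tilt m s 0 (\<lambda>y. r\<^sup>2 / 2 * (tanh y)\<^sup>2 + r ^ 4 / 4 * (1 - (tanh y)\<^sup>2)\<^sup>2 - C * r ^ 5)"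
      unfolding \<Gamma>_def G_def
      by (subst tilt_diff, intro exp_growth_add exp_growth_mult exp_growth_const et, intro exp_growth_const,
          subst tilt_add, (intro exp_growth_mult exp_growth_const et)+) (simp only: tilt_mult tilt_const)
    also have "\<dots> \<le> tilt m s 0 (ent r)"
    proof (rule tilt_mono)
      show "r\<^sup>2 / 2 * (tanh y)\<^sup>2 + r ^ 4 / 4 * (1 - (tanh y)\<^sup>2)\<^sup>2 - C * r ^ 5 \<le> ent r y" for y
        unfolding C_def by (rule ent_expansion[OF r(1,2)])
      show "exp_growth (\<lambda>y. r\<^sup>2 / 2 * (tanh y)\<^sup>2 + r ^ 4 / 4 * (1 - (tanh y)\<^sup>2)\<^sup>2 - C * r ^ 5)"
        by (intro exp_growth_diff exp_growth_add exp_growth_mult exp_growth_const et)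
    qed (rule exp_growth_ent[OF r(1,2)])
    also have "\<dots> \<le> 1 / 2 * (\<theta> (Q n) - \<theta> q)"
      unfolding s_def
    proof (rule split_upper_atom[OF q(1) Qn m])
      show "r = sqrt (\<xi>' (Q n) - \<xi>' q)" by (simp add: r_def R_def)
      show "r \<le> 1" by (rule r(2))
      show "P2 0 q m \<le> P3 q (Q n) m k" if "m < k" "k < 1" for k
        using that Qn[of n] by (intro opt) auto
    qed
    also have "\<dots> \<le> 1 / 2 * (q * r\<^sup>2 + (r\<^sup>2)\<^sup>2 / (2 * x))"
      using theta_diff_le2[of q "Q n"] Qn[of n] q by (simp add: r(3) x_def)
    finally have le: "r\<^sup>2 / 2 * \<Gamma> + r ^ 4 / 4 * G - C * r ^ 5 \<le> 1 / 2 * (q * r\<^sup>2 + (r\<^sup>2)\<^sup>2 / (2 * x))" .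
    have "r\<^sup>2 * (1 / 2 * (\<Gamma> - q) + r\<^sup>2 / 4 * (G - 1 / x))
        = r\<^sup>2 / 2 * \<Gamma> + r ^ 4 / 4 * G - 1 / 2 * (q * r\<^sup>2 + (r\<^sup>2)\<^sup>2 / (2 * x))"
      using x by (simp add: field_simps eval_nat_numeral)
    moreover have "r\<^sup>2 * (C * r ^ 3) = C * r ^ 5" by (simp add: eval_nat_numeral)
    ultimately have "r\<^sup>2 * (1 / 2 * (\<Gamma> - q) + r\<^sup>2 / 4 * (G - 1 / x)) \<le> r\<^sup>2 * (C * r ^ 3)"
      using le by linarith
    then have "1 / 2 * (\<Gamma> - q) + r\<^sup>2 / 4 * (G - 1 / x) \<le> C * r ^ 3"
      using r(1) by (simp only: mult_le_cancel_left_pos zero_less_power)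
    then show ?thesis by (simp add: r_def)
  qed
  have G0: "0 \<le> G" unfolding G_def
    using tilt_mono[OF exp_growth_const[of 0] et(2), of m s 0] by (simp add: tilt_const)
  have "(\<lambda>n. C * R n ^ 3 + (R n)\<^sup>2 / 4 * (1 / x)) \<longlonglongrightarrow> C * 0 ^ 3 + 0\<^sup>2 / 4 * (1 / x)"
    by (intro tendsto_intros Rlim) auto
  then have lim3: "(\<lambda>n. C * R n ^ 3 + (R n)\<^sup>2 / 4 * (1 / x)) \<longlonglongrightarrow> 0" by simp
  have "1 / 2 * (\<Gamma> - q) \<le> C * R n ^ 3 + (R n)\<^sup>2 / 4 * (1 / x)" if "n \<ge> n0" for n
  proof -
    have "0 \<le> (R n)\<^sup>2 / 4 * G" using G0 by simp
    then show ?thesis using key[OF that] by (simp add: right_diff_distrib)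
  qed
  then have "1 / 2 * (\<Gamma> - q) \<le> 0" by (intro LIMSEQ_le_const[OF lim3]) blast
  then show "tilt m (sqrt (\<xi>' q)) 0 (\<lambda>y. (tanh y)\<^sup>2) \<le> q" by (simp add: \<Gamma>_def s_def)
  have "(\<lambda>n. 4 * C * R n) \<longlonglongrightarrow> 4 * C * 0" by (intro tendsto_intros Rlim)
  then have lim: "(\<lambda>n. 4 * C * R n) \<longlonglongrightarrow> 0" by simp
  have "G - 1 / x \<le> 4 * C * R n" if "n \<ge> n0" for n
  proof -
    have "0 \<le> 1 / 2 * (\<Gamma> - q)" using ge by (simp add: \<Gamma>_def s_def)
    then have "(R n)\<^sup>2 / 4 * (G - 1 / x) \<le> C * R n ^ 3" using key[OF that] by linarith
    then have "(R n)\<^sup>2 * (G - 1 / x) \<le> (R n)\<^sup>2 * (4 * C * R n)" by (simp add: eval_nat_numeral mult_ac)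
    then show ?thesis using Rpos(1)[of n] by (simp only: mult_le_cancel_left_pos zero_less_power)
  qed
  then have "G - 1 / x \<le> 0" by (intro LIMSEQ_le_const[OF lim]) blast
  then show "tilt m (sqrt (\<xi>' q)) 0 (\<lambda>y. (1 - (tanh y)\<^sup>2)\<^sup>2) \<le> 1 / \<xi>'' q"
    by (simp add: G_def s_def x_def)
qed

text \<open>The trial measure of the random energy model.\<close>

lemma P2_0_1_le:
  assumes m: "0 < m" "m \<le> 1" shows "P2 0 1 m \<le> ln 2 / m + m * \<xi> 1 / 2 - ln 2"
proof -
  have "lc_moment m (sqrt (\<xi>' 1)) 0 \<le> exp ((1 - m) * ln 2 + (m * sqrt (\<xi>' 1))\<^sup>2 / 2)"
    using m by (intro lc_moment_le) auto
  then have "ln (lc_moment m (sqrt (\<xi>' 1)) 0) \<le> ln (exp ((1 - m) * ln 2 + (m * sqrt (\<xi>' 1))\<^sup>2 / 2))"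
    using lc_moment_pos by (subst ln_le_cancel_iff) auto
  also have "\<dots> = (1 - m) * ln 2 + m\<^sup>2 * \<xi>' 1 / 2"
    using xi'_nonneg[of 1] by (simp add: power_mult_distrib)
  finally have "1 / m * ln (lc_moment m (sqrt (\<xi>' 1)) 0) \<le> 1 / m * ((1 - m) * ln 2 + m\<^sup>2 * \<xi>' 1 / 2)"
    using m by (intro mult_left_mono) auto
  also have "\<dots> = ln 2 / m - ln 2 + m * \<xi>' 1 / 2"
    using m by (simp add: field_simps power2_eq_square)
  finally have "lc_pot m (sqrt (\<xi>' 1)) 0 \<le> ln 2 / m - ln 2 + m * \<xi>' 1 / 2" by (simp add: lc_pot_def)
  moreover have "P2 0 1 m = lc_pot m (sqrt (\<xi>' 1)) 0 - m * \<theta> 1 / 2"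
    by (simp add: P2_zero field_simps)
  moreover have "m * \<xi>' 1 / 2 - m * \<theta> 1 / 2 = m * \<xi> 1 / 2"
    by (simp add: theta_1[symmetric] algebra_simps diff_divide_distrib)
  ultimately show ?thesis by linarith
qed

text \<open>The part \<open>m * (\<xi>' q - \<theta> q) / 2\<close> is nonnegative and is dropped,
  so the bound is free of \<open>m\<close>. Against the random energy model value it keeps
  \<open>\<xi> q\<close> close to \<open>\<xi> 1\<close>.\<close>

lemma P2_zero_ge:
  assumes q: "0 < q" "q \<le> 1" and m: "0 < m" "m \<le> 1"
  shows "1 / 2 * (\<xi> 1 - \<xi> q - (1 - q) * \<xi>' q) - ln 2 \<le> P2 0 q m"
proof -
  define A where "A = \<xi>' q"
  have A: "0 < A" unfolding A_def using q by (rule xi'_pos)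
  have "exp (m * 0 - m * ln 2 + (m * sqrt A)\<^sup>2 / 2) \<le> lc_moment m (sqrt A) 0"
    using m by (intro lc_moment_ge) auto
  then have "ln (exp (m * 0 - m * ln 2 + (m * sqrt A)\<^sup>2 / 2)) \<le> ln (lc_moment m (sqrt A) 0)"
    using lc_moment_pos by (subst ln_le_cancel_iff) auto
  then have "m * (m * A / 2 - ln 2) \<le> ln (lc_moment m (sqrt A) 0)"
    using A by (simp add: power_mult_distrib algebra_simps power2_eq_square)
  then have "1 / m * (m * (m * A / 2 - ln 2)) \<le> 1 / m * ln (lc_moment m (sqrt A) 0)"
    using m by (intro mult_left_mono) auto
  then have 1: "m * A / 2 - ln 2 \<le> lc_pot m (sqrt A) 0" using m by (simp add: lc_pot_def)
  have "q * A \<le> 1 * A" using q A by (intro mult_right_mono) auto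
  then have "\<theta> q \<le> A"
    using xi_nonneg[of q] q unfolding \<theta>_def A_def by linarith
  then have "m * \<theta> q \<le> m * A" using m by (intro mult_left_mono) auto
  then have "1 / 2 * (\<xi>' 1 - \<theta> 1 - A + \<theta> q) - ln 2 \<le> P2 0 q m"
    unfolding P2_zero A_def[symmetric] using 1 by argo
  moreover have "\<xi>' 1 - \<theta> 1 - A + \<theta> q = \<xi> 1 - \<xi> q - (1 - q) * \<xi>' q"
    by (simp add: theta_1 \<theta>_def A_def algebra_simps)
  ultimately show ?thesis by simp
qed

text \<open>\<open>(1 - tanh\<^sup>2)\<^sup>2\<close> is the power -4 of \<open>cosh\<close>. The
  extra power \<open>m\<close> is at least 1, and \<open>lc y \<le> y\<^sup>2 / 2\<close> leaves the
  Gaussian integral of \<open>exp (- 2 * A * z\<^sup>2)\<close>. The denominator is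
  \<open>lc_moment_le\<close> combined with \<open>w\<close>.\<close>

lemma gardner_lower_bound:
  assumes q: "0 < q" "q \<le> 1" and m: "0 < m" "m \<le> 1" and w: "m\<^sup>2 * \<xi> q \<le> 2 * ln 2"
  shows "1 / (sqrt (1 + 4 * \<xi>' q) * (2 * 2 powr (\<xi>' q / \<xi> q))) \<le> tilt m (sqrt (\<xi>' q)) 0 (\<lambda>y. (1 - (tanh y)\<^sup>2)\<^sup>2)"
proof -
  define A where "A = \<xi>' q"
  define s where "s = sqrt A"
  define N where "N = lc_moment m s 0"
  have A: "0 < A" unfolding A_def using q by (rule xi'_pos)
  have s2: "s\<^sup>2 = A" using A by (simp add: s_def)
  have Npos: "0 < N" unfolding N_def by (rule lc_moment_pos)
  obtain c where c: "0 < c" "c < q" "\<xi> q - \<xi> 0 = (q - 0) * \<xi>' c" using xi_mvt[of 0 q] q by auto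
  have xq: "0 < \<xi> q" using c q xi'_pos[of c] by (simp add: xi_0)
  have "N \<le> exp ((1 - m) * ln 2 + (m * s)\<^sup>2 / 2)"
    unfolding N_def using m by (intro lc_moment_le) auto
  also have "\<dots> \<le> exp (ln 2 + A / \<xi> q * ln 2)"
  proof -
    have "m\<^sup>2 * A = (m\<^sup>2 * \<xi> q) * (A / \<xi> q)" using xq by simp
    also have "\<dots> \<le> 2 * ln 2 * (A / \<xi> q)" using w A xq by (intro mult_right_mono) auto
    finally have "m\<^sup>2 * A / 2 \<le> A / \<xi> q * ln 2" by (simp add: mult_ac)
    moreover have "(1 - m) * ln 2 \<le> 1 * (ln 2 :: real)" using m by (intro mult_right_mono) auto
    ultimately have "(1 - m) * ln 2 + m\<^sup>2 * A / 2 \<le> ln 2 + A / \<xi> q * ln 2" by argo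
    then show ?thesis by (simp only: power_mult_distrib s2 exp_le_cancel_iff)
  qed
  also have "\<dots> = 2 * 2 powr (A / \<xi> q)" by (simp add: exp_add powr_def)
  finally have Nle: "N \<le> 2 * 2 powr (A / \<xi> q)" .
  have "1 / (sqrt (1 + 4 * A) * (2 * 2 powr (A / \<xi> q))) \<le> 1 / (sqrt (1 + 4 * A) * N)"
    using Nle Npos A by (intro divide_left_mono mult_left_mono mult_pos_pos) auto
  also have "\<dots> = gE (\<lambda>z. exp (- (2 * A) * z\<^sup>2)) / N"
    using gE_exp_neg_square[of "2 * A"] A by simp
  also have "\<dots> \<le> tilt m s 0 (\<lambda>y. (1 - (tanh y)\<^sup>2)\<^sup>2)"
    unfolding tilt_def N_def[symmetric]
  proof (rule divide_right_mono[OF gE_mono])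
    show "exp_growth (\<lambda>z. exp (- (2 * A) * z\<^sup>2))"
      by (rule exp_growth_bounded[where C=1]) (use A in auto)
    show "exp_growth (\<lambda>z. exp (m * lc (0 + s * z)) * (1 - (tanh (0 + s * z))\<^sup>2)\<^sup>2)"
      by (rule exp_growth_weighted) (intro exp_growth_intros exp_growth_tanh)
    fix z
    define y where "y = 0 + s * z"
    have cp: "0 < cosh y" by simp
    have "1 - (tanh y)\<^sup>2 = ((cosh y)\<^sup>2 - (sinh y)\<^sup>2) / (cosh y)\<^sup>2"
      using cp by (simp add: tanh_def power_divide diff_divide_distrib)
    then have "1 - (tanh y)\<^sup>2 = inverse ((cosh y)\<^sup>2)"
      by (simp add: cosh_square_eq[of y] inverse_eq_divide)
    then have "(1 - (tanh y)\<^sup>2)\<^sup>2 = inverse (cosh y ^ 4)"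
      by (simp add: power_inverse power_mult[symmetric])
    also have "cosh y ^ 4 = exp (4 * lc y)"
      using cp by (simp add: exp_of_nat_mult[of 4 "lc y", simplified])
    finally have e: "(1 - (tanh y)\<^sup>2)\<^sup>2 = exp (- (4 * lc y))" by (simp only: exp_minus)
    have "- (2 * A) * z\<^sup>2 = - (2 * y\<^sup>2)" by (simp add: y_def power_mult_distrib s2)
    then have "exp (- (2 * A) * z\<^sup>2) \<le> exp (- (4 * lc y))" using lc_le_square[of y] by simp
    also have "\<dots> = 1 * exp (- (4 * lc y))" by simp
    also have "\<dots> \<le> exp (m * lc y) * exp (- (4 * lc y))"
      using m lc_nonneg[of y] by (intro mult_right_mono) auto
    finally show "exp (- (2 * A) * z\<^sup>2) \<le> exp (m * lc (0 + s * z)) * (1 - (tanh (0 + s * z))\<^sup>2)\<^sup>2"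
      unfolding e[unfolded y_def] y_def .
  qed (use Npos in simp)
  finally show ?thesis by (simp add: A_def s_def)
qed

end

section \<open>Conclusion\<close>

text \<open>Here \<open>X = \<xi> 1\<close>, \<open>B = \<xi>' 1\<close>, \<open>x = \<xi> q\<close> and \<open>A = \<xi>' q\<close>; with \<open>p = B / X\<close> and \<open>w = 2 powr p\<close> one has
  \<open>sqrt A > 32 / 3 * w\<close>, while stability of the atom \<open>q\<close> would give \<open>sqrt A \<le> 9 * w\<close>.\<close>

lemma numeric_contradiction:
  fixes X B x A :: real
  assumes X: "0 < X" "2 * X \<le> B" and x: "x \<le> X" "2 * x \<le> A" and A: "A \<le> B"
    and hyp: "1 / 3 * sqrt B * 2 powr (B / X + 5) < X"
    and energy: "X - x \<le> 2 * sqrt (2 * ln 2 * X) + sqrt B"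
    and stable: "A \<le> sqrt (1 + 4 * A) * (2 * 2 powr (A / x))"
  shows False
proof -
  define p where "p = B / X"
  define w where "w = 2 powr p"
  have p: "2 \<le> p" "B = p * X" using X by (simp_all add: p_def field_simps)
  have w4: "4 \<le> w"
  proof -
    have "(2::real) powr 2 \<le> 2 powr p" using p by (intro powr_mono) auto
    then show ?thesis by (simp add: w_def)
  qed
  have ln2: "ln 2 \<le> (1::real)" using ln_le_minus_one[of 2] by simp
  \<comment> \<open>Tangent of the exponential at \<open>p = 1\<close>, with
    \<open>ln 2 \<ge> 1 / 2\<close>.\<close>
  have pw: "p \<le> w"
  proof -
    have "1 + (p - 1) * ln 2 \<le> exp ((p - 1) * ln 2)" by (rule exp_ge_add_one_self)
    also have "\<dots> = w / 2" by (simp add: w_def powr_def left_diff_distrib exp_diff)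
    finally have "2 + 2 * ((p - 1) * ln 2) \<le> w" by (simp add: mult.commute)
    moreover have "(p - 1) * (1 / 2) \<le> (p - 1) * ln 2"
      using p ln_le_minus_one[of "1 / 2"] by (intro mult_left_mono) (auto simp: ln_div)
    ultimately show ?thesis by argo
  qed
  \<comment> \<open>\<open>2 powr 5 = 32\<close>; all later constants are paid for by this
    margin.\<close>
  have h: "sqrt B * w * 32 < 3 * X"
    using hyp by (simp add: p_def[symmetric] powr_add w_def[symmetric] powr_numeral)
  have B0: "0 < B" using X by simp
  have sB: "sqrt B * 32 * 4 < 3 * X"
  proof -
    have "sqrt B * 32 * 4 \<le> sqrt B * 32 * w" using B0 w4 by (intro mult_left_mono) auto
    then show ?thesis using h by (simp add: mult_ac)
  qed
  have "ln 2 * X \<le> 1 * X" using ln2 X by (intro mult_right_mono) auto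
  then have "2 * ln 2 * X \<le> B" using X by argo
  then have "sqrt (2 * ln 2 * X) \<le> sqrt B" by simp
  then have def: "X - x \<le> 3 * sqrt B" using energy by linarith
  \<comment> \<open>\<open>sB\<close>, where \<open>w \<ge> 4\<close> was used, makes
    \<open>3 * sqrt B\<close> smaller than \<open>9 * X / 128\<close>.\<close>
  have x_ge: "X * (1 - 9 / 128) \<le> x" using def sB by simp
  have x0: "0 < x" using x_ge X by (simp add: zero_less_mult_iff)
  have AX: "X \<le> A" using x_ge x X by simp
  have A0: "0 < A" using AX X by simp
  have "(X - x) * w * 32 \<le> 9 * X"
  proof -
    have "(X - x) * (w * 32) \<le> (3 * sqrt B) * (w * 32)" using def w4 by (intro mult_right_mono) auto
    also have "\<dots> = 3 * (sqrt B * w * 32)" by simp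
    also have "\<dots> \<le> 9 * X" using h by linarith
    finally show ?thesis by (simp add: mult_ac)
  qed
  then have dw: "(X - x) * (w * 32) \<le> 9 * X" by (simp add: mult_ac)
  have "A / x \<le> p + 1"
  proof -
    \<comment> \<open>\<open>p \<le> w\<close> and \<open>1 \<le> w / 4\<close> give the factor 5/4.
      Passing from \<open>p\<close> to \<open>A / x\<close> thus costs at most 1 in the exponent,
      one more factor 2.\<close>
    have "(X - x) * ((p + 1) * 32) \<le> (X - x) * (w * (5 / 4) * 32)"
      using pw w4 x by (intro mult_left_mono) auto
    also have "\<dots> = ((X - x) * (w * 32)) * (5 / 4)" by simp
    also have "\<dots> \<le> 9 * X * (5 / 4)" using dw by (intro mult_right_mono) auto
    also have "\<dots> \<le> 32 * X" using X by simp
    finally have "32 * ((X - x) * (p + 1)) \<le> 32 * X" by (simp only: mult_ac)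
    then have "(X - x) * (p + 1) \<le> X" by linarith
    then have "p * X \<le> (p + 1) * x" by (simp add: algebra_simps)
    then have "A \<le> (p + 1) * x" using A p by simp
    then show ?thesis using x0 by (simp add: divide_le_eq)
  qed
  then have "2 powr (A / x) \<le> 2 powr (p + 1)" by (intro powr_mono) auto
  then have pw2: "2 powr (A / x) \<le> 2 * w" by (simp add: powr_add w_def)
  have sX: "32 * w < 3 * sqrt X"
  proof -
    have "sqrt X \<le> sqrt B" using X by simp
    then have "sqrt X * (w * 32) \<le> sqrt B * (w * 32)" using w4 by (intro mult_right_mono) auto
    also have "\<dots> < 3 * X" using h by (simp add: mult_ac)
    also have "3 * X = sqrt X * (3 * sqrt X)" using X by simp
    finally show ?thesis using X by (simp add: mult_less_cancel_left_pos mult_ac)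
  qed
  have sA: "sqrt X \<le> sqrt A" using AX by simp
  have "1 \<le> sqrt A" using sX sA w4 by linarith
  then have A1: "1 \<le> A" by simp
  \<comment> \<open>\<open>(9 / 4)\<^sup>2\<close> is a square above 5, and
    \<open>1 + 4 * A \<le> 5 * A\<close>. Together with two factors 2 this produces the final 9,
    below 32/3.\<close>
  have "sqrt (1 + 4 * A) \<le> sqrt ((9 / 4)\<^sup>2 * A)" using A1 by (simp add: power2_eq_square)
  also have "\<dots> = 9 / 4 * sqrt A" by (simp add: real_sqrt_mult)
  finally have "sqrt (1 + 4 * A) * (2 * 2 powr (A / x)) \<le> (9 / 4 * sqrt A) * (2 * (2 * w))"
    using pw2 A0 by (intro mult_mono mult_left_mono) auto
  with stable have "A \<le> sqrt A * (9 * w)" by (simp add: mult_ac)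
  then have "sqrt A * sqrt A \<le> sqrt A * (9 * w)" using A0 by simp
  moreover have "0 < sqrt A" using A0 by simp
  ultimately have "sqrt A \<le> 9 * w" by (simp only: mult_le_cancel_left_pos)
  then show False using sX sA w4 by linarith
qed

theorem theorem3:
  fixes \<beta> :: "nat \<Rightarrow> real" and \<xi> :: "real \<Rightarrow> real" and \<mu> :: "real measure"
  assumes "summable (\<lambda>p. 2 ^ (p + 2) * (\<beta> (p + 2))\<^sup>2)"
    and "\<xi> = mixture \<beta>"
    and "\<xi> 1 > max (8 * ln 2)
           (1 / 3 * sqrt (deriv \<xi> 1) * 2 powr (deriv \<xi> 1 / \<xi> 1 + 5))"
    and "parisi_measure \<xi> \<mu>"
  shows "\<not> replica_symmetric \<mu> \<and> \<not> one_step_rsb \<mu>"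
proof -
  have ln2: "0 < ln (2::real)" by simp
  have X8: "8 * ln 2 < \<xi> 1" using assms(3) by simp
  interpret mixture_model \<beta> \<xi>
    by unfold_locales (use assms X8 ln2 in linarith)+
  have min: "parisi_functional \<xi> \<mu> \<le> parisi_functional \<xi> \<nu>" if "\<nu> \<in> prob_measures" for \<nu>
    using assms(4) that by (auto simp: parisi_measure_def)
  have min1: "parisi_functional \<xi> \<mu> \<le> P1 q" if "0 \<le> q" "q \<le> 1" for q
    using exists_P1[OF that] min by metis
  have min2: "parisi_functional \<xi> \<mu> \<le> P2 a b m" if "0 \<le> a" "a < b" "b \<le> 1" "0 < m" "m < 1" for a b m
    using exists_P2[OF that] min by metis
  have min3: "parisi_functional \<xi> \<mu> \<le> P3 b c m n" if "0 < b" "b < c" "c \<le> 1" "0 < m" "m < n" "n < 1" for b c m n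
    using exists_P3[OF that] min by metis
  have "\<not> replica_symmetric \<mu>"
  proof
    assume "replica_symmetric \<mu>"
    then obtain q where q: "0 \<le> q" "q \<le> 1" and val: "parisi_functional \<xi> \<mu> = P1 q"
      by (rule replica_symmetric_P1)
    show False
    proof (cases "q = 0")
      case True
      have "P1 0 = 1 / 2 * \<xi> 1" using theta_1 by (simp add: P1_def xi'_0 theta_0 field_simps)
      \<comment> \<open>The trial value at mass 1/2 lies below \<open>\<xi> 1 / 2\<close> as soon as
        \<open>\<xi> 1 > 4 * ln 2\<close>.\<close>
      moreover have "P2 0 1 (1 / 2) \<le> ln 2 + \<xi> 1 / 4" using P2_0_1_le[of "1 / 2"] by simp
      moreover have "P1 0 \<le> P2 0 1 (1 / 2)" using min2[of 0 1 "1 / 2"] val True by simp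
      ultimately show False using X8 ln2 by linarith
    next
      case False
      then have q0: "0 < q" using q by simp
      define s where "s = sqrt (\<xi>' 1 - \<xi>' q)"
      have s2: "s\<^sup>2 = \<xi>' 1 - \<xi>' q" using xi'_mono[of q 1] q by (simp add: s_def)
      have stat: "gE (\<lambda>z. (tilt 1 s (sqrt (\<xi>' q) * z) tanh)\<^sup>2) \<le> q"
      \<comment> \<open>At \<open>q = 1\<close> no move to the right is left, but then
        \<open>|tilt tanh| \<le> 1\<close> is the claim.\<close>
      proof (cases "q = 1")
        case True
        have "gE (\<lambda>z. (tilt 1 s (sqrt (\<xi>' q) * z) tanh)\<^sup>2) \<le> gE (\<lambda>z. 1)"
          by (rule gE_mono) (use tilt_tanh_abs_le in \<open>auto intro!: exp_growth_const exp_growth_power exp_growth_tilt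
             tanh_continuous abs_tanh_le_1 simp: abs_square_le_1\<close>)
        then show ?thesis using True by simp
      next
        case False
        then have q1: "q < 1" using q by simp
        show ?thesis unfolding s_def
        proof (rule lower_atom_stationary[OF q0 q1])
          fix a' assume a': "q < a'" "a' < 1"
          then show "P2 q 1 1 \<le> P2 a' 1 1"
            using min1[of a'] val P1_eq_P2[of q] P1_eq_P2[of a'] q by simp
        qed auto
      qed
      show False
      \<comment> \<open>The Dirac measure is the case \<open>m = 1\<close> with an empty upper atom
        at 1. Mass \<open>e\<close> moved to 0 gives the two-atom measure \<open>P2 0 q e\<close>,
        up to the constant \<open>s\<^sup>2 / 2\<close> that weight 1 adds on both sides.\<close>
      proof (rule lower_atom_unstable[of q 1 1 1 s])
        fix e :: real assume e: "0 < e" "e < 1"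
        have el: "exp_growth (\<lambda>z. lc (sqrt (\<xi>' q) * z))"
          using exp_growth_affine[OF exp_growth_lc, of 0] by simp
        have "P1 q \<le> P2 0 q e" using min2[of 0 q e] val q0 q e by simp
        then have 1: "gE (\<lambda>z. lc (sqrt (\<xi>' q) * z)) \<le> lc_pot e (sqrt (\<xi>' q)) 0 - 1 / 2 * e * \<theta> q"
          unfolding P1_def P2_zero by (simp add: algebra_simps)
        have "lc_pot 1 s = (\<lambda>x. lc x + s\<^sup>2 / 2)" by (auto simp: lc_pot_1)
        then have "gauss_step e (\<xi>' q) (lc_pot 1 s) 0 = lc_pot e (sqrt (\<xi>' q)) 0 + s\<^sup>2 / 2"
          using e by (simp add: gauss_step_add_const exp_growth_lc exp_growth_exp_lc gauss_step_lc_pot del: exp_ln)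
        moreover have "gE (\<lambda>z. lc_pot 1 s (sqrt (\<xi>' q) * z)) = gE (\<lambda>z. lc (sqrt (\<xi>' q) * z)) + s\<^sup>2 / 2"
          unfolding lc_pot_1 by (simp add: gE_add el exp_growth_const)
        ultimately show "gE (\<lambda>z. lc_pot 1 s (sqrt (\<xi>' q) * z))
          \<le> gauss_step e (\<xi>' q) (lc_pot 1 s) 0 - 1 / 2 * e * \<theta> q" using 1 by linarith
      qed (use q q0 stat in auto)
    qed
  qed
  moreover have "\<not> one_step_rsb \<mu>"
  proof
    assume "one_step_rsb \<mu>"
    then obtain a b m where ab: "0 \<le> a" "a < b" "b \<le> 1" and m: "0 < m" "m < 1"
      and val: "parisi_functional \<xi> \<mu> = P2 a b m"
      by (rule one_step_rsb_P2)
    show False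
    proof (cases "a = 0")
      case False
      then have a0: "0 < a" using ab by simp
      define s where "s = sqrt (\<xi>' b - \<xi>' a)"
      show False
      \<comment> \<open>The atom \<open>a\<close> has mass \<open>m\<close>, so \<open>e\<close>
        ranges below \<open>m\<close>; the competitor has masses \<open>e\<close>,
        \<open>m - e\<close>, \<open>1 - m\<close> at 0, \<open>a\<close>, \<open>b\<close>.\<close>
      proof (rule lower_atom_unstable[of a b m m s])
        show "gE (\<lambda>z. (tilt m s (sqrt (\<xi>' a) * z) tanh)\<^sup>2) \<le> a"
          unfolding s_def
        proof (rule lower_atom_stationary[OF a0 ab(2,3) m(1)])
          fix a' assume "a < a'" "a' < b"
          then show "P2 a b m \<le> P2 a' b m" using min2[of a' b m] val ab m by simp
        qed (use m in auto)
        fix e assume e: "0 < e" "e < m"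
        have "P2 a b m \<le> P3 a b e m" using min3[of a b e m] val a0 ab m e by simp
        then show "gE (\<lambda>z. lc_pot m s (sqrt (\<xi>' a) * z)) \<le> gauss_step e (\<xi>' a) (lc_pot m s) 0 - 1 / 2 * e * \<theta> a"
          unfolding P2_def P3_def s_def by (simp add: algebra_simps)
      qed (use a0 ab m in auto)
    next
      case True
      define q where "q = b"
      have q: "0 < q" "q \<le> 1" using ab True by (auto simp: q_def)
      have opt: "parisi_functional \<xi> \<mu> = P2 0 q m" using val True by (simp add: q_def)
      have wb: "m\<^sup>2 * \<xi> q \<le> 2 * ln 2"
        by (rule weight_bound[OF q m]) (use min2[of 0 q] opt q m in auto)
      have G1: "q \<le> tilt m (sqrt (\<xi>' q)) 0 (\<lambda>y. (tanh y)\<^sup>2)" (is "q \<le> ?\<Gamma>")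
        by (rule upper_atom_stationary[OF q m]) (use min2[of 0 _ m] opt q m in auto)
      let ?G = "tilt m (sqrt (\<xi>' q)) 0 (\<lambda>y. (1 - (tanh y)\<^sup>2)\<^sup>2)"
      have et: "exp_growth (\<lambda>y. (tanh y)\<^sup>2)" "exp_growth (\<lambda>y. 1 - (tanh y)\<^sup>2)"
        by (intro exp_growth_intros exp_growth_tanh)+
      have "(tilt m (sqrt (\<xi>' q)) 0 (\<lambda>y. 1 - (tanh y)\<^sup>2))\<^sup>2 \<le> ?G" by (rule tilt_square_le[OF et(2)])
      moreover have "tilt m (sqrt (\<xi>' q)) 0 (\<lambda>y. 1 - (tanh y)\<^sup>2) = 1 - ?\<Gamma>"
        by (simp add: tilt_diff exp_growth_const et tilt_const)
      ultimately have GG: "(1 - ?\<Gamma>)\<^sup>2 \<le> ?G" by simp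
      \<comment> \<open>Strictness of \<open>tanh\<^sup>2 < 1\<close> gives
        \<open>q \<le> ?\<Gamma> < 1\<close>, the room to the right of \<open>q\<close> that the
        splitting needs.\<close>
      have "0 < tilt m (sqrt (\<xi>' q)) 0 (\<lambda>y. 1 - (tanh y)\<^sup>2)"
        unfolding tilt_def
      proof (intro divide_pos_pos gE_pos lc_moment_pos exp_growth_weighted et)
        fix z
        have "(tanh (0 + sqrt (\<xi>' q) * z))\<^sup>2 < 1"
          using tanh_real_lt_1 tanh_real_gt_neg1 by (auto simp: abs_square_less_1 abs_less_iff minus_less_iff)
        then show "0 < exp (m * lc (0 + sqrt (\<xi>' q) * z)) * (1 - (tanh (0 + sqrt (\<xi>' q) * z))\<^sup>2)"
          by (intro mult_pos_pos) auto
      qed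
      then have "?\<Gamma> < 1" using \<open>tilt m (sqrt (\<xi>' q)) 0 (\<lambda>y. 1 - (tanh y)\<^sup>2) = 1 - ?\<Gamma>\<close> by simp
      then have q1: "q < 1" using G1 by linarith
      have o3: "P2 0 q m \<le> P3 q q' m n" if "q < q'" "q' \<le> 1" "m < n" "n < 1" for q' n
        using min3[of q q' m n] opt that q m by simp
      have G2: "?\<Gamma> \<le> q" and stab: "?G \<le> 1 / \<xi>'' q"
        using upper_atom_stable[OF q(1) q1 m o3 G1] by blast+
      define A where "A = \<xi>' q"
      have A: "0 < A" unfolding A_def using q by (rule xi'_pos)
      have A2: "A \<le> \<xi>'' q" unfolding A_def using xi'_le_xi''[of q] q by simp
      have "1 / \<xi>'' q \<le> 1 / A" using A A2 by (intro divide_left_mono) auto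
      then have GA: "?G \<le> 1 / A" using stab by linarith
      \<comment> \<open>Cauchy-Schwarz with the stability bound controls \<open>1 - q\<close>; this
        turns the loss \<open>(1 - q) * \<xi>' q\<close> in \<open>P2_zero_ge\<close> into at most
        \<open>sqrt (\<xi>' 1)\<close>.\<close>
      have "(1 - q)\<^sup>2 \<le> (1 - ?\<Gamma>)\<^sup>2" using G2 q by (intro power_mono) auto
      then have "(1 - q)\<^sup>2 \<le> 1 / A" using GG GA by linarith
      then have "(1 - q)\<^sup>2 * A\<^sup>2 \<le> 1 / A * A\<^sup>2" by (intro mult_right_mono) auto
      then have "((1 - q) * A)\<^sup>2 \<le> A" using A by (simp add: power_mult_distrib power2_eq_square)
      then have sA: "(1 - q) * A \<le> sqrt A" by (rule real_le_rsqrt)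
      have AB: "A \<le> \<xi>' 1" unfolding A_def using xi'_mono[of q 1] q by simp
      \<comment> \<open>The minimiser of \<open>ln 2 / m + m * \<xi> 1 / 2\<close>, where both terms
        are equal; \<open>8 * ln 2 < \<xi> 1\<close> keeps it below 1.\<close>
      define m0 where "m0 = sqrt (2 * ln 2 / \<xi> 1)"
      have m0: "0 < m0" "m0 < 1" "m0\<^sup>2 = 2 * ln 2 / \<xi> 1"
        using X8 ln2 xi1_pos by (auto simp: m0_def)
      have m0X: "m0 * \<xi> 1 = sqrt (2 * ln 2 * \<xi> 1)"
      proof -
        have "(m0 * \<xi> 1)\<^sup>2 = 2 * ln 2 * \<xi> 1"
          unfolding power_mult_distrib m0(3) using xi1_pos by (simp add: power2_eq_square)
        then show ?thesis using m0 xi1_pos by (metis abs_of_pos mult_pos_pos real_sqrt_abs)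
      qed
      have "ln 2 / m0 = m0 * \<xi> 1 / 2"
      proof -
        have "m0 * (m0 * \<xi> 1) = m0\<^sup>2 * \<xi> 1" by (simp add: power2_eq_square)
        also have "\<dots> = 2 * ln 2" unfolding m0(3) using xi1_pos by simp
        finally have "m0 * (m0 * \<xi> 1) = 2 * ln 2" .
        then show ?thesis using m0(1) by (simp add: field_simps)
      qed
      then have "P2 0 1 m0 \<le> sqrt (2 * ln 2 * \<xi> 1) - ln 2"
        using P2_0_1_le[of m0] m0 m0X by simp
      moreover have "P2 0 q m \<le> P2 0 1 m0" using min2[of 0 1 m0] opt m0 by simp
      moreover have "1 / 2 * (\<xi> 1 - \<xi> q - (1 - q) * A) - ln 2 \<le> P2 0 q m"
        unfolding A_def using m by (intro P2_zero_ge q) auto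
      moreover have "sqrt A \<le> sqrt (\<xi>' 1)" using AB by simp
      ultimately have energy: "\<xi> 1 - \<xi> q \<le> 2 * sqrt (2 * ln 2 * \<xi> 1) + sqrt (\<xi>' 1)"
        using sA by argo
      have "1 / (sqrt (1 + 4 * A) * (2 * 2 powr (A / \<xi> q))) \<le> 1 / A"
        using gardner_lower_bound[OF q m(1) less_imp_le[OF m(2)] wb] GA unfolding A_def by linarith
      then have "A \<le> sqrt (1 + 4 * A) * (2 * 2 powr (A / \<xi> q))"
        using A by (simp add: field_simps)
      moreover have "2 * \<xi> q \<le> A"
      proof -
        have "q * A \<le> 1 * A" using q A by (intro mult_right_mono) auto
        then show ?thesis using xi_le[of q] q unfolding A_def by linarith
      qed
      moreover have "2 * \<xi> 1 \<le> \<xi>' 1" using xi_le[of 1] by simp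
      moreover have "\<xi> q \<le> \<xi> 1" using xi_mono[of q 1] q by simp
      ultimately show False
        using numeric_contradiction[of "\<xi> 1" "\<xi>' 1" "\<xi> q" A] xi1_pos AB energy assms(3) by simp
    qed
  qed
  ultimately show ?thesis by simp
qed

end
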